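(* For any two convenient base points $\bar z_1, \bar z_2$, and any isomorphism $\iota \colon \bar z_1 \rightarrow \bar z_2$, we have $C_{\bar z_2} \circ \iota = C_{\bar z_1}$. Thus $E_2$ is isomorphic to the fundamental group $\pi_1(\mathcal{E}_\epsilon(\tilde{\mathbf{G}}), \bar F)$, as defined in [Weissman, "L-groups and parameters for covering groups", Theorem 19.7, Remark 19.8].
   Context: Setting: $\mathbf{G}$ is a pinned split reductive group over a local or global field $F$, $\tilde{\mathbf{G}}$ a degree $n$ Brylinski–Deligne cover with invariants $(Q,\mathcal{D},f)$, $\#\mu_n(F)=n$ (and $Q$ even-valued if $n$ odd), and $\epsilon\colon\mu_n(F)\hookrightarrow\mathbb{C}^\times$ a fixed injective character. $Y_{Q,n}\supset Y_{Q,n}^{\mathrm{SC}}$ are the lattices of the dual group's root datum, $\tilde Z^\vee=\Hom(Y_{Q,n}/Y_{Q,n}^{\mathrm{SC}},\mathbb{C}^\times)$, $\hat T=\Hom(Y_{Q,n},\bar F^\times)$, $\hat Z=\Hom(Y_{Q,n}/Y_{Q,n}^{\mathrm{SC}},\bar F^\times)$. $\bar D_{Q,n}$ is the preimage of $Y_{Q,n}$ in $\mathcal{D}(\bar F)$, $D_{Q,n}$ its $\mathrm{Gal}_F$-fixed points, and $s_\psi$ the pinning-determined splitting over $Y^{\mathrm{SC}}_{Q,n}$. A convenient base point of the gerbe $\mathcal{E}_\epsilon(\tilde{\mathbf{G}})$ is the $\bar F$-object $\bar z=(\hat T,h,j_0)$ determined by a choice of splitting $s$ of $\bar D_{Q,n}$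 restricting to $s_\psi$ (with $h(x)=x^n\ast s$ and $j_0$ sending $1$ to $\psi$). An isomorphism $\iota\colon\bar z_1\to\bar z_2$ (base points from $s_1,s_2$) induces an isomorphism of fundamental groups $\pi_1^{\mathrm{et}}(\mathcal{E}_\epsilon(\tilde{\mathbf{G}}),\bar z_1)\to\pi_1^{\mathrm{et}}(\mathcal{E}_\epsilon(\tilde{\mathbf{G}}),\bar z_2)$, also denoted $\iota$. Here $\pi_1^{\mathrm{et}}(\mathcal{E}_\epsilon(\tilde{\mathbf{G}}),\bar z)=\bigsqcup_{\gamma\in\mathrm{Gal}_F}\Hom(\bar z,{}^\gamma\bar z)$, with elements of $\Hom(\bar z,{}^\gamma\bar z)$ being pairs $(\tau,\zeta)\in\hat T\times\tilde Z^\vee$ with $\tau^n=\gamma^{-1}s/s$, $\tau\in\hat Z$, modulo $(\tau,\zeta)\sim(\xi\tau,\epsilon(\xi)^{-1}\zeta)$, $\xi\in\hat Z_{[n]}$. $E_2$ is the Gan–Gao second twist, an extension of $\mathrm{Gal}_F$ by $\tilde Z^\vee$ whose fibre over $\gamma$ consists of homomorphisms $\chi\colon D_{Q,n}\to\mathbb{C}^\times$ trivial on $s_\psi(Y^{\mathrm{SC}}_{Q,n})$ with $\chi(u)=\epsilon(\gamma^{-1}\sqrt[n]{u}/\sqrt[n]{u})$ for $u\in F^\times$. For a convenient base point $\bar z$ (from $s$), $C_{\bar z}\colon\pi_1^{\mathrm{et}}(\mathcal{E}_\epsilon(\tilde{\mathbf{G}}),\bar z)\to E_2$ is the isomorphism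 of extensions given on the fibre over $\gamma$ by $C_\gamma(\tau,\zeta)(s(y)\cdot u)=\epsilon\left(\frac{\gamma^{-1}\sqrt[n]{u}}{\sqrt[n]{u}}\cdot\tau(y)\right)\cdot\zeta(y)$. The base-point-free ("Platonic") fundamental group $\pi_1(\mathcal{E}_\epsilon(\tilde{\mathbf{G}}),\bar F)$ is defined using that the induced isomorphisms of fundamental groups do not depend on the choice of isomorphism between base points.
   Formalization: Hom(z̄, ᵞz̄) is taken in the gerbe itself: τ need not lie in Ẑ, only be n-torsion on Y^SC with ε(τ)ζ = 1 there, since requiring τ ∈ Ẑ can leave fibres empty (e.g. PGL_2, n = 2, Q = 0); it agrees with the given description whenever a τ ∈ Ẑ exists. *)

theory Defs
  imports "HOL-Analysis.Analysis" "HOL-Algebra.Group"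
    "HOL-Computational_Algebra.Computational_Algebra"
begin

section \<open>Local and global fields, separable closures, Galois groups\<close>

text \<open>The base field \<open>F\<close> is a subfield of a field type \<open>'k\<close>, which plays the role of
  the separable closure of \<open>F\<close>.\<close>

definition is_subfield :: "'k::field set \<Rightarrow> bool" where
  "is_subfield K \<longleftrightarrow> 0 \<in> K \<and> 1 \<in> K \<and>
     (\<forall>x\<in>K. \<forall>y\<in>K. x + y \<in> K \<and> x * y \<in> K) \<and> (\<forall>x\<in>K. - x \<in> K \<and> inverse x \<in> K)"

definition field_gen :: "'k::field set \<Rightarrow> 'k set" where
  "field_gen S = \<Inter>{K. is_subfield K \<and> S \<subseteq> K}"

definition finite_extension :: "'k::field set \<Rightarrow> 'k set \<Rightarrow> bool" where
  "finite_extension K L \<longleftrightarrow> K \<subseteq> L \<and>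
     (\<exists>B. finite B \<and> B \<subseteq> L \<and> (\<forall>x\<in>L. \<exists>c. (\<forall>b\<in>B. c b \<in> K) \<and> x = (\<Sum>b\<in>B. c b * b)))"

definition transcendental_over :: "'k::field set \<Rightarrow> 'k \<Rightarrow> bool" where
  "transcendental_over K t \<longleftrightarrow> (\<forall>p. p \<noteq> 0 \<longrightarrow> (\<forall>i. coeff p i \<in> K) \<longrightarrow> poly p t \<noteq> 0)"

definition global_field :: "'k::field set \<Rightarrow> bool" where
  "global_field F \<longleftrightarrow> is_subfield F \<and>
     (CHAR('k) = 0 \<and> finite_extension (field_gen {}) F \<or>
      CHAR('k) \<noteq> 0 \<and> (\<exists>t\<in>F. transcendental_over (field_gen {}) t \<and>
                          finite_extension (field_gen {t}) F))"

definition local_field :: "'k::field set \<Rightarrow> bool" where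
  "local_field F \<longleftrightarrow> is_subfield F \<and>
     (\<exists>T. topspace T = F \<and> Hausdorff_space T \<and> locally_compact_space T \<and>
        T \<noteq> discrete_topology F \<and>
        continuous_map (prod_topology T T) T (\<lambda>(x, y). x + y) \<and>
        continuous_map (prod_topology T T) T (\<lambda>(x, y). x * y) \<and>
        continuous_map T T uminus \<and>
        continuous_map (subtopology T (F - {0})) T inverse)"

definition separable_poly :: "'k::field poly \<Rightarrow> bool" where
  "separable_poly p \<longleftrightarrow> coprime p (pderiv p)"

definition separable_closure_of :: "'k::field set \<Rightarrow> bool" where
  "separable_closure_of F \<longleftrightarrow>
     (\<forall>x::'k. \<exists>p. p \<noteq> 0 \<and> (\<forall>i. coeff p i \<in> F) \<and> separable_poly p \<and> poly p x = 0) \<and>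
     (\<forall>p::'k poly. 0 < degree p \<longrightarrow> separable_poly p \<longrightarrow> (\<exists>x. poly p x = 0))"

definition gal :: "'k::field set \<Rightarrow> ('k \<Rightarrow> 'k) set" where
  "gal F = {\<gamma>. bij \<gamma> \<and> (\<forall>x y. \<gamma> (x + y) = \<gamma> x + \<gamma> y) \<and> (\<forall>x y. \<gamma> (x * y) = \<gamma> x * \<gamma> y) \<and>
               (\<forall>x\<in>F. \<gamma> x = x)}"

abbreviation ginv :: "('k \<Rightarrow> 'k) \<Rightarrow> 'k \<Rightarrow> 'k" where
  "ginv \<gamma> \<equiv> inv_into UNIV \<gamma>"

definition mu_n :: "nat \<Rightarrow> 'k::field set \<Rightarrow> 'k set" where
  "mu_n n F = {x\<in>F. x ^ n = 1}"


section \<open>Lattices, root data, quadratic forms\<close>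

definition zsc :: "int \<Rightarrow> 'y::ab_group_add \<Rightarrow> 'y" where
  "zsc k y = (if 0 \<le> k then (((+) y) ^^ nat k) 0 else - (((+) y) ^^ nat (- k)) 0)"

definition zspan :: "'y::ab_group_add set \<Rightarrow> 'y set" where
  "zspan S = \<Inter>{L. 0 \<in> L \<and> (\<forall>x\<in>L. \<forall>y\<in>L. x + y \<in> L) \<and> (\<forall>x\<in>L. - x \<in> L) \<and> S \<subseteq> L}"

definition free_of_finite_rank :: "'y::ab_group_add itself \<Rightarrow> bool" where
  "free_of_finite_rank _ \<longleftrightarrow>
     (\<exists>B::'y set. finite B \<and>
        (\<forall>y. \<exists>!c. (\<forall>b. b \<notin> B \<longrightarrow> c b = 0) \<and> y = (\<Sum>b\<in>B. zsc (c b) b)))"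

text \<open>The cocharacter lattice \<open>Y\<close> is the type \<open>'y\<close>, and the character lattice is
  \<open>X = Hom(Y, \<int>)\<close>, so that the pairing of \<open>\<alpha>\<close> and \<open>y\<close> is \<open>\<alpha> y\<close>.\<close>

definition reflection :: "(('y \<Rightarrow> int) \<Rightarrow> 'y) \<Rightarrow> ('y \<Rightarrow> int) \<Rightarrow> ('y \<Rightarrow> int) \<Rightarrow> ('y \<Rightarrow> int)" where
  "reflection coroot \<alpha> \<beta> = (\<lambda>y. \<beta> y - \<beta> (coroot \<alpha>) * \<alpha> y)"

definition coreflection ::
    "(('y::ab_group_add \<Rightarrow> int) \<Rightarrow> 'y) \<Rightarrow> ('y \<Rightarrow> int) \<Rightarrow> 'y \<Rightarrow> 'y" where
  "coreflection coroot \<alpha> y = y - zsc (\<alpha> y) (coroot \<alpha>)"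

definition based_root_datum ::
    "('y::ab_group_add \<Rightarrow> int) set \<Rightarrow> (('y \<Rightarrow> int) \<Rightarrow> 'y) \<Rightarrow> ('y \<Rightarrow> int) set \<Rightarrow> bool" where
  "based_root_datum \<Phi> coroot \<Delta> \<longleftrightarrow>
     free_of_finite_rank TYPE('y) \<and>
     finite \<Phi> \<and> (\<forall>\<alpha>\<in>\<Phi>. \<forall>x y. \<alpha> (x + y) = \<alpha> x + \<alpha> y) \<and>
     inj_on coroot \<Phi> \<and> (\<forall>\<alpha>\<in>\<Phi>. \<alpha> (coroot \<alpha>) = 2) \<and>
     (\<forall>\<alpha>\<in>\<Phi>. reflection coroot \<alpha> ` \<Phi> = \<Phi>) \<and>
     (\<forall>\<alpha>\<in>\<Phi>. coreflection coroot \<alpha> ` (coroot ` \<Phi>) = coroot ` \<Phi>) \<and>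
     (\<forall>\<alpha>\<in>\<Phi>. (\<lambda>y. 2 * \<alpha> y) \<notin> \<Phi>) \<and>
     \<Delta> \<subseteq> \<Phi> \<and>
     (\<forall>c :: ('y \<Rightarrow> int) \<Rightarrow> int. (\<forall>y. (\<Sum>\<alpha>\<in>\<Delta>. c \<alpha> * \<alpha> y) = 0) \<longrightarrow> (\<forall>\<alpha>\<in>\<Delta>. c \<alpha> = 0)) \<and>
     (\<forall>\<beta>\<in>\<Phi>. \<exists>c :: ('y \<Rightarrow> int) \<Rightarrow> int. (\<forall>y. \<beta> y = (\<Sum>\<alpha>\<in>\<Delta>. c \<alpha> * \<alpha> y)) \<and>
              ((\<forall>\<alpha>\<in>\<Delta>. 0 \<le> c \<alpha>) \<or> (\<forall>\<alpha>\<in>\<Delta>. c \<alpha> \<le> 0)))"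

definition polar :: "('y::ab_group_add \<Rightarrow> int) \<Rightarrow> 'y \<Rightarrow> 'y \<Rightarrow> int" where
  "polar Q x y = Q (x + y) - Q x - Q y"

definition quadratic_form :: "('y::ab_group_add \<Rightarrow> int) \<Rightarrow> bool" where
  "quadratic_form Q \<longleftrightarrow> (\<forall>m y. Q (zsc m y) = m\<^sup>2 * Q y) \<and>
     (\<forall>x x' y. polar Q (x + x') y = polar Q x y + polar Q x' y)"


section \<open>Brylinski--Deligne data\<close>

text \<open>An extension \<open>G\<^sub>m \<rightarrow> E \<rightarrow> L\<close> of a constant sheaf \<open>L \<subseteq> Y\<close> on the etale site of \<open>F\<close> is
  given by the group of its points over the separable closure together with its smooth
  Galois action.  Smoothness says that the stabiliser of each point contains the subgroup
  fixing a finite subset of the separable closure.\<close>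

record ('y, 'k, 'd) gext =
  grp :: "'d monoid"
  emb :: "'k \<Rightarrow> 'd"
  prj :: "'d \<Rightarrow> 'y"
  gact :: "('k \<Rightarrow> 'k) \<Rightarrow> 'd \<Rightarrow> 'd"

definition sgn_pow :: "int \<Rightarrow> 'k::field" where
  "sgn_pow k = (if even k then 1 else - 1)"

definition gm_extension :: "'k::field set \<Rightarrow> 'y::ab_group_add set \<Rightarrow> ('y, 'k, 'd) gext \<Rightarrow> bool" where
  "gm_extension F L E \<longleftrightarrow>
     group (grp E) \<and>
     (\<forall>u. u \<noteq> 0 \<longrightarrow> emb E u \<in> carrier (grp E)) \<and>
     (\<forall>u v. u \<noteq> 0 \<longrightarrow> v \<noteq> 0 \<longrightarrow> emb E (u * v) = emb E u \<otimes>\<^bsub>grp E\<^esub> emb E v) \<and>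
     inj_on (emb E) (- {0}) \<and>
     (\<forall>u. \<forall>a\<in>carrier (grp E). u \<noteq> 0 \<longrightarrow> emb E u \<otimes>\<^bsub>grp E\<^esub> a = a \<otimes>\<^bsub>grp E\<^esub> emb E u) \<and>
     prj E ` carrier (grp E) = L \<and>
     (\<forall>a\<in>carrier (grp E). \<forall>b\<in>carrier (grp E). prj E (a \<otimes>\<^bsub>grp E\<^esub> b) = prj E a + prj E b) \<and>
     {a \<in> carrier (grp E). prj E a = 0} = emb E ` (- {0}) \<and>
     (\<forall>\<gamma>\<in>gal F. gact E \<gamma> \<in> hom (grp E) (grp E)) \<and>
     (\<forall>a\<in>carrier (grp E). gact E id a = a) \<and>
     (\<forall>\<gamma>\<in>gal F. \<forall>\<delta>\<in>gal F. \<forall>a\<in>carrier (grp E). gact E (\<gamma> \<circ> \<delta>) a = gact E \<gamma> (gact E \<delta> a)) \<and>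
     (\<forall>\<gamma>\<in>gal F. \<forall>u. u \<noteq> 0 \<longrightarrow> gact E \<gamma> (emb E u) = emb E (\<gamma> u)) \<and>
     (\<forall>\<gamma>\<in>gal F. \<forall>a\<in>carrier (grp E). prj E (gact E \<gamma> a) = prj E a) \<and>
     (\<forall>a\<in>carrier (grp E). \<exists>S. finite S \<and>
        (\<forall>\<gamma>\<in>gal F. (\<forall>x\<in>S. \<gamma> x = x) \<longrightarrow> gact E \<gamma> a = a))"

definition has_commutator ::
    "('y, 'k::field, 'd) gext \<Rightarrow> ('y \<Rightarrow> 'y \<Rightarrow> int) \<Rightarrow> bool" where
  "has_commutator E B \<longleftrightarrow>
     (\<forall>a\<in>carrier (grp E). \<forall>b\<in>carrier (grp E).
        a \<otimes>\<^bsub>grp E\<^esub> b = emb E (sgn_pow (B (prj E a) (prj E b))) \<otimes>\<^bsub>grp E\<^esub> (b \<otimes>\<^bsub>grp E\<^esub> a))"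

text \<open>\<open>DQ\<close> is the canonical extension of the coroot lattice attached to \<open>Q\<close>. The pinning
  provides it with \<open>F\<close>-rational lifts \<open>sQ \<alpha>\<close> of the simple coroots, and \<open>(DQ, sQ)\<close> is unique up to
  unique isomorphism.  The third invariant \<open>f\<close> is \<open>fmap : DQ \<rightarrow> D\<close>.\<close>

record ('y, 'k, 'd, 'e) bd_data =
  base :: "'k set"
  deg :: nat
  eps :: "'k \<Rightarrow> complex"
  roots :: "('y \<Rightarrow> int) set"
  coroot :: "('y \<Rightarrow> int) \<Rightarrow> 'y"
  simple :: "('y \<Rightarrow> int) set"
  Qf :: "'y \<Rightarrow> int"
  Dx :: "('y, 'k, 'd) gext"
  DQ :: "('y, 'k, 'e) gext"
  sQ :: "('y \<Rightarrow> int) \<Rightarrow> 'e"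
  fmap :: "'e \<Rightarrow> 'd"

definition bd_setting :: "('y::ab_group_add, 'k::field, 'd, 'e) bd_data \<Rightarrow> bool" where
  "bd_setting C \<longleftrightarrow>
     (local_field (base C) \<or> global_field (base C)) \<and>
     separable_closure_of (base C) \<and>
     0 < deg C \<and> card (mu_n (deg C) (base C)) = deg C \<and>
     (\<forall>x\<in>mu_n (deg C) (base C). \<forall>y\<in>mu_n (deg C) (base C). eps C (x * y) = eps C x * eps C y) \<and>
     (\<forall>x\<in>mu_n (deg C) (base C). eps C x \<noteq> 0) \<and>
     inj_on (eps C) (mu_n (deg C) (base C)) \<and>
     based_root_datum (roots C) (coroot C) (simple C) \<and>
     quadratic_form (Qf C) \<and>
     (\<forall>\<alpha>\<in>roots C. \<forall>y. Qf C (coreflection (coroot C) \<alpha> y) = Qf C y) \<and>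
     (odd (deg C) \<longrightarrow> (\<forall>y. even (Qf C y))) \<and>
     gm_extension (base C) UNIV (Dx C) \<and>
     has_commutator (Dx C) (polar (Qf C)) \<and>
     gm_extension (base C) (zspan (coroot C ` roots C)) (DQ C) \<and>
     has_commutator (DQ C) (polar (Qf C)) \<and>
     (\<forall>\<alpha>\<in>simple C. sQ C \<alpha> \<in> carrier (grp (DQ C)) \<and> prj (DQ C) (sQ C \<alpha>) = coroot C \<alpha> \<and>
        (\<forall>\<gamma>\<in>gal (base C). gact (DQ C) \<gamma> (sQ C \<alpha>) = sQ C \<alpha>)) \<and>
     fmap C \<in> hom (grp (DQ C)) (grp (Dx C)) \<and>
     (\<forall>u. u \<noteq> 0 \<longrightarrow> fmap C (emb (DQ C) u) = emb (Dx C) u) \<and>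
     (\<forall>a\<in>carrier (grp (DQ C)). prj (Dx C) (fmap C a) = prj (DQ C) a) \<and>
     (\<forall>\<gamma>\<in>gal (base C). \<forall>a\<in>carrier (grp (DQ C)).
        fmap C (gact (DQ C) \<gamma> a) = gact (Dx C) \<gamma> (fmap C a))"


section \<open>The lattices of the dual group, characters and splittings\<close>

definition YQn :: "('y::ab_group_add, 'k, 'd, 'e) bd_data \<Rightarrow> 'y set" where
  "YQn C = {y. \<forall>y'. int (deg C) dvd polar (Qf C) y y'}"

definition n_root :: "('y, 'k, 'd, 'e) bd_data \<Rightarrow> ('y \<Rightarrow> int) \<Rightarrow> int" where
  "n_root C \<alpha> = int (deg C) div gcd (int (deg C)) (Qf C (coroot C \<alpha>))"

definition YSC :: "('y::ab_group_add, 'k, 'd, 'e) bd_data \<Rightarrow> 'y set" where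
  "YSC C = zspan ((\<lambda>\<alpha>. zsc (n_root C \<alpha>) (coroot C \<alpha>)) ` roots C)"

text \<open>Characters and splittings over a sublattice \<open>L\<close> are extended by \<open>1\<close> outside \<open>L\<close>.  Hence
  the group operations on characters are the pointwise ones.\<close>

definition chars :: "'y::ab_group_add set \<Rightarrow> ('y \<Rightarrow> 'a::field) set" where
  "chars L = {\<theta>. (\<forall>x\<in>L. \<forall>y\<in>L. \<theta> (x + y) = \<theta> x * \<theta> y) \<and> (\<forall>x\<in>L. \<theta> x \<noteq> 0) \<and>
                 (\<forall>x. x \<notin> L \<longrightarrow> \<theta> x = 1)}"

definition res :: "'y set \<Rightarrow> ('y \<Rightarrow> 'a::one) \<Rightarrow> 'y \<Rightarrow> 'a" where
  "res L \<theta> = (\<lambda>y. if y \<in> L then \<theta> y else 1)"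

definition fmult :: "('y \<Rightarrow> 'a::times) \<Rightarrow> ('y \<Rightarrow> 'a) \<Rightarrow> 'y \<Rightarrow> 'a" where
  "fmult \<theta> \<theta>' = (\<lambda>y. \<theta> y * \<theta>' y)"

definition That :: "('y::ab_group_add, 'k::field, 'd, 'e) bd_data \<Rightarrow> ('y \<Rightarrow> 'k) set" where
  "That C = chars (YQn C)"

definition That_SC :: "('y::ab_group_add, 'k::field, 'd, 'e) bd_data \<Rightarrow> ('y \<Rightarrow> 'k) set" where
  "That_SC C = chars (YSC C)"

definition Zhat :: "('y::ab_group_add, 'k::field, 'd, 'e) bd_data \<Rightarrow> ('y \<Rightarrow> 'k) set" where
  "Zhat C = {\<tau> \<in> That C. \<forall>y\<in>YSC C. \<tau> y = 1}"

definition Ttilde :: "('y::ab_group_add, 'k, 'd, 'e) bd_data \<Rightarrow> ('y \<Rightarrow> complex) set" where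
  "Ttilde C = chars (YQn C)"

definition Ttilde_SC :: "('y::ab_group_add, 'k, 'd, 'e) bd_data \<Rightarrow> ('y \<Rightarrow> complex) set" where
  "Ttilde_SC C = chars (YSC C)"

definition Ztilde :: "('y::ab_group_add, 'k, 'd, 'e) bd_data \<Rightarrow> ('y \<Rightarrow> complex) set" where
  "Ztilde C = {\<zeta> \<in> Ttilde C. \<forall>y\<in>YSC C. \<zeta> y = 1}"

definition tors :: "nat \<Rightarrow> ('y \<Rightarrow> 'k::field) set \<Rightarrow> ('y \<Rightarrow> 'k) set" where
  "tors n A = {\<xi> \<in> A. \<forall>y. \<xi> y ^ n = 1}"

definition splittings ::
    "('y::ab_group_add, 'k, 'd, 'e) bd_data \<Rightarrow> 'y set \<Rightarrow> ('y \<Rightarrow> 'd) set" where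
  "splittings C L = {s.
     (\<forall>y\<in>L. s y \<in> carrier (grp (Dx C)) \<and> prj (Dx C) (s y) = y) \<and>
     (\<forall>x\<in>L. \<forall>y\<in>L. s (x + y) = s x \<otimes>\<^bsub>grp (Dx C)\<^esub> s y) \<and>
     (\<forall>y. y \<notin> L \<longrightarrow> s y = \<one>\<^bsub>grp (Dx C)\<^esub>)}"

definition s_psi :: "('y::ab_group_add, 'k, 'd, 'e) bd_data \<Rightarrow> 'y \<Rightarrow> 'd" where
  "s_psi C = (THE s. s \<in> splittings C (YSC C) \<and>
     (\<forall>\<alpha>\<in>simple C. s (zsc (n_root C \<alpha>) (coroot C \<alpha>)) =
        fmap C (sQ C \<alpha>) [^]\<^bsub>grp (Dx C)\<^esub> n_root C \<alpha>))"

definition D_Qn :: "('y::ab_group_add, 'k::field, 'd, 'e) bd_data \<Rightarrow> 'd set" where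
  "D_Qn C = {d \<in> carrier (grp (Dx C)). prj (Dx C) d \<in> YQn C \<and>
               (\<forall>\<gamma>\<in>gal (base C). gact (Dx C) \<gamma> d = d)}"


section \<open>The fibre of the gerbe over the separable closure\<close>

text \<open>The gerbe of \<open>n\<close>-th roots of the torsor of splittings over \<open>Y\<^sub>Q\<^sub>,\<^sub>n\<close> is banded by the
  \<open>n\<close>-torsion of \<open>That\<close>.  Its pushforward along \<open>\<epsilon>\<close> is banded by \<open>Ttilde\<close>: a morphism is a class of
  pairs \<open>(f, \<zeta>)\<close> with \<open>(\<xi> f, \<zeta>) \<sim> (f, \<epsilon>(\<xi>) \<zeta>)\<close> for \<open>\<xi>\<close> in the \<open>n\<close>-torsion.  The same holds over
  \<open>Y\<^sup>S\<^sup>C\<^sub>Q\<^sub>,\<^sub>n\<close>, where the Whittaker object is trivialised over \<open>F\<close> by the character \<open>\<psi>\<close> of the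
  pinning: it becomes \<open>w = (That_SC, x \<mapsto> x\<^sup>n * s\<^sub>\<psi>)\<close>, with \<open>\<psi>\<close> corresponding to \<open>1\<close>.

  An object is a triple \<open>(H, h, j)\<close>, where \<open>H\<close> is a torsor under \<open>That\<close>, the map \<open>h\<close> sends \<open>H\<close>
  to the splittings with \<open>h (t x) = t\<^sup>n * h x\<close>, and \<open>j\<close> is a morphism of the pushed-forward gerbe over
  \<open>Y\<^sup>S\<^sup>C\<^sub>Q\<^sub>,\<^sub>n\<close> from the image of \<open>(H, h)\<close> to \<open>w\<close>.  A morphism out of the induced \<open>That_SC\<close>-torsor is
  given by an equivariant map \<open>H \<rightarrow> That_SC\<close>, and \<open>jcls\<close> is the class of such pairs.\<close>

record ('h, 'y, 'k, 'd) gobj =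
  tor :: "'h set"
  tact :: "('y \<Rightarrow> 'k) \<Rightarrow> 'h \<Rightarrow> 'h"
  hmap :: "'h \<Rightarrow> 'y \<Rightarrow> 'd"
  jcls :: "(('h \<Rightarrow> 'y \<Rightarrow> 'k) \<times> ('y \<Rightarrow> complex)) set"

definition j_class ::
    "('y::ab_group_add, 'k::field, 'd, 'e) bd_data \<Rightarrow> 'h set \<Rightarrow>
     ('h \<Rightarrow> 'y \<Rightarrow> 'k) \<Rightarrow> ('y \<Rightarrow> complex) \<Rightarrow> (('h \<Rightarrow> 'y \<Rightarrow> 'k) \<times> ('y \<Rightarrow> complex)) set" where
  "j_class C H j \<zeta> =
     (\<lambda>\<xi>. (\<lambda>x\<in>H. fmult \<xi> (j x), \<lambda>y. inverse (eps C (\<xi> y)) * \<zeta> y)) ` tors (deg C) (That_SC C)"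

definition is_object ::
    "('y::ab_group_add, 'k::field, 'd, 'e) bd_data \<Rightarrow> ('h, 'y, 'k, 'd) gobj \<Rightarrow> bool" where
  "is_object C z \<longleftrightarrow>
     tor z \<noteq> {} \<and>
     (\<forall>t\<in>That C. \<forall>x\<in>tor z. tact z t x \<in> tor z) \<and>
     (\<forall>x\<in>tor z. tact z (\<lambda>_. 1) x = x) \<and>
     (\<forall>t\<in>That C. \<forall>t'\<in>That C. \<forall>x\<in>tor z. tact z (fmult t t') x = tact z t (tact z t' x)) \<and>
     (\<forall>x\<in>tor z. \<forall>x'\<in>tor z. \<exists>!t. t \<in> That C \<and> tact z t x = x') \<and>
     (\<forall>x\<in>tor z. hmap z x \<in> splittings C (YQn C)) \<and>
     (\<forall>t\<in>That C. \<forall>x\<in>tor z. \<forall>y.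
        hmap z (tact z t x) y = emb (Dx C) (t y ^ deg C) \<otimes>\<^bsub>grp (Dx C)\<^esub> hmap z x y) \<and>
     (\<exists>j \<zeta>.
        (\<forall>x\<in>tor z. j x \<in> That_SC C) \<and>
        (\<forall>t\<in>That C. \<forall>x\<in>tor z. j (tact z t x) = fmult (res (YSC C) t) (j x)) \<and>
        (\<forall>x\<in>tor z. \<forall>y\<in>YSC C.
           emb (Dx C) (j x y ^ deg C) \<otimes>\<^bsub>grp (Dx C)\<^esub> s_psi C y = hmap z x y) \<and>
        \<zeta> \<in> Ttilde_SC C \<and> jcls z = j_class C (tor z) j \<zeta>)"

text \<open>Torsors are taken with underlying set in the type of \<open>That\<close>; up to isomorphism these are
  all torsors.\<close>

definition objects ::
    "('y::ab_group_add, 'k::field, 'd, 'e) bd_data \<Rightarrow> ('y \<Rightarrow> 'k, 'y, 'k, 'd) gobj set" where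
  "objects C = {z. is_object C z}"

type_synonym ('h, 'y) gmor = "(('h \<Rightarrow> 'h) \<times> ('y \<Rightarrow> complex)) set"

definition mor_class ::
    "('y::ab_group_add, 'k::field, 'd, 'e) bd_data \<Rightarrow> ('h, 'y, 'k, 'd) gobj \<Rightarrow>
     ('h, 'y, 'k, 'd) gobj \<Rightarrow> ('h \<Rightarrow> 'h) \<Rightarrow> ('y \<Rightarrow> complex) \<Rightarrow> ('h, 'y) gmor" where
  "mor_class C z z' f \<zeta> =
     (\<lambda>\<xi>. (\<lambda>x\<in>tor z. tact z' \<xi> (f x), \<lambda>y. inverse (eps C (\<xi> y)) * \<zeta> y)) ` tors (deg C) (That C)"

text \<open>The last condition says that the composite of \<open>j\<close> of the target with the morphism is
  \<open>j\<close> of the source.\<close>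

definition Mor ::
    "('y::ab_group_add, 'k::field, 'd, 'e) bd_data \<Rightarrow> ('h, 'y, 'k, 'd) gobj \<Rightarrow>
     ('h, 'y, 'k, 'd) gobj \<Rightarrow> ('h, 'y) gmor set" where
  "Mor C z z' = {mor_class C z z' f \<zeta> | f \<zeta>.
     f \<in> tor z \<rightarrow> tor z' \<and>
     (\<forall>t\<in>That C. \<forall>x\<in>tor z. f (tact z t x) = tact z' t (f x)) \<and>
     (\<forall>x\<in>tor z. hmap z' (f x) = hmap z x) \<and>
     \<zeta> \<in> Ttilde C \<and>
     (\<forall>(j, \<zeta>')\<in>jcls z'. (compose (tor z) j f, fmult \<zeta>' (res (YSC C) \<zeta>)) \<in> jcls z)}"

definition mor_id ::
    "('y::ab_group_add, 'k::field, 'd, 'e) bd_data \<Rightarrow> ('h, 'y, 'k, 'd) gobj \<Rightarrow> ('h, 'y) gmor" where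
  "mor_id C z = mor_class C z z id (\<lambda>_. 1)"

definition mor_comp ::
    "('h, 'y, 'k, 'd) gobj \<Rightarrow> ('h, 'y) gmor \<Rightarrow> ('h, 'y) gmor \<Rightarrow> ('h, 'y) gmor" where
  "mor_comp z m' m = {(compose (tor z) f' f, fmult \<zeta>' \<zeta>) | f \<zeta> f' \<zeta>'. (f, \<zeta>) \<in> m \<and> (f', \<zeta>') \<in> m'}"

definition mor_inv ::
    "('h, 'y, 'k, 'd) gobj \<Rightarrow> ('h, 'y, 'k, 'd) gobj \<Rightarrow> ('h, 'y) gmor \<Rightarrow> ('h, 'y) gmor" where
  "mor_inv z z' m = (\<lambda>(f, \<zeta>). (\<lambda>x\<in>tor z'. inv_into (tor z) f x, \<lambda>y. inverse (\<zeta> y))) ` m"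

text \<open>The conjugate object has the same underlying set, with \<open>u *\<^sub>\<gamma> x = \<gamma>\<^sup>-\<^sup>1(u) * x\<close>,
  and \<open>h\<close>, \<open>j\<close> are composed with \<open>\<gamma>\<close>.  Galois acts trivially on \<open>Ttilde\<close>, and on
  the \<open>n\<close>-torsion of \<open>That\<close> because the \<open>n\<close>-th roots of unity lie in \<open>F\<close>.  Therefore conjugating a
  morphism does not change the class of pairs representing it.\<close>

definition conj_obj ::
    "('y, 'k, 'd, 'e) bd_data \<Rightarrow> ('k \<Rightarrow> 'k) \<Rightarrow> ('h, 'y, 'k, 'd) gobj \<Rightarrow> ('h, 'y, 'k, 'd) gobj" where
  "conj_obj C \<gamma> z =
     \<lparr>tor = tor z,
      tact = (\<lambda>t. tact z (ginv \<gamma> \<circ> t)),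
      hmap = (\<lambda>x y. gact (Dx C) \<gamma> (hmap z x y)),
      jcls = (\<lambda>(j, \<zeta>). (\<lambda>x\<in>tor z. \<gamma> \<circ> j x, \<zeta>)) ` jcls z\<rparr>"

definition conj_mor :: "('k \<Rightarrow> 'k) \<Rightarrow> ('h, 'y) gmor \<Rightarrow> ('h, 'y) gmor" where
  "conj_mor \<gamma> m = m"


section \<open>Fundamental groups\<close>

definition pi1 ::
    "('y::ab_group_add, 'k::field, 'd, 'e) bd_data \<Rightarrow> ('h, 'y, 'k, 'd) gobj \<Rightarrow>
     (('k \<Rightarrow> 'k) \<times> ('h, 'y) gmor) monoid" where
  "pi1 C z =
     \<lparr>carrier = (SIGMA \<gamma>:gal (base C). Mor C z (conj_obj C \<gamma> z)),
      mult = (\<lambda>(\<gamma>, m) (\<gamma>', m'). (\<gamma> \<circ> \<gamma>', mor_comp z (conj_mor \<gamma> m') m)),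
      one = (id, mor_id C z)\<rparr>"

definition pi1_incl ::
    "('y::ab_group_add, 'k::field, 'd, 'e) bd_data \<Rightarrow> ('h, 'y, 'k, 'd) gobj \<Rightarrow> ('y \<Rightarrow> complex) \<Rightarrow>
     ('k \<Rightarrow> 'k) \<times> ('h, 'y) gmor" where
  "pi1_incl C z \<zeta> = (id, mor_class C z z id \<zeta>)"

definition pi1_map ::
    "('h, 'y, 'k, 'd) gobj \<Rightarrow> ('h, 'y, 'k, 'd) gobj \<Rightarrow> ('h, 'y) gmor \<Rightarrow>
     ('k \<Rightarrow> 'k) \<times> ('h, 'y) gmor \<Rightarrow> ('k \<Rightarrow> 'k) \<times> ('h, 'y) gmor" where
  "pi1_map z z' \<iota> =
     (\<lambda>(\<gamma>, m). (\<gamma>, mor_comp z' (conj_mor \<gamma> \<iota>) (mor_comp z' m (mor_inv z z' \<iota>))))"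

text \<open>The base-point-free fundamental group: the limit of the groups \<open>pi1 C z\<close> over all base points
  \<open>z\<close> and all isomorphisms between them.\<close>

definition pi1_platonic ::
    "('y::ab_group_add, 'k::field, 'd, 'e) bd_data \<Rightarrow>
     (('y \<Rightarrow> 'k, 'y, 'k, 'd) gobj \<Rightarrow> ('k \<Rightarrow> 'k) \<times> ('y \<Rightarrow> 'k, 'y) gmor) monoid" where
  "pi1_platonic C =
     \<lparr>carrier = {g \<in> (\<Pi>\<^sub>E z\<in>objects C. carrier (pi1 C z)).
        \<forall>z\<in>objects C. \<forall>z'\<in>objects C. \<forall>\<iota>\<in>Mor C z z'. pi1_map z z' \<iota> (g z) = g z'},
      mult = (\<lambda>g g'. \<lambda>z\<in>objects C. g z \<otimes>\<^bsub>pi1 C z\<^esub> g' z),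
      one = (\<lambda>z\<in>objects C. \<one>\<^bsub>pi1 C z\<^esub>)\<rparr>"


section \<open>The second twist and the comparison map\<close>

text \<open>Homomorphisms on \<open>D_Qn C\<close> are extended by \<open>1\<close>.\<close>

definition E2 ::
    "('y::ab_group_add, 'k::field, 'd, 'e) bd_data \<Rightarrow> (('k \<Rightarrow> 'k) \<times> ('d \<Rightarrow> complex)) monoid" where
  "E2 C =
     \<lparr>carrier = {(\<gamma>, \<theta>). \<gamma> \<in> gal (base C) \<and>
        (\<forall>d\<in>D_Qn C. \<theta> d \<noteq> 0) \<and>
        (\<forall>d\<in>D_Qn C. \<forall>d'\<in>D_Qn C. \<theta> (d \<otimes>\<^bsub>grp (Dx C)\<^esub> d') = \<theta> d * \<theta> d') \<and>
        (\<forall>d. d \<notin> D_Qn C \<longrightarrow> \<theta> d = 1) \<and>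
        (\<forall>y\<in>YSC C. \<theta> (s_psi C y) = 1) \<and>
        (\<forall>u\<in>base C - {0}. \<forall>v. v ^ deg C = u \<longrightarrow> \<theta> (emb (Dx C) u) = eps C (ginv \<gamma> v / v))},
      mult = (\<lambda>(\<gamma>, \<theta>) (\<gamma>', \<theta>'). (\<gamma> \<circ> \<gamma>', fmult \<theta> \<theta>')),
      one = (id, \<lambda>_. 1)\<rparr>"

definition E2_incl ::
    "('y::ab_group_add, 'k::field, 'd, 'e) bd_data \<Rightarrow> ('y \<Rightarrow> complex) \<Rightarrow>
     ('k \<Rightarrow> 'k) \<times> ('d \<Rightarrow> complex)" where
  "E2_incl C \<zeta> = (id, \<lambda>d. if d \<in> D_Qn C then \<zeta> (prj (Dx C) d) else 1)"

definition convenient_splittings ::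
    "('y::ab_group_add, 'k, 'd, 'e) bd_data \<Rightarrow> ('y \<Rightarrow> 'd) set" where
  "convenient_splittings C = {s \<in> splittings C (YQn C). \<forall>y\<in>YSC C. s y = s_psi C y}"

definition base_point ::
    "('y::ab_group_add, 'k::field, 'd, 'e) bd_data \<Rightarrow> ('y \<Rightarrow> 'd) \<Rightarrow> ('y \<Rightarrow> 'k, 'y, 'k, 'd) gobj" where
  "base_point C s =
     \<lparr>tor = That C,
      tact = fmult,
      hmap = (\<lambda>x y. emb (Dx C) (x y ^ deg C) \<otimes>\<^bsub>grp (Dx C)\<^esub> s y),
      jcls = j_class C (That C) (res (YSC C)) (\<lambda>_. 1)\<rparr>"

text \<open>A map of torsors \<open>f\<close> from \<open>That\<close> to its \<open>\<gamma>\<close>-conjugate corresponds to the element \<open>\<tau> = f 1\<close>,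
  with \<open>f x = \<gamma>\<^sup>-\<^sup>1(x) \<tau>\<close>.\<close>

definition C_pair ::
    "('y::ab_group_add, 'k::field, 'd, 'e) bd_data \<Rightarrow> ('y \<Rightarrow> 'd) \<Rightarrow> ('k \<Rightarrow> 'k) \<Rightarrow>
     ('y \<Rightarrow> 'k) \<Rightarrow> ('y \<Rightarrow> complex) \<Rightarrow> 'd \<Rightarrow> complex" where
  "C_pair C s \<gamma> \<tau> \<zeta> d =
     (if d \<in> D_Qn C then
        let y = prj (Dx C) d;
            u = (THE u. u \<noteq> 0 \<and> d = s y \<otimes>\<^bsub>grp (Dx C)\<^esub> emb (Dx C) u);
            v = (SOME v. v ^ deg C = u)
        in eps C (ginv \<gamma> v / v * \<tau> y) * \<zeta> y
      else 1)"

definition C_map ::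
    "('y::ab_group_add, 'k::field, 'd, 'e) bd_data \<Rightarrow> ('y \<Rightarrow> 'd) \<Rightarrow>
     ('k \<Rightarrow> 'k) \<times> ('y \<Rightarrow> 'k, 'y) gmor \<Rightarrow> ('k \<Rightarrow> 'k) \<times> ('d \<Rightarrow> complex)" where
  "C_map C s = (\<lambda>(\<gamma>, m). let (f, \<zeta>) = (SOME p. p \<in> m) in (\<gamma>, C_pair C s \<gamma> (f (\<lambda>_. 1)) \<zeta>))"



section \<open>Morphisms from a convenient base point to its conjugates\<close>

text \<open>\<open>tau_mor C s \<gamma> \<tau> \<zeta>\<close> is the morphism given by the pair \<open>(\<tau>, \<zeta>)\<close>.  As soon as one morphism has
  \<open>\<tau> \<in> Zhat\<close>, all of them are represented by pairs in \<open>Zhat \<times> Ztilde\<close>, modulo the \<open>n\<close>-torsion of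
  \<open>Zhat\<close>.  In general the restriction of \<open>\<tau>\<close> to \<open>Y\<^sup>S\<^sup>C\<^sub>Q\<^sub>,\<^sub>n\<close> is only \<open>n\<close>-torsion, and \<open>\<zeta>\<close>
  compensates for it: the restriction map from the \<open>n\<close>-torsion of \<open>That\<close> to that of \<open>That_SC\<close> need
  not be surjective.\<close>

definition tau_mor ::
    "('y::ab_group_add, 'k::field, 'd, 'e) bd_data \<Rightarrow> ('y \<Rightarrow> 'd) \<Rightarrow> ('k \<Rightarrow> 'k) \<Rightarrow>
     ('y \<Rightarrow> 'k) \<Rightarrow> ('y \<Rightarrow> complex) \<Rightarrow> ('y \<Rightarrow> 'k, 'y) gmor" where
  "tau_mor C s \<gamma> \<tau> \<zeta> =
     mor_class C (base_point C s) (conj_obj C \<gamma> (base_point C s)) (\<lambda>x. fmult (ginv \<gamma> \<circ> x) \<tau>) \<zeta>"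

definition nth_root_cond ::
    "('y::ab_group_add, 'k::field, 'd, 'e) bd_data \<Rightarrow> ('y \<Rightarrow> 'd) \<Rightarrow> ('k \<Rightarrow> 'k) \<Rightarrow>
     ('y \<Rightarrow> 'k) \<Rightarrow> bool" where
  "nth_root_cond C s \<gamma> \<tau> \<longleftrightarrow>
     (\<forall>y. emb (Dx C) (\<tau> y ^ deg C) \<otimes>\<^bsub>grp (Dx C)\<^esub> s y = gact (Dx C) (ginv \<gamma>) (s y))"

lemma gal_simps:
  assumes "\<gamma> \<in> gal F"
  shows "\<gamma> (x * y) = \<gamma> x * \<gamma> y" "\<gamma> 1 = 1" "\<gamma> 0 = 0" "\<gamma> (x ^ k) = \<gamma> x ^ k"
    "\<gamma> (ginv \<gamma> x) = x" "ginv \<gamma> (\<gamma> x) = x" "\<gamma> x = 0 \<longleftrightarrow> x = 0"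
proof -
  have b: "bij \<gamma>" and m: "\<And>x y. \<gamma> (x * y) = \<gamma> x * \<gamma> y" and a: "\<And>x y. \<gamma> (x + y) = \<gamma> x + \<gamma> y"
    using assms by (auto simp: gal_def)
  show "\<gamma> (x * y) = \<gamma> x * \<gamma> y" by (rule m)
  show z: "\<gamma> 0 = 0" using a[of 0 0] by (metis add.right_neutral add_left_cancel)
  show zz: "\<gamma> x = 0 \<longleftrightarrow> x = 0" for x using b z by (metis bij_pointE)
  show o: "\<gamma> 1 = 1" using m[of 1 1] zz[of 1] by simp
  show "\<gamma> (x ^ k) = \<gamma> x ^ k" by (induction k) (auto simp: o m)
  show "\<gamma> (ginv \<gamma> x) = x" using b by (simp add: bij_is_surj surj_f_inv_f)
  show "ginv \<gamma> (\<gamma> x) = x" using b by (simp add: bij_is_inj)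
qed

lemma ginv_gal:
  assumes "\<gamma> \<in> gal F"
  shows "ginv \<gamma> \<in> gal F"
proof -
  have b: "bij \<gamma>" using assms by (auto simp: gal_def)
  have inj: "inj \<gamma>" using b bij_is_inj by auto
  show ?thesis unfolding gal_def
  proof (safe)
    show "bij (ginv \<gamma>)" using b by (rule bij_imp_bij_inv)
    fix x y
    show "ginv \<gamma> (x + y) = ginv \<gamma> x + ginv \<gamma> y"
      by (rule injD[OF inj]) (use assms gal_simps[OF assms] in \<open>auto simp: gal_def\<close>)
    show "ginv \<gamma> (x * y) = ginv \<gamma> x * ginv \<gamma> y"
      by (rule injD[OF inj]) (use gal_simps[OF assms] in \<open>auto\<close>)
  next
    fix x assume "x \<in> F"
    then have "\<gamma> x = x" using assms by (simp add: gal_def)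
    then show "ginv \<gamma> x = x" using gal_simps(6)[OF assms, of x] by simp
  qed
qed

lemma mu_n_closed:
  fixes x :: "'k::field"
  assumes "card (mu_n n F) = n" "0 < n" "x ^ n = 1"
  shows "x \<in> mu_n n F"
proof -
  define p :: "'k poly" where "p = monom 1 n - 1"
  have d: "degree p = n"
    unfolding p_def using assms(2)
    by (metis degree_1 degree_add_eq_left degree_minus degree_monom_eq one_neq_zero
        uminus_add_conv_diff add.commute)
  have p0: "p \<noteq> 0" using d assms(2) by auto
  have eq: "{x. poly p x = 0} = {x. x ^ n = 1}" by (auto simp: p_def poly_monom)
  have "finite {x::'k. x ^ n = 1}" "card {x::'k. x ^ n = 1} \<le> n"
    using poly_roots_finite[OF p0] card_poly_roots_bound[OF p0] d eq by auto
  moreover have "mu_n n F \<subseteq> {x. x ^ n = 1}" by (auto simp: mu_n_def)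
  ultimately have "mu_n n F = {x. x ^ n = 1}" using assms(1) by (metis card_seteq)
  with assms(3) show ?thesis by auto
qed

lemma bd_settingD:
  assumes "bd_setting C"
  shows "0 < deg C" "card (mu_n (deg C) (base C)) = deg C"
    "\<forall>x\<in>mu_n (deg C) (base C). \<forall>y\<in>mu_n (deg C) (base C). eps C (x * y) = eps C x * eps C y"
    "\<forall>x\<in>mu_n (deg C) (base C). eps C x \<noteq> 0"
    "based_root_datum (roots C) (coroot C) (simple C)"
    "quadratic_form (Qf C)"
    "\<forall>\<alpha>\<in>roots C. \<forall>y. Qf C (coreflection (coroot C) \<alpha> y) = Qf C y"
    "gm_extension (base C) UNIV (Dx C)"
proof -
  note A = assms[unfolded bd_setting_def]
  show "0 < deg C"
    using A by (elim conjE)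
  show "card (mu_n (deg C) (base C)) = deg C"
    using A by (elim conjE)
  show "\<forall>x\<in>mu_n (deg C) (base C). \<forall>y\<in>mu_n (deg C) (base C). eps C (x * y) = eps C x * eps C y"
    using A by (elim conjE)
  show "\<forall>x\<in>mu_n (deg C) (base C). eps C x \<noteq> 0"
    using A by (elim conjE)
  show "based_root_datum (roots C) (coroot C) (simple C)"
    using A by (elim conjE)
  show "quadratic_form (Qf C)"
    using A by (elim conjE)
  show "\<forall>\<alpha>\<in>roots C. \<forall>y. Qf C (coreflection (coroot C) \<alpha> y) = Qf C y"
    using A by (elim conjE)
  show "gm_extension (base C) UNIV (Dx C)"
    using A by (elim conjE)
qed

lemma bd_eps:
  assumes "bd_setting C" "x ^ deg C = 1" "y ^ deg C = 1"
  shows "eps C (x * y) = eps C x * eps C y" "eps C x \<noteq> 0" "eps C 1 = 1"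
    "\<gamma> \<in> gal (base C) \<Longrightarrow> \<gamma> x = x"
proof -
  have m: "a \<in> mu_n (deg C) (base C)" if "a ^ deg C = 1" for a
    using bd_settingD(1,2)[OF assms(1)] that by (intro mu_n_closed)
  have h: "eps C (a * b) = eps C a * eps C b" if "a ^ deg C = 1" "b ^ deg C = 1" for a b
    using bd_settingD(3)[OF assms(1)] m[OF that(1)] m[OF that(2)] by blast
  have nz: "eps C a \<noteq> 0" if "a ^ deg C = 1" for a
    using bd_settingD(4)[OF assms(1)] m[OF that] by blast
  show "eps C (x * y) = eps C x * eps C y" "eps C x \<noteq> 0" using h nz assms by auto
  show "eps C 1 = 1" using h[of 1 1] nz[of 1] by simp
  show "\<gamma> x = x" if "\<gamma> \<in> gal (base C)" using m[OF assms(2)] that by (auto simp: mu_n_def gal_def)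
qed

lemma chars_nz: "t \<in> chars L \<Longrightarrow> t y \<noteq> 0"
  by (cases "y \<in> L") (auto simp: chars_def)

lemma chars_closed:
  "(\<lambda>_. 1) \<in> chars L"
  "t \<in> chars L \<Longrightarrow> t' \<in> chars L \<Longrightarrow> fmult t t' \<in> chars L"
  "t \<in> chars L \<Longrightarrow> (\<lambda>y. inverse (t y)) \<in> chars L"
  by (auto simp: chars_def fmult_def)

lemma chars_gal: "\<gamma> \<in> gal F \<Longrightarrow> t \<in> chars L \<Longrightarrow> \<gamma> \<circ> t \<in> chars L"
  by (auto simp: chars_def gal_simps[of \<gamma> F])

lemma chars_res:
  assumes "t \<in> chars L" "zspan S \<subseteq> L"
  shows "res (zspan S) t \<in> chars (zspan S)"
proof -
  have "x + y \<in> zspan S" if "x \<in> zspan S" "y \<in> zspan S" for x y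
    using that unfolding zspan_def by blast
  then show ?thesis using assms by (auto simp: chars_def res_def subset_iff)
qed

lemma YSC_subset_YQn:
  assumes "bd_setting C"
  shows "YSC C \<subseteq> YQn C"
proof -
  define Q where "Q = Qf C"
  define B where "B = polar Q"
  have q: "quadratic_form Q" and rd: "based_root_datum (roots C) (coroot C) (simple C)"
    and inv: "\<And>\<alpha> y. \<alpha> \<in> roots C \<Longrightarrow> Q (coreflection (coroot C) \<alpha> y) = Q y"
    using bd_settingD(5-7)[OF assms] by (simp_all add: Q_def)
  have Ba: "B (x + x') y = B x y + B x' y" for x x' y
    using q by (auto simp: quadratic_form_def B_def)
  have Bs: "B x y = B y x" for x y by (simp add: B_def polar_def add.commute)
  have B0: "B 0 y = 0" for y using Ba[of 0 0 y] by simp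
  have Bm: "B (- x) y = - B x y" for x y using Ba[of x "- x" y] B0[of y] by simp
  have Bp: "B ((((+) x) ^^ k) 0) y = int k * B x y" for k x y
    by (induction k) (auto simp: B0 Ba algebra_simps)
  have Bz: "B (zsc k x) y = k * B x y" for k x y
    by (cases "0 \<le> k") (auto simp: zsc_def Bp Bm)
  have Qp: "Q (x + y) = Q x + Q y + B x y" for x y by (simp add: B_def polar_def)
  have Qz: "Q (zsc k x) = k\<^sup>2 * Q x" for k x using q by (auto simp: quadratic_form_def)
  have Q2: "B x x = 2 * Q x" for x
  proof -
    have "zsc 2 x = x + x" by (simp add: zsc_def numeral_2_eq_2)
    then show ?thesis using Qz[of 2 x] Qp[of x x] by simp
  qed
  have key: "B (coroot C \<alpha>) y = \<alpha> y * Q (coroot C \<alpha>)" if \<alpha>: "\<alpha> \<in> roots C" for \<alpha> y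
  proof -
    let ?a = "coroot C \<alpha>"
    have add: "\<alpha> (x + y) = \<alpha> x + \<alpha> y" for x y using rd \<alpha> by (auto simp: based_root_datum_def)
    have two: "\<alpha> ?a = 2" using rd \<alpha> by (auto simp: based_root_datum_def)
    have nz: "B ?a y = \<alpha> y * Q ?a" if "\<alpha> y \<noteq> 0" for y
    proof -
      have Qm: "Q (- x) = Q x" for x
      proof -
        have "zsc (- 1) x = - x" by (simp add: zsc_def)
        then show ?thesis using Qz[of "- 1" x] by simp
      qed
      have "Q y = Q (y + - zsc (\<alpha> y) ?a)" using inv[OF \<alpha>, of y] by (simp add: coreflection_def)
      also have "\<dots> = Q y + (\<alpha> y)\<^sup>2 * Q ?a - \<alpha> y * B ?a y"
        by (subst Qp) (simp add: Qm Qz Bs[of y] Bm Bz)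
      finally have "\<alpha> y * (\<alpha> y * Q ?a - B ?a y) = 0"
        by (auto simp: power2_eq_square algebra_simps)
      with that show ?thesis by simp
    qed
    show ?thesis
    proof (cases "\<alpha> y = 0")
      case True
      then have "B ?a (y + ?a) = 2 * Q ?a" using nz[of "y + ?a"] add two by simp
      then have "B ?a y = 0" using Ba[of y ?a ?a] Bs Q2[of ?a] by simp
      with True show ?thesis by simp
    qed (rule nz)
  qed
  have gen: "int (deg C) dvd B (zsc (n_root C \<alpha>) (coroot C \<alpha>)) y" if "\<alpha> \<in> roots C" for \<alpha> y
  proof -
    have "n_root C \<alpha> * Q (coroot C \<alpha>) =
        int (deg C) * (Q (coroot C \<alpha>) div gcd (int (deg C)) (Q (coroot C \<alpha>)))"
      unfolding n_root_def Q_def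
      by (simp only: dvd_div_mult[OF gcd_dvd1] div_mult_swap[OF gcd_dvd2])
    then have "int (deg C) dvd n_root C \<alpha> * Q (coroot C \<alpha>)" by simp
    then show ?thesis by (simp add: Bz key[OF that] mult.assoc mult.left_commute)
  qed
  let ?L = "{y. \<forall>y'. int (deg C) dvd B y y'}"
  have "0 \<in> ?L" "\<forall>x\<in>?L. \<forall>y\<in>?L. x + y \<in> ?L" "\<forall>x\<in>?L. - x \<in> ?L" by (auto simp: B0 Ba Bm)
  moreover have "(\<lambda>\<alpha>. zsc (n_root C \<alpha>) (coroot C \<alpha>)) ` roots C \<subseteq> ?L" using gen by auto
  ultimately have "YSC C \<subseteq> ?L" unfolding YSC_def zspan_def by (intro Inter_lower) blast
  then show ?thesis by (simp add: YQn_def B_def Q_def)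
qed

lemma res_That:
  assumes "bd_setting C" "t \<in> That C"
  shows "res (YSC C) t \<in> That_SC C"
  using assms(2) YSC_subset_YQn[OF assms(1)] unfolding That_def That_SC_def YSC_def
  by (rule chars_res)

lemma gm_extensionD:
  assumes "gm_extension F L E"
  shows "group (grp E)"
    "u \<noteq> 0 \<Longrightarrow> emb E u \<in> carrier (grp E)"
    "u \<noteq> 0 \<Longrightarrow> v \<noteq> 0 \<Longrightarrow> emb E (u * v) = emb E u \<otimes>\<^bsub>grp E\<^esub> emb E v"
    "inj_on (emb E) (- {0})"
    "\<gamma> \<in> gal F \<Longrightarrow> gact E \<gamma> \<in> hom (grp E) (grp E)"
    "a \<in> carrier (grp E) \<Longrightarrow> gact E id a = a"
    "\<gamma> \<in> gal F \<Longrightarrow> \<delta> \<in> gal F \<Longrightarrow> a \<in> carrier (grp E) \<Longrightarrow>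
       gact E (\<gamma> \<circ> \<delta>) a = gact E \<gamma> (gact E \<delta> a)"
    "\<gamma> \<in> gal F \<Longrightarrow> u \<noteq> 0 \<Longrightarrow> gact E \<gamma> (emb E u) = emb E (\<gamma> u)"
proof -
  note A = assms[unfolded gm_extension_def]
  show "group (grp E)" using A by (elim conjE)
  show "inj_on (emb E) (- {0})" using A by (elim conjE)
  have "\<forall>u. u \<noteq> 0 \<longrightarrow> emb E u \<in> carrier (grp E)" using A by (elim conjE)
  then show "u \<noteq> 0 \<Longrightarrow> emb E u \<in> carrier (grp E)" by blast
  have "\<forall>u v. u \<noteq> 0 \<longrightarrow> v \<noteq> 0 \<longrightarrow> emb E (u * v) = emb E u \<otimes>\<^bsub>grp E\<^esub> emb E v"
    using A by (elim conjE)
  then show "u \<noteq> 0 \<Longrightarrow> v \<noteq> 0 \<Longrightarrow> emb E (u * v) = emb E u \<otimes>\<^bsub>grp E\<^esub> emb E v" by blast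
  have "\<forall>\<gamma>\<in>gal F. gact E \<gamma> \<in> hom (grp E) (grp E)" using A by (elim conjE)
  then show "\<gamma> \<in> gal F \<Longrightarrow> gact E \<gamma> \<in> hom (grp E) (grp E)" by blast
  have "\<forall>a\<in>carrier (grp E). gact E id a = a" using A by (elim conjE)
  then show "a \<in> carrier (grp E) \<Longrightarrow> gact E id a = a" by blast
  have "\<forall>\<gamma>\<in>gal F. \<forall>\<delta>\<in>gal F. \<forall>a\<in>carrier (grp E). gact E (\<gamma> \<circ> \<delta>) a = gact E \<gamma> (gact E \<delta> a)"
    using A by (elim conjE)
  then show "\<gamma> \<in> gal F \<Longrightarrow> \<delta> \<in> gal F \<Longrightarrow> a \<in> carrier (grp E) \<Longrightarrow>
       gact E (\<gamma> \<circ> \<delta>) a = gact E \<gamma> (gact E \<delta> a)" by blast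
  have "\<forall>\<gamma>\<in>gal F. \<forall>u. u \<noteq> 0 \<longrightarrow> gact E \<gamma> (emb E u) = emb E (\<gamma> u)" using A by (elim conjE)
  then show "\<gamma> \<in> gal F \<Longrightarrow> u \<noteq> 0 \<Longrightarrow> gact E \<gamma> (emb E u) = emb E (\<gamma> u)" by blast
qed

lemma Mor_base_point_conj:
  assumes C: "bd_setting C" and s: "s \<in> convenient_splittings C" and \<gamma>: "\<gamma> \<in> gal (base C)"
  shows "Mor C (base_point C s) (conj_obj C \<gamma> (base_point C s)) =
    {tau_mor C s \<gamma> \<tau> \<zeta> | \<tau> \<zeta>. \<tau> \<in> That C \<and> \<zeta> \<in> Ttilde C \<and> nth_root_cond C s \<gamma> \<tau> \<and>
       (\<forall>y\<in>YSC C. \<tau> y ^ deg C = 1 \<and> eps C (\<tau> y) * \<zeta> y = 1)}"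
    (is "Mor C ?z ?z' = ?R")
proof -
  let ?D = "grp (Dx C)" and ?e = "emb (Dx C)" and ?n = "deg C"
  let ?T = "tors (deg C) (That_SC C)"
  have ext: "gm_extension (base C) UNIV (Dx C)" using C by (rule bd_settingD)
  interpret group ?D using ext by (rule gm_extensionD)
  have e_in: "u \<noteq> 0 \<Longrightarrow> ?e u \<in> carrier ?D"
    and e_mult: "u \<noteq> 0 \<Longrightarrow> v \<noteq> 0 \<Longrightarrow> ?e (u * v) = ?e u \<otimes>\<^bsub>?D\<^esub> ?e v"
    and g_hom: "\<delta> \<in> gal (base C) \<Longrightarrow> gact (Dx C) \<delta> \<in> hom ?D ?D"
    and g_id: "a \<in> carrier ?D \<Longrightarrow> gact (Dx C) id a = a"
    and g_comp: "\<delta> \<in> gal (base C) \<Longrightarrow> \<delta>' \<in> gal (base C) \<Longrightarrow> a \<in> carrier ?D \<Longrightarrow>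
       gact (Dx C) (\<delta> \<circ> \<delta>') a = gact (Dx C) \<delta> (gact (Dx C) \<delta>' a)"
    and g_emb: "\<delta> \<in> gal (base C) \<Longrightarrow> u \<noteq> 0 \<Longrightarrow> gact (Dx C) \<delta> (?e u) = ?e (\<delta> u)"
    for u v \<delta> \<delta>' a
    by (fact gm_extensionD[OF ext])+
  have e1: "?e 1 = \<one>\<^bsub>?D\<^esub>"
    using e_mult[of 1 1] e_in[of 1] by (metis l_cancel_one mult_1 one_neq_zero)
  have \<gamma>': "ginv \<gamma> \<in> gal (base C)" using \<gamma> by (rule ginv_gal)
  have sD: "s y \<in> carrier ?D" for y
    using s by (cases "y \<in> YQn C") (auto simp: convenient_splittings_def splittings_def)
  have gD: "gact (Dx C) \<delta> a \<in> carrier ?D" if "\<delta> \<in> gal (base C)" "a \<in> carrier ?D" for \<delta> a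
    using g_hom[OF that(1)] that(2) by (auto simp: hom_def)
  have inv1: "ginv \<gamma> \<circ> \<gamma> = id" "\<gamma> \<circ> ginv \<gamma> = id" using gal_simps[OF \<gamma>] by (auto simp: fun_eq_iff)
  have flip: "gact (Dx C) \<gamma> a = b \<longleftrightarrow> a = gact (Dx C) (ginv \<gamma>) b"
    if "a \<in> carrier ?D" "b \<in> carrier ?D" for a b
    using g_comp[OF \<gamma>' \<gamma> that(1)] g_comp[OF \<gamma> \<gamma>' that(2)] g_id that inv1 by metis
  have Tnz: "t y \<noteq> 0" if "t \<in> That C" for t y using that chars_nz by (auto simp: That_def)
  have one: "(\<lambda>_. 1) \<in> That C" by (simp add: That_def chars_closed)
  have tz: "tact ?z' t x = fmult (ginv \<gamma> \<circ> t) x" "tor ?z = That C" "tor ?z' = That C" for t x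
    by (simp_all add: conj_obj_def base_point_def)
  have hz: "hmap ?z x y = ?e (x y ^ ?n) \<otimes>\<^bsub>?D\<^esub> s y"
    "hmap ?z' x y = gact (Dx C) \<gamma> (?e (x y ^ ?n) \<otimes>\<^bsub>?D\<^esub> s y)" for x y
    by (simp_all add: conj_obj_def base_point_def)
  have jz: "jcls ?z = j_class C (That C) (res (YSC C)) (\<lambda>_. 1)"
    "jcls ?z' = (\<lambda>(j, \<zeta>). (\<lambda>x\<in>That C. \<gamma> \<circ> j x, \<zeta>)) ` j_class C (That C) (res (YSC C)) (\<lambda>_. 1)"
    by (simp_all add: conj_obj_def base_point_def)
  have eps1: "eps C 1 = 1" using bd_eps(3)[OF C, of 1 1] by simp
  have oneT: "(\<lambda>_. 1) \<in> ?T" by (simp add: tors_def That_SC_def chars_closed)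
  have "m \<in> ?R" if "m \<in> Mor C ?z ?z'" for m
  proof -
    from that obtain f \<zeta> where m: "m = mor_class C ?z ?z' f \<zeta>"
      and f: "f \<in> That C \<rightarrow> That C"
      and eq: "\<And>t x. t \<in> That C \<Longrightarrow> x \<in> That C \<Longrightarrow> f (fmult t x) = fmult (ginv \<gamma> \<circ> t) (f x)"
      and h: "\<And>x. x \<in> That C \<Longrightarrow> hmap ?z' (f x) = hmap ?z x"
      and \<zeta>: "\<zeta> \<in> Ttilde C"
      and j: "\<forall>(j, \<zeta>')\<in>jcls ?z'. (compose (That C) j f, fmult \<zeta>' (res (YSC C) \<zeta>)) \<in> jcls ?z"
      unfolding Mor_def by (auto simp: tz) (auto simp: base_point_def)
    define \<tau> where "\<tau> = f (\<lambda>_. 1)"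
    have \<tau>: "\<tau> \<in> That C" using f one by (auto simp: \<tau>_def)
    have fx: "f x = fmult (ginv \<gamma> \<circ> x) \<tau>" if "x \<in> That C" for x
      using eq[OF that one] by (simp add: fmult_def \<tau>_def)
    have m': "m = tau_mor C s \<gamma> \<tau> \<zeta>"
      unfolding m tau_mor_def mor_class_def
      by (intro image_cong refl) (auto simp: tz fx intro!: restrict_ext)
    have "nth_root_cond C s \<gamma> \<tau>" unfolding nth_root_cond_def
    proof
      fix y
      have a: "?e (\<tau> y ^ ?n) \<otimes>\<^bsub>?D\<^esub> s y \<in> carrier ?D" using e_in Tnz[OF \<tau>] sD by simp
      have "gact (Dx C) \<gamma> (?e (\<tau> y ^ ?n) \<otimes>\<^bsub>?D\<^esub> s y) = s y"
        using fun_cong[OF h[OF one], of y] by (simp add: hz \<tau>_def[symmetric] e1 sD)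
      then show "?e (\<tau> y ^ ?n) \<otimes>\<^bsub>?D\<^esub> s y = gact (Dx C) (ginv \<gamma>) (s y)"
        using flip[OF a sD] by simp
    qed
    moreover have "\<tau> y ^ ?n = 1 \<and> eps C (\<tau> y) * \<zeta> y = 1" if y: "y \<in> YSC C" for y
    proof -
      define j0 where "j0 = (\<lambda>x\<in>That C. fmult (\<lambda>_. 1) (res (YSC C) x))"
      have "(j0, \<lambda>y. inverse (eps C 1) * 1) \<in> j_class C (That C) (res (YSC C)) (\<lambda>_. 1)"
        unfolding j_class_def j0_def using oneT by (intro image_eqI[where x = "\<lambda>_. 1"]) auto
      then have "(\<lambda>x\<in>That C. \<gamma> \<circ> j0 x, \<lambda>y. inverse (eps C 1) * 1) \<in> jcls ?z'"
        unfolding jz by (intro image_eqI) auto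
      with j have "(compose (That C) (\<lambda>x\<in>That C. \<gamma> \<circ> j0 x) f,
          fmult (\<lambda>y. inverse (eps C 1) * 1) (res (YSC C) \<zeta>)) \<in> jcls ?z" by blast
      then obtain \<xi> where \<xi>: "\<xi> \<in> ?T"
        and 1: "compose (That C) (\<lambda>x\<in>That C. \<gamma> \<circ> j0 x) f = (\<lambda>x\<in>That C. fmult \<xi> (res (YSC C) x))"
        and 2: "fmult (\<lambda>y. inverse (eps C 1) * 1) (res (YSC C) \<zeta>) = (\<lambda>y. inverse (eps C (\<xi> y)) * 1)"
        unfolding jz j_class_def by auto
      have "\<gamma> (\<tau> y) = \<xi> y"
        using fun_cong[OF fun_cong[OF 1, of "\<lambda>_. 1"], of y] one \<tau> y
        by (simp add: compose_def j0_def \<tau>_def[symmetric] fmult_def res_def)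
      moreover have \<xi>n: "\<xi> y ^ ?n = 1" using \<xi> by (simp add: tors_def)
      moreover have "\<gamma> (\<xi> y) = \<xi> y" using bd_eps(4)[OF C \<xi>n \<xi>n \<gamma>] .
      ultimately have "\<tau> y = \<xi> y" by (metis gal_simps(6)[OF \<gamma>])
      moreover have "\<zeta> y = inverse (eps C (\<xi> y))"
        using fun_cong[OF 2, of y] y by (simp add: fmult_def res_def eps1)
      ultimately show ?thesis using \<xi>n bd_eps(2)[OF C \<xi>n \<xi>n] by simp
    qed
    ultimately show ?thesis using m' \<tau> \<zeta> by blast
  qed
  moreover have "m \<in> Mor C ?z ?z'" if "m \<in> ?R" for m
  proof -
    from that obtain \<tau> \<zeta> where m: "m = tau_mor C s \<gamma> \<tau> \<zeta>" and \<tau>: "\<tau> \<in> That C" and \<zeta>: "\<zeta> \<in> Ttilde C"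
      and nr: "nth_root_cond C s \<gamma> \<tau>" and tn: "\<And>y. y \<in> YSC C \<Longrightarrow> \<tau> y ^ ?n = 1"
      and et: "\<And>y. y \<in> YSC C \<Longrightarrow> eps C (\<tau> y) * \<zeta> y = 1" by blast
    let ?f = "\<lambda>x. fmult (ginv \<gamma> \<circ> x) \<tau>"
    have f: "?f \<in> That C \<rightarrow> That C"
      using \<tau> chars_closed(2) chars_gal[OF \<gamma>'] unfolding That_def by blast
    have eq: "?f (fmult t x) = fmult (ginv \<gamma> \<circ> t) (?f x)" for t x
      by (auto simp: fmult_def gal_simps(1)[OF \<gamma>'])
    have h: "hmap ?z' (?f x) = hmap ?z x" if x: "x \<in> That C" for x
    proof
      fix y
      let ?g = "ginv \<gamma> (x y)"
      have g0: "?g \<noteq> 0" using Tnz[OF x] gal_simps(7)[OF \<gamma>'] by simp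
      have in2: "?e (\<tau> y ^ ?n) \<otimes>\<^bsub>?D\<^esub> s y \<in> carrier ?D" using e_in Tnz[OF \<tau>] sD by simp
      have "?e (?f x y ^ ?n) \<otimes>\<^bsub>?D\<^esub> s y = ?e (?g ^ ?n) \<otimes>\<^bsub>?D\<^esub> (?e (\<tau> y ^ ?n) \<otimes>\<^bsub>?D\<^esub> s y)"
        using g0 Tnz[OF \<tau>] by (simp add: fmult_def power_mult_distrib e_mult m_assoc e_in sD)
      also have "\<dots> = ?e (?g ^ ?n) \<otimes>\<^bsub>?D\<^esub> gact (Dx C) (ginv \<gamma>) (s y)"
        using nr by (simp add: nth_root_cond_def)
      also have "\<dots> = gact (Dx C) (ginv \<gamma>) (?e (x y ^ ?n) \<otimes>\<^bsub>?D\<^esub> s y)"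
        using hom_mult[OF g_hom[OF \<gamma>'] e_in sD] Tnz[OF x] g_emb[OF \<gamma>']
        by (simp add: gal_simps(4)[OF \<gamma>'])
      finally have "?e (?f x y ^ ?n) \<otimes>\<^bsub>?D\<^esub> s y = gact (Dx C) (ginv \<gamma>) (?e (x y ^ ?n) \<otimes>\<^bsub>?D\<^esub> s y)" .
      moreover have "?f x y \<noteq> 0" using f x Tnz by blast
      ultimately show "hmap ?z' (?f x) y = hmap ?z x y"
        unfolding hz using e_in sD Tnz[OF x] gD[OF \<gamma>'] by (intro iffD2[OF flip]) auto
    qed
    have j: "(compose (That C) j ?f, fmult \<zeta>' (res (YSC C) \<zeta>)) \<in> jcls ?z" if j': "(j, \<zeta>') \<in> jcls ?z'" for j \<zeta>'
    proof -
      from j' obtain \<xi> where \<xi>: "\<xi> \<in> ?T"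
        and jj: "j = (\<lambda>x\<in>That C. \<gamma> \<circ> (\<lambda>x\<in>That C. fmult \<xi> (res (YSC C) x)) x)"
        and zz: "\<zeta>' = (\<lambda>y. inverse (eps C (\<xi> y)) * 1)"
        unfolding jz j_class_def by auto
      have \<xi>n: "\<xi> y ^ ?n = 1" for y using \<xi> by (simp add: tors_def)
      have rn: "res (YSC C) \<tau> y ^ ?n = 1" for y using tn by (auto simp: res_def)
      let ?x = "fmult \<xi> (res (YSC C) \<tau>)"
      have "?x \<in> ?T"
        using \<xi> res_That[OF C \<tau>] chars_closed(2) \<xi>n rn
        by (auto simp: tors_def That_SC_def) (auto simp: fmult_def power_mult_distrib)
      moreover have "compose (That C) j ?f = (\<lambda>x\<in>That C. fmult ?x (res (YSC C) x))"
      proof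
        fix x
        show "compose (That C) j ?f x = (\<lambda>x\<in>That C. fmult ?x (res (YSC C) x)) x"
        proof (cases "x \<in> That C")
          case True
          then have fx: "?f x \<in> That C" using f by blast
          have g: "\<gamma> (\<xi> y) = \<xi> y" "\<gamma> (res (YSC C) \<tau> y) = res (YSC C) \<tau> y" for y
            using bd_eps(4)[OF C \<xi>n \<xi>n \<gamma>] bd_eps(4)[OF C rn rn \<gamma>] by blast+
          have "\<gamma> (fmult \<xi> (res (YSC C) (?f x)) y) = fmult ?x (res (YSC C) x) y" for y
            using g[of y]
            by (cases "y \<in> YSC C") (auto simp: fmult_def res_def gal_simps[OF \<gamma>] mult_ac)
          then show ?thesis using True fx by (auto simp: compose_def jj fun_eq_iff)
        qed (simp add: compose_def)
      qed
      moreover have "fmult \<zeta>' (res (YSC C) \<zeta>) = (\<lambda>y. inverse (eps C (?x y)) * 1)"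
      proof
        fix y
        have a: "eps C (?x y) = eps C (\<xi> y) * eps C (res (YSC C) \<tau> y)"
          using bd_eps(1)[OF C \<xi>n rn] by (simp add: fmult_def)
        have "res (YSC C) \<zeta> y = inverse (eps C (res (YSC C) \<tau> y))"
          using et[of y] eps1 by (auto simp: res_def inverse_unique)
        with a show "fmult \<zeta>' (res (YSC C) \<zeta>) y = inverse (eps C (?x y)) * 1"
          by (simp add: fmult_def zz)
      qed
      ultimately show ?thesis unfolding jz j_class_def by (intro image_eqI[where x = ?x]) auto
    qed
    have tb: "tact ?z = fmult" by (simp add: base_point_def)
    show ?thesis
      unfolding Mor_def m tau_mor_def
      by (intro CollectI exI[of _ ?f] exI[of _ \<zeta>]) (use f eq h j \<zeta> in \<open>auto simp: tz tb\<close>)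
  qed
  ultimately show ?thesis by blast
qed

lemma tau_mor_eq_iff:
  assumes C: "bd_setting C" and \<gamma>: "\<gamma> \<in> gal (base C)"
  shows "tau_mor C s \<gamma> \<tau> \<zeta> = tau_mor C s \<gamma> \<tau>' \<zeta>' \<longleftrightarrow>
    (\<exists>\<xi>\<in>tors (deg C) (That C). \<tau>' = fmult \<xi> \<tau> \<and> \<zeta>' = (\<lambda>y. inverse (eps C (\<xi> y)) * \<zeta> y))"
    (is "?l \<longleftrightarrow> ?r")
proof -
  let ?T = "tors (deg C) (That C)"
  have \<gamma>': "ginv \<gamma> \<in> gal (base C)" using \<gamma> by (rule ginv_gal)
  have tn: "\<xi> y ^ deg C = 1" if "\<xi> \<in> ?T" for \<xi> y using that by (simp add: tors_def)
  have fixd: "ginv \<gamma> \<circ> \<xi> = \<xi>" if "\<xi> \<in> ?T" for \<xi>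
    using bd_eps(4)[OF C tn[OF that] tn[OF that] \<gamma>'] by auto
  define P where "P \<tau> \<zeta> \<xi> = ((\<lambda>x\<in>That C. fmult \<xi> (fmult (ginv \<gamma> \<circ> x) \<tau>)),
      (\<lambda>y. inverse (eps C (\<xi> y)) * \<zeta> y))" for \<tau> \<zeta> \<xi>
  have P: "tau_mor C s \<gamma> \<tau> \<zeta> = P \<tau> \<zeta> ` ?T" for \<tau> \<zeta>
    unfolding tau_mor_def mor_class_def P_def
    by (intro image_cong refl) (auto simp: conj_obj_def base_point_def fixd)
  have one: "(\<lambda>_. 1) \<in> ?T" by (simp add: tors_def That_def chars_closed)
  have eps1: "eps C 1 = 1" using bd_eps(3)[OF C, of 1 1] by simp
  have mult: "fmult \<xi> \<xi>' \<in> ?T" if "\<xi> \<in> ?T" "\<xi>' \<in> ?T" for \<xi> \<xi>'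
    using that chars_closed(2) by (auto simp: tors_def That_def) (auto simp: fmult_def power_mult_distrib)
  have inv: "(\<lambda>y. inverse (\<xi> y)) \<in> ?T" if "\<xi> \<in> ?T" for \<xi>
    using that chars_closed(3) by (auto simp: tors_def That_def power_inverse)
  have shift: "P (fmult \<xi> \<tau>) (\<lambda>y. inverse (eps C (\<xi> y)) * \<zeta> y) \<xi>' = P \<tau> \<zeta> (fmult \<xi>' \<xi>)"
    if "\<xi> \<in> ?T" "\<xi>' \<in> ?T" for \<xi> \<xi>' \<tau> \<zeta>
    unfolding P_def using bd_eps(1)[OF C tn[OF that(2)] tn[OF that(1)]]
    by (auto simp: fmult_def fun_eq_iff mult_ac restrict_def)
  show ?thesis
  proof
    assume ?l
    then have "P \<tau>' \<zeta>' (\<lambda>_. 1) \<in> P \<tau> \<zeta> ` ?T" using one by (auto simp: P)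
    then obtain \<xi> where \<xi>: "\<xi> \<in> ?T" and e: "P \<tau>' \<zeta>' (\<lambda>_. 1) = P \<tau> \<zeta> \<xi>" by blast
    have 1: "(\<lambda>_. 1) \<in> That C" by (simp add: That_def chars_closed)
    have "fst (P \<tau>' \<zeta>' (\<lambda>_. 1)) (\<lambda>_. 1) = fst (P \<tau> \<zeta> \<xi>) (\<lambda>_. 1)" using e by simp
    then have "\<tau>' = fmult \<xi> \<tau>"
      using 1 by (simp add: P_def fmult_def gal_simps(2)[OF \<gamma>'])
    moreover have "\<zeta>' = (\<lambda>y. inverse (eps C (\<xi> y)) * \<zeta> y)"
      using e unfolding P_def by (auto simp: eps1)
    ultimately show ?r using \<xi> by blast
  next
    assume ?r
    then obtain \<xi> where \<xi>: "\<xi> \<in> ?T" and e: "\<tau>' = fmult \<xi> \<tau>" "\<zeta>' = (\<lambda>y. inverse (eps C (\<xi> y)) * \<zeta> y)"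
      by blast
    have "P \<tau>' \<zeta>' ` ?T = P \<tau> \<zeta> ` ((\<lambda>\<xi>'. fmult \<xi>' \<xi>) ` ?T)"
      unfolding e image_image by (intro image_cong refl) (simp add: shift \<xi>)
    also have "(\<lambda>\<xi>'. fmult \<xi>' \<xi>) ` ?T = ?T"
    proof (intro equalityI subsetI)
      fix x assume x: "x \<in> ?T"
      have "\<xi> y \<noteq> 0" for y using \<xi> chars_nz by (auto simp: tors_def That_def)
      then have "x = fmult (fmult x (\<lambda>y. inverse (\<xi> y))) \<xi>" by (auto simp: fmult_def)
      then show "x \<in> (\<lambda>\<xi>'. fmult \<xi>' \<xi>) ` ?T" using mult[OF x inv[OF \<xi>]] by blast
    qed (use mult \<xi> in auto)
    finally show ?l by (simp add: P)
  qed
qed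

lemma Mor_base_point_conj_Zhat:
  assumes C: "bd_setting C" and s: "s \<in> convenient_splittings C" and \<gamma>: "\<gamma> \<in> gal (base C)"
    and \<tau>0: "\<tau>0 \<in> Zhat C" "nth_root_cond C s \<gamma> \<tau>0"
  shows "Mor C (base_point C s) (conj_obj C \<gamma> (base_point C s)) =
    {tau_mor C s \<gamma> \<tau> \<zeta> | \<tau> \<zeta>. \<tau> \<in> Zhat C \<and> \<zeta> \<in> Ztilde C \<and> nth_root_cond C s \<gamma> \<tau>}"
    (is "_ = ?R")
    and "\<And>\<tau> \<tau>' \<zeta> \<zeta>'. \<tau> \<in> Zhat C \<Longrightarrow> \<tau>' \<in> Zhat C \<Longrightarrow>
      tau_mor C s \<gamma> \<tau> \<zeta> = tau_mor C s \<gamma> \<tau>' \<zeta>' \<longleftrightarrow>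
      (\<exists>\<xi>\<in>tors (deg C) (Zhat C). \<tau>' = fmult \<xi> \<tau> \<and> \<zeta>' = (\<lambda>y. inverse (eps C (\<xi> y)) * \<zeta> y))"
proof -
  note A = Mor_base_point_conj[OF C s \<gamma>]
  have eps1: "eps C 1 = 1" using bd_eps(3)[OF C, of 1 1] by simp
  have nz: "t y \<noteq> 0" if "t \<in> That C" for t y using that chars_nz by (auto simp: That_def)
  show "Mor C (base_point C s) (conj_obj C \<gamma> (base_point C s)) = ?R"
  proof (intro equalityI subsetI)
    fix m assume "m \<in> ?R"
    then obtain \<tau> \<zeta> where m: "m = tau_mor C s \<gamma> \<tau> \<zeta>" "nth_root_cond C s \<gamma> \<tau>"
      and z: "\<tau> \<in> Zhat C" "\<zeta> \<in> Ztilde C" by blast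
    have "\<tau> \<in> That C" "\<zeta> \<in> Ttilde C" "\<forall>y\<in>YSC C. \<tau> y ^ deg C = 1 \<and> eps C (\<tau> y) * \<zeta> y = 1"
      using z by (auto simp: Zhat_def Ztilde_def eps1)
    with m show "m \<in> Mor C (base_point C s) (conj_obj C \<gamma> (base_point C s))"
      unfolding A by blast
  next
    fix m assume "m \<in> Mor C (base_point C s) (conj_obj C \<gamma> (base_point C s))"
    then obtain \<tau> \<zeta> where m: "m = tau_mor C s \<gamma> \<tau> \<zeta>" and \<tau>: "\<tau> \<in> That C" and \<zeta>: "\<zeta> \<in> Ttilde C"
      and nr: "nth_root_cond C s \<gamma> \<tau>" and et: "\<forall>y\<in>YSC C. \<tau> y ^ deg C = 1 \<and> eps C (\<tau> y) * \<zeta> y = 1"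
      unfolding A by blast
    have ext: "gm_extension (base C) UNIV (Dx C)" using C by (rule bd_settingD)
    interpret group "grp (Dx C)" using ext by (rule gm_extensionD)
    have t0: "\<tau>0 \<in> That C" using \<tau>0 by (simp add: Zhat_def)
    have pow: "\<tau> y ^ deg C = \<tau>0 y ^ deg C" for y
    proof -
      have sD: "s y \<in> carrier (grp (Dx C))"
        using s by (cases "y \<in> YQn C") (auto simp: convenient_splittings_def splittings_def)
      have e_in: "\<And>u. u \<noteq> 0 \<Longrightarrow> emb (Dx C) u \<in> carrier (grp (Dx C))"
        and inj: "inj_on (emb (Dx C)) (- {0})"
        by (fact gm_extensionD[OF ext])+
      have "emb (Dx C) (\<tau> y ^ deg C) = emb (Dx C) (\<tau>0 y ^ deg C)"
        using nr \<tau>0(2) sD e_in nz[OF \<tau>] nz[OF t0] unfolding nth_root_cond_def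
        by (metis power_not_zero right_cancel)
      then show ?thesis using inj nz[OF \<tau>] nz[OF t0] by (auto dest!: inj_onD)
    qed
    define \<xi> where "\<xi> = fmult \<tau>0 (\<lambda>y. inverse (\<tau> y))"
    have \<xi>: "\<xi> \<in> tors (deg C) (That C)"
      using chars_closed(2)[OF t0[unfolded That_def] chars_closed(3)[OF \<tau>[unfolded That_def]]]
        pow nz[OF \<tau>] nz[OF t0]
      by (auto simp: tors_def That_def \<xi>_def fmult_def power_mult_distrib power_inverse
          simp flip: pow)
    have \<tau>0e: "\<tau>0 = fmult \<xi> \<tau>" using nz[OF \<tau>] by (auto simp: \<xi>_def fmult_def)
    define \<zeta>0 where "\<zeta>0 = (\<lambda>y. inverse (eps C (\<xi> y)) * \<zeta> y)"
    have m0: "m = tau_mor C s \<gamma> \<tau>0 \<zeta>0"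
      unfolding m using tau_mor_eq_iff[OF C \<gamma>] \<xi> \<tau>0e \<zeta>0_def by blast
    have \<xi>n: "\<xi> y ^ deg C = 1" for y using \<xi> by (simp add: tors_def)
    have "\<zeta>0 \<in> Ttilde C"
    proof -
      have x: "\<xi> \<in> chars (YQn C)" using \<xi> by (simp add: tors_def That_def)
      have "(\<lambda>y. eps C (\<xi> y)) \<in> chars (YQn C)"
        using x bd_eps[OF C \<xi>n \<xi>n] by (auto simp: chars_def eps1)
      then show ?thesis
        using chars_closed(2)[OF chars_closed(3)] \<zeta>
        unfolding Ttilde_def \<zeta>0_def fmult_def by blast
    qed
    moreover have "\<zeta>0 y = 1" if y: "y \<in> YSC C" for y
    proof -
      have t1: "\<tau>0 y = 1" using \<tau>0 y by (simp add: Zhat_def)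
      have "\<xi> y * \<tau> y = 1" using \<tau>0e t1 by (metis fmult_def)
      moreover have "\<tau> y ^ deg C = 1" using et y by simp
      ultimately have "eps C (\<xi> y) * eps C (\<tau> y) = 1" using bd_eps(1)[OF C \<xi>n, of "\<tau> y" y] eps1 by simp
      then have "inverse (eps C (\<xi> y)) = eps C (\<tau> y)" by (simp add: inverse_unique)
      then show ?thesis using et y by (simp add: \<zeta>0_def)
    qed
    ultimately show "m \<in> ?R" using m0 \<tau>0 by (auto simp: Ztilde_def)
  qed
  fix \<tau> \<tau>' :: "'a \<Rightarrow> 'b" and \<zeta> \<zeta>'
  assume z: "\<tau> \<in> Zhat C" "\<tau>' \<in> Zhat C"
  have E: "\<xi> \<in> tors (deg C) (Zhat C) \<longleftrightarrow> \<xi> \<in> tors (deg C) (That C)" if e: "\<tau>' = fmult \<xi> \<tau>" for \<xi>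
  proof -
    have "\<xi> y = 1" if y: "y \<in> YSC C" for y
    proof -
      have "\<tau> y = 1" "\<tau>' y = 1" using z y by (auto simp: Zhat_def)
      then show ?thesis using e by (simp add: fmult_def)
    qed
    then show ?thesis by (auto simp: tors_def Zhat_def)
  qed
  show "tau_mor C s \<gamma> \<tau> \<zeta> = tau_mor C s \<gamma> \<tau>' \<zeta>' \<longleftrightarrow>
      (\<exists>\<xi>\<in>tors (deg C) (Zhat C). \<tau>' = fmult \<xi> \<tau> \<and> \<zeta>' = (\<lambda>y. inverse (eps C (\<xi> y)) * \<zeta> y))"
    unfolding tau_mor_eq_iff[OF C \<gamma>] Bex_def
    by (intro ex_cong1 iffI; elim conjE; intro conjI; simp add: E)
qed

end

theory Submission
  imports Defs
begin

text \<open>A morphism from a base point \<open>z = (H, h, j)\<close> to its conjugate under \<open>\<gamma>\<close> is a class of pairs \<open>(f, \<zeta>)\<close>.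
  For any \<open>x \<in> H\<close> write \<open>f x = \<tau> x\<close> with \<open>\<tau> \<in> That\<close>, and write a rational point of the extension as
  \<open>h x y \<cdot> v\<^sup>n\<close>.  Then \<open>\<epsilon>(\<gamma>\<^sup>-\<^sup>1(v) / v \<cdot> \<tau> y) \<zeta> y\<close> depends neither on \<open>x\<close>, nor on \<open>v\<close>, nor on the pair, and
  transporting everything along an isomorphism of base points does not change \<open>\<tau>\<close>, \<open>\<zeta>\<close>, \<open>v\<close>.  So it
  defines a comparison map for every base point, which for a convenient one is \<open>C_map\<close> (take
  \<open>x = 1\<close>).  The general base points cannot be avoided: in positive characteristic \<open>s\<^sub>\<psi>\<close> need not
  extend to \<open>Y\<^sub>Q\<^sub>,\<^sub>n\<close> over the separable closure, in which case no convenient base point exists.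

  The comparison map is bijective onto \<open>E2\<close> because rational points surject onto \<open>Y\<^sub>Q\<^sub>,\<^sub>n\<close> (Hilbert 90),
  the rational points of \<open>G\<^sub>m\<close> are \<open>F\<^sup>\<times>\<close> (the fixed field of the Galois group is \<open>F\<close>), and any two base
  points are isomorphic (sublattices are free, \<open>\<complex>\<^sup>\<times>\<close> is divisible, and separably closed fields contain
  \<open>n\<close>-th roots).  That \<open>s\<^sub>\<psi>\<close> exists rests on \<open>Y\<^sup>S\<^sup>C\<^sub>Q\<^sub>,\<^sub>n\<close> having the multiples \<open>n\<^sub>\<alpha> \<alpha>\<^sup>\<or>\<close> of the simple coroots
  as a basis.\<close>

section \<open>Galois theory of the separable closure\<close>

text \<open>The independence rests on one computation. Replacing \<open>x\<close> by
  \<open>r x\<close> multiplies \<tau> by \<open>\<gamma>^-1(r) / r\<close> and turns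
  \<open>v\<close> into \<open>\<omega> v / r\<close> with \<omega> in mu_n; as mu_n lies in
  \<open>F\<close>, \<gamma> fixes \<omega>, and all these factors cancel. Twisting the pair by
  \<xi> multiplies \<tau> by \<xi> and \<zeta> by the inverse of \<open>\<epsilon>(\<xi>)\<close>.
  The argument of \<epsilon> lies in mu_n because the point of the extension is rational.
  Bijectivity is a torsor argument: over a fixed \<gamma>, two morphisms differ, up to n-torsion, by
  a character in \<open>Ztilde\<close>, and so do two elements of \<open>E2\<close>. Hence one
  morphism from a base point to each of its conjugates is enough. The obstacle is that a torsion
  character of \<open>YSC\<close> with values in the separable closure may fail to extend to a
  torsion character of \<open>YQn\<close>. Its image under \<epsilon> is a complex character, which
  does extend, and the component \<zeta> absorbs the mismatch. All transports of an element to a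
  given base point have the same comparison value, so injectivity makes them agree; this gives the
  independence of the chosen isomorphism.\<close>

lemma of_nat_neq_0_if_card_mu_n:
  fixes F :: "'k::field set"
  assumes "card (mu_n n F) = n" "0 < n"
  shows "(of_nat n :: 'k) \<noteq> 0"
proof
  assume "(of_nat n :: 'k) = 0"
  then have dvd: "CHAR('k) dvd n" by (simp add: of_nat_eq_0_iff_char_dvd)
  define p where "p = CHAR('k)"
  have p0: "p > 0" using dvd assms(2) by (auto simp: p_def intro: Nat.gr0I)
  then have pr: "prime p" unfolding p_def by (rule prime_CHAR_semidom)
  obtain m where m: "n = p * m" using dvd by (auto simp: p_def)
  have m0: "0 < m" "m < n" using m assms(2) prime_gt_1_nat[OF pr] by auto
  \<comment> \<open>Frobenius: with \<open>p\<close> the characteristic,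
    \<open>x^n - 1 = (x^m - 1)^p\<close>, so there are at most \<open>m < n\<close> roots of unity
    of order dividing \<open>n\<close>.\<close>
  have root: "x ^ m = 1" if "x ^ n = 1" for x :: 'k
  proof -
    have "(x ^ m - 1 + 1) ^ p = (x ^ m - 1) ^ p + 1 ^ p"
      unfolding p_def by (rule freshmans_dream) (use pr in \<open>auto simp: p_def\<close>)
    then have "(x ^ m - 1) ^ p = 0"
      using that by (simp add: m mult.commute[of p] power_mult)
    then show ?thesis using p0 by simp
  qed
  have f: "finite {x::'k. x ^ m = 1}" "card {x::'k. x ^ m = 1} \<le> m"
  proof -
    define q :: "'k poly" where "q = monom 1 m - 1"
    have "coeff q m = 1" using m0 by (simp add: q_def)
    then have q0: "q \<noteq> 0" by auto
    have d: "degree q \<le> m" unfolding q_def by (rule degree_diff_le) (auto simp: degree_monom_le)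
    have eq: "{x. poly q x = 0} = {x. x ^ m = 1}" by (auto simp: q_def poly_monom)
    show "finite {x::'k. x ^ m = 1}" using poly_roots_finite[OF q0] eq by simp
    show "card {x::'k. x ^ m = 1} \<le> m" using card_poly_roots_bound[OF q0] eq d by simp
  qed
  have "mu_n n F \<subseteq> {x. x ^ m = 1}" using root by (auto simp: mu_n_def)
  then have "card (mu_n n F) \<le> m" using card_mono[OF f(1)] f(2) by (meson order_trans)
  then show False using assms(1) m0 by simp
qed

text \<open>Since \<open>n\<close> is invertible, \<open>X^n - u\<close> is separable: Euler's
  relation \<open>(X/n) p' - p = u\<close> puts a unit in the ideal generated by \<open>p\<close>
  and \<open>p'\<close>.\<close>

lemma nth_root_exists:
  fixes F :: "'k::field set"
    and u :: 'k
  assumes sc: "separable_closure_of F" and card: "card (mu_n n F) = n" and n: "0 < n" and u: "u \<noteq> 0"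
  obtains v where "v ^ n = u" "v \<noteq> 0"
proof -
  define p :: "'k poly" where "p = monom 1 n - [:u:]"
  have nz: "(of_nat n :: 'k) \<noteq> 0" using card n by (rule of_nat_neq_0_if_card_mu_n)
  have "coeff p n = 1" using n by (simp add: p_def coeff_pCons split: nat.splits)
  then have "n \<le> degree p" by (simp add: le_degree)
  then have d: "0 < degree p" using n by simp
  have eq: "smult u 1 = - p + [:0, inverse (of_nat n):] * pderiv p"
  proof -
    have "pderiv p = monom (of_nat n) (n - 1)" by (simp add: p_def pderiv_diff pderiv_monom pderiv_pCons)
    moreover have "[:0, inverse (of_nat n):] * monom (of_nat n) (n - 1) = (monom 1 n :: 'k poly)"
      using nz n by (cases n) (auto simp: mult_monom simp flip: monom_0 monom_Suc
          simp: smult_monom mult_pCons_left)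
    ultimately show ?thesis by (simp add: p_def)
  qed
  have "coprime p (pderiv p)"
  proof (rule coprimeI)
    fix c assume "c dvd p" "c dvd pderiv p"
    then have "c dvd smult u 1" unfolding eq by (meson dvd_add dvd_minus_iff dvd_mult)
    moreover have "is_unit (smult u 1)" using u by (simp add: is_unit_iff_degree)
    ultimately show "is_unit c" by (rule dvd_trans)
  qed
  then obtain v where "poly p v = 0"
    using sc d unfolding separable_closure_of_def separable_poly_def by blast
  then have "v ^ n = u" by (simp add: p_def poly_monom)
  moreover have "v \<noteq> 0" using u n \<open>v ^ n = u\<close> by auto
  ultimately show ?thesis by (rule that)
qed

lemma separable_poly_dvd:
  assumes "separable_poly P" "p dvd P"
  shows "separable_poly p"
  unfolding separable_poly_def
proof (rule coprimeI)
  obtain r where r: "P = p * r" using assms(2) by auto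
  fix c assume c: "c dvd p" "c dvd pderiv p"
  then have "c dvd P" "c dvd pderiv P" unfolding r pderiv_mult by (auto intro: dvd_mult2 dvd_add)
  then show "is_unit c" using assms(1) unfolding separable_poly_def by (meson coprime_common_divisor)
qed

section \<open>Extension of embeddings over \<open>F\<close> and the fixed field of the Galois
  group\<close>

lemma subfield_closed:
  assumes "is_subfield F"
  shows "0 \<in> F" "1 \<in> F" "- 1 \<in> F" "x \<in> F \<Longrightarrow> y \<in> F \<Longrightarrow> x + y \<in> F" "x \<in> F \<Longrightarrow> y \<in> F \<Longrightarrow> x * y \<in> F"
    "x \<in> F \<Longrightarrow> - x \<in> F" "x \<in> F \<Longrightarrow> inverse x \<in> F"
  using assms by (auto simp: is_subfield_def)

lemma poly_in_subring:
  assumes "0 \<in> K" "\<And>x y. x \<in> K \<Longrightarrow> y \<in> K \<Longrightarrow> x + y \<in> K \<and> x * y \<in> K"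
    "a \<in> K" "\<forall>i. coeff p i \<in> K"
  shows "poly p a \<in> K"
  using assms(4)
proof (induction p)
  case (pCons c q)
  have "c \<in> K" using pCons.prems[THEN spec, of 0] by simp
  moreover have "\<forall>i. coeff q i \<in> K" using pCons.prems by (metis coeff_pCons_Suc)
  ultimately show ?case using pCons.IH assms(2,3) by simp
qed (simp add: assms)

text \<open>Dividing a relation \<open>c + a q(a) = 0\<close> by its constant term gives
  \<open>1/a = - q(a)/c\<close>; if \<open>c = 0\<close>, cancelling \<open>a\<close> leaves a
  shorter relation.\<close>

lemma inverse_in_subring:
  assumes F: "is_subfield F" "F \<subseteq> K" and K: "\<And>x y. x \<in> K \<Longrightarrow> y \<in> K \<Longrightarrow> x + y \<in> K \<and> x * y \<in> K"
    and a: "a \<in> K" "a \<noteq> 0" and p: "p \<noteq> 0" "\<forall>i. coeff p i \<in> F" "poly p a = 0"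
  shows "inverse a \<in> K"
  using p
proof (induction p)
  case (pCons c q)
  have c: "c \<in> F" using pCons.prems(2)[THEN spec, of 0] by simp
  have q: "\<forall>i. coeff q i \<in> F" using pCons.prems(2) by (metis coeff_pCons_Suc)
  have e: "c + a * poly q a = 0" using pCons.prems(3) by simp
  show ?case
  proof (cases "c = 0")
    case True
    then show ?thesis using pCons.IH q e a pCons.hyps by auto
  next
    case False
    have "poly q a \<in> K"
      using poly_in_subring[of K a q] K a q subfield_closed(1)[OF F(1)] F(2) by blast
    moreover have "- inverse c \<in> K" using c F subfield_closed(6,7)[OF F(1)] by blast
    moreover have "inverse a = - inverse c * poly q a"
    proof -
      have "a * poly q a = - c" using e by (simp add: eq_neg_iff_add_eq_0 add.commute)
      then have "a * (- inverse c * poly q a) = 1" using False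
        by (metis (no_types, opaque_lifting) mult.left_commute mult_minus_left mult_minus_right
            minus_minus left_inverse)
      then show ?thesis by (rule inverse_unique)
    qed
    ultimately show ?thesis using K by metis
  qed
qed simp

text \<open>Graphs of ring homomorphisms over \<open>F\<close> from a subring containing \<open>F\<close>; the subring is
  automatically a field because everything is algebraic over \<open>F\<close>.\<close>

definition partial_emb :: "'k::field set \<Rightarrow> ('k \<times> 'k) set \<Rightarrow> bool" where
  "partial_emb F G \<longleftrightarrow> Id_on F \<subseteq> G \<and> single_valued G \<and>
     (\<forall>a b c d. (a, b) \<in> G \<longrightarrow> (c, d) \<in> G \<longrightarrow> (a + c, b + d) \<in> G \<and> (a * c, b * d) \<in> G)"

text \<open>Conjugation of polynomials by the partial embedding, kept as a relation so that no
  values outside the domain of \<open>G\<close> have to be chosen.\<close>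

definition poly_graph :: "('k::zero \<times> 'k) set \<Rightarrow> ('k poly \<times> 'k poly) set" where
  "poly_graph G = {(q, q'). \<forall>i. (coeff q i, coeff q' i) \<in> G}"

context
  fixes F :: "'k::field set" and G
  assumes F: "is_subfield F" and sc: "separable_closure_of F" and G: "partial_emb F G"
begin

lemma partial_emb_closed:
  shows "a \<in> F \<Longrightarrow> (a, a) \<in> G" "(0, 0) \<in> G" "(1, 1) \<in> G"
    "(a, b) \<in> G \<Longrightarrow> (c, d) \<in> G \<Longrightarrow> (a + c, b + d) \<in> G"
    "(a, b) \<in> G \<Longrightarrow> (c, d) \<in> G \<Longrightarrow> (a * c, b * d) \<in> G"
    "(a, b) \<in> G \<Longrightarrow> (c, d) \<in> G \<Longrightarrow> (a - c, b - d) \<in> G"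
proof -
  show F_in: "(a, a) \<in> G" if "a \<in> F" for a using G that by (auto simp: partial_emb_def Id_on_def)
  show "(0, 0) \<in> G" "(1, 1) \<in> G" using F_in subfield_closed[OF F] by auto
  show add: "(a + c, b + d) \<in> G" and mult: "(a * c, b * d) \<in> G"
    if "(a, b) \<in> G" "(c, d) \<in> G" for a b c d using G that unfolding partial_emb_def by blast+
  show "(a - c, b - d) \<in> G" if "(a, b) \<in> G" "(c, d) \<in> G"
    using add[OF that(1) mult[OF F_in[OF subfield_closed(3)[OF F]] that(2)]] by simp
qed

lemma partial_emb_unique: "(a, b) \<in> G \<Longrightarrow> (a, c) \<in> G \<Longrightarrow> b = c"
  using G unfolding partial_emb_def single_valued_def by blast

lemma partial_emb_inverse:
  assumes "(a, b) \<in> G" "a \<noteq> 0"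
  obtains c where "(inverse a, c) \<in> G"
proof -
  obtain p where "p \<noteq> 0" "\<forall>i. coeff p i \<in> F" "poly p a = 0"
    using sc unfolding separable_closure_of_def by blast
  then have "inverse a \<in> Domain G"
    using partial_emb_closed assms by (intro inverse_in_subring[OF F]) (auto, blast+)
  then show ?thesis using that by auto
qed

text \<open>Injectivity is automatic: a nonzero element of the domain has its inverse there, and
  \<open>b = 0\<close> would put \<open>(1, 0)\<close> next to \<open>(1, 1)\<close>.\<close>

lemma partial_emb_eq_0_iff: "(a, b) \<in> G \<Longrightarrow> a = 0 \<longleftrightarrow> b = 0"
proof
  assume ab: "(a, b) \<in> G"
  show "b = 0" if "a = 0" using ab that partial_emb_unique partial_emb_closed(2) by blast
  show "a = 0" if "b = 0"
  proof (rule ccontr)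
    assume "a \<noteq> 0"
    then obtain c where "(inverse a, c) \<in> G" using partial_emb_inverse ab by blast
    then have "(inverse a * a, c * b) \<in> G" using ab by (rule partial_emb_closed)
    then show False using \<open>a \<noteq> 0\<close> that partial_emb_unique[of 1 0 1] partial_emb_closed(3) by simp
  qed
qed

lemma poly_graph_closed:
  assumes "(p, p') \<in> poly_graph G" "(q, q') \<in> poly_graph G"
  shows "(p + q, p' + q') \<in> poly_graph G" "(p - q, p' - q') \<in> poly_graph G"
    "(p * q, p' * q') \<in> poly_graph G"
proof -
  have sum: "(sum f A, sum g A) \<in> G" if "\<And>i. (f i, g i) \<in> G" for f g and A :: "nat set"
    by (induction A rule: infinite_finite_induct) (auto intro: partial_emb_closed that)
  show "(p + q, p' + q') \<in> poly_graph G" "(p - q, p' - q') \<in> poly_graph G"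
    using assms by (auto simp: poly_graph_def intro: partial_emb_closed)
  show "(p * q, p' * q') \<in> poly_graph G"
    using assms by (auto simp: poly_graph_def coeff_mult intro!: sum partial_emb_closed)
qed

lemma poly_graph_monom: "(c, d) \<in> G \<Longrightarrow> (monom c m, monom d m) \<in> poly_graph G"
  by (auto simp: poly_graph_def partial_emb_closed)

lemma poly_graph_degree:
  assumes "(p, p') \<in> poly_graph G"
  shows "degree p = degree p'" "p = 0 \<longleftrightarrow> p' = 0"
proof -
  have eq: "coeff p i = 0 \<longleftrightarrow> coeff p' i = 0" for i
    using assms partial_emb_eq_0_iff by (auto simp: poly_graph_def)
  show "degree p = degree p'" unfolding degree_def using eq by simp
  show "p = 0 \<longleftrightarrow> p' = 0" using eq by (simp add: poly_eq_iff)
qed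

text \<open>Leading terms are cancelled in the domain and in the image at once. What remains still
  vanishes at \<open>a\<close>, so minimality of \<open>p\<close> lets the division run down to 0.
  Divisibility on the image side is what makes the extension by \<open>a\<close> well
  defined.\<close>

lemma minimal_poly_dvd:
  assumes p: "(p, p') \<in> poly_graph G" "p \<noteq> 0" "poly p a = 0"
    and min: "\<And>q q'. (q, q') \<in> poly_graph G \<Longrightarrow> q \<noteq> 0 \<Longrightarrow> poly q a = 0 \<Longrightarrow> degree p \<le> degree q"
    and q: "(q, q') \<in> poly_graph G" "poly q a = 0"
  shows "p dvd q \<and> p' dvd q'"
  using q
proof (induction "degree q" arbitrary: q q' rule: less_induct)
  case less
  show ?case
  proof (cases "q = 0")
    case True
    then show ?thesis using poly_graph_degree(2)[OF less.prems(1)] by simp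
  next
    case False
    then have le: "degree p \<le> degree q" using min less.prems by blast
    obtain i where i: "(inverse (lead_coeff p), i) \<in> G"
      using partial_emb_inverse[of "lead_coeff p"] p by (auto simp: poly_graph_def)
    define c c' m where "c = lead_coeff q * inverse (lead_coeff p)"
      and "c' = coeff q' (degree q) * i" and "m = degree q - degree p"
    have "(c, c') \<in> G"
      unfolding c_def c'_def by (rule partial_emb_closed(5)[OF _ i]) (use less.prems in \<open>auto simp: poly_graph_def\<close>)
    note cm = poly_graph_closed(3)[OF poly_graph_monom[OF this, of m] p(1)]
    define r r' where "r = q - monom c m * p" and "r' = q' - monom c' m * p'"
    have r: "(r, r') \<in> poly_graph G" unfolding r_def r'_def using less.prems(1) cm by (rule poly_graph_closed)
    have ra: "poly r a = 0" by (simp add: r_def p less.prems)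
    have "degree (monom c m * p) \<le> degree q"
      using degree_mult_le[of "monom c m" p] degree_monom_le[of c m] le by (simp add: m_def)
    then have "degree r \<le> degree q" unfolding r_def by (intro degree_diff_le) auto
    moreover have "coeff (monom c m * p) (degree q) = lead_coeff q"
      using le p(2) by (simp add: coeff_monom_mult m_def c_def)
    then have "coeff r (degree q) = 0" by (simp add: r_def)
    ultimately have "r = 0 \<or> degree r < degree q" by (rule eq_zero_or_degree_less)
    then have "p dvd r \<and> p' dvd r'"
      using less.hyps[OF _ r ra] poly_graph_degree(2)[OF r] by auto
    moreover have "q = r + monom c m * p" "q' = r' + monom c' m * p'" by (simp_all add: r_def r'_def)
    ultimately show ?thesis by simp
  qed
qed

text \<open>One-step extension: \<open>p\<close> is minimal for \<open>a\<close> over the domain of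
  \<open>G\<close>, \<open>p'\<close> is its conjugate, and \<open>a\<close> may be sent to any root
  of \<open>p'\<close>. The degree-one clause detects that \<open>a\<close> was already in the
  domain.\<close>

lemma partial_emb_extend:
  obtains p p' where "(p, p') \<in> poly_graph G" "poly p a = 0" "separable_poly p'"
    "degree p' > 0" "degree p' = 1 \<Longrightarrow> a \<in> Domain G"
    "\<And>b. poly p' b = 0 \<Longrightarrow> \<exists>G'. partial_emb F G' \<and> G \<subseteq> G' \<and> (a, b) \<in> G'"
proof -
  define A where "A = {(q, q'). (q, q') \<in> poly_graph G \<and> q \<noteq> 0 \<and> poly q a = 0}"
  obtain P where P: "P \<noteq> 0" "\<forall>i. coeff P i \<in> F" "separable_poly P" "poly P a = 0"
    using sc unfolding separable_closure_of_def by blast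
  \<comment> \<open>A polynomial over \<open>F\<close> is its own conjugate, so \<open>p'\<close>
    divides \<open>P\<close> and inherits its separability.\<close>
  have PG: "(P, P) \<in> poly_graph G" using P by (auto simp: poly_graph_def intro: partial_emb_closed)
  then have "(P, P) \<in> A" using P by (simp add: A_def)
  then obtain w where w: "w \<in> A" "\<And>w'. w' \<in> A \<Longrightarrow> degree (fst w) \<le> degree (fst w')"
    using ex_has_least_nat[of "\<lambda>w. w \<in> A" "(P, P)" "\<lambda>w. degree (fst w)"] by blast
  obtain p p' where wp: "w = (p, p')" by (cases w)
  have p: "(p, p') \<in> poly_graph G" "p \<noteq> 0" "poly p a = 0" using w wp by (auto simp: A_def)
  have min: "degree p \<le> degree q" if "(q, q') \<in> poly_graph G" "q \<noteq> 0" "poly q a = 0" for q q'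
    using w(2)[of "(q, q')"] that wp by (auto simp: A_def)
  have dv: "p dvd q \<and> p' dvd q'" if "(q, q') \<in> poly_graph G" "poly q a = 0" for q q'
    by (rule minimal_poly_dvd[OF p _ that]) (use min in blast)
  note dg = poly_graph_degree[OF p(1)]
  have "degree p > 0" using p(2,3) by (metis degree_eq_zeroE gr0I poly_const_conv pCons_0_0)
  have sep: "separable_poly p'" using separable_poly_dvd[OF P(3)] dv[OF PG P(4)] by blast
  have deg1: "a \<in> Domain G" if "degree p' = 1"
  proof -
    define c c' d d' where cd_def: "c = coeff p 0" "c' = coeff p' 0" "d = coeff p 1" "d' = coeff p' 1"
    have dp: "degree p = 1" using that dg by simp
    have pe: "p = [:c, d:]" "d \<noteq> 0"
    proof -
      have "coeff p n = coeff [:c, d:] n" for n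
        using dp by (cases n; cases "n - 1") (auto simp: cd_def coeff_eq_0)
      then show "p = [:c, d:]" by (rule poly_eqI)
      show "d \<noteq> 0" using dp p(2) by (metis cd_def(3) leading_coeff_0_iff)
    qed
    have cd: "(c, c') \<in> G" "(d, d') \<in> G" using p(1) by (auto simp: cd_def poly_graph_def)
    obtain i where "(inverse d, i) \<in> G" using partial_emb_inverse cd pe by blast
    then have "((0 - c) * inverse d, (0 - c') * i) \<in> G" using cd partial_emb_closed by blast
    moreover have "a = (0 - c) * inverse d"
      using p(3) pe by (simp add: field_simps eq_neg_iff_add_eq_0)
    ultimately show ?thesis by auto
  qed
  have ext: "\<exists>G'. partial_emb F G' \<and> G \<subseteq> G' \<and> (a, b) \<in> G'" if b: "poly p' b = 0" for b
  proof (intro exI conjI)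
    \<comment> \<open>Two expressions \<open>q(a) = r(a)\<close> of one element have images that
      differ by a multiple of \<open>p'\<close>, and this vanishes at \<open>b\<close>.\<close>
    let ?G = "{(poly q a, poly q' b) | q q'. (q, q') \<in> poly_graph G}"
    show sub: "G \<subseteq> ?G"
    proof
      fix w assume w: "w \<in> G"
      obtain c d where cd: "w = (c, d)" by (cases w)
      have "(monom c 0, monom d 0) \<in> poly_graph G" using w cd poly_graph_monom by blast
      then show "w \<in> ?G" unfolding cd by (force simp: poly_monom)
    qed
    have "(monom 1 1, monom 1 1) \<in> poly_graph G" by (intro poly_graph_monom partial_emb_closed)
    then show "(a, b) \<in> ?G" by (force simp: poly_monom)
    have "single_valued ?G"
    proof (rule single_valuedI)
      fix x y z assume "(x, y) \<in> ?G" "(x, z) \<in> ?G"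
      then obtain q q' r r' where qr: "(q, q') \<in> poly_graph G" "(r, r') \<in> poly_graph G"
        and e: "x = poly q a" "y = poly q' b" "x = poly r a" "z = poly r' b" by auto
      have "p' dvd q' - r'" using dv[OF poly_graph_closed(2)[OF qr]] e by simp
      then have "poly (q' - r') b = 0" using b by (metis dvd_def mult_zero_left poly_mult)
      then show "y = z" by (simp add: e)
    qed
    moreover have "Id_on F \<subseteq> ?G" using sub partial_emb_closed(1) by auto
    moreover have "(x + x', y + y') \<in> ?G \<and> (x * x', y * y') \<in> ?G"
      if xy: "(x, y) \<in> ?G" "(x', y') \<in> ?G" for x y x' y'
    proof -
      from xy obtain q q' r r' where qr: "(q, q') \<in> poly_graph G" "(r, r') \<in> poly_graph G"
        and e: "x = poly q a" "y = poly q' b" "x' = poly r a" "y' = poly r' b" by auto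
      have "(poly (q + r) a, poly (q' + r') b) \<in> ?G" "(poly (q * r) a, poly (q' * r') b) \<in> ?G"
        using poly_graph_closed[OF qr] by blast+
      then show ?thesis unfolding e poly_add poly_mult by blast
    qed
    ultimately show "partial_emb F ?G" unfolding partial_emb_def by blast
  qed
  show ?thesis by (rule that[OF p(1,3) sep _ deg1 ext]) (use dg \<open>degree p > 0\<close> in auto)
qed

end

text \<open>A maximal extension, from Zorn's lemma, is defined everywhere because each conjugate
  minimal polynomial is separable and therefore has a root.\<close>

lemma partial_emb_extend_gal:
  fixes F :: "'k::field set"
  assumes F: "is_subfield F" and sc: "separable_closure_of F" and G: "partial_emb F G"
  obtains \<gamma> where "\<gamma> \<in> gal F" "\<And>a b. (a, b) \<in> G \<Longrightarrow> \<gamma> a = b"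
proof -
  let ?A = "{H. partial_emb F H \<and> G \<subseteq> H}"
  have "\<exists>M\<in>?A. \<forall>X\<in>?A. M \<subseteq> X \<longrightarrow> X = M"
  proof (rule subset_Zorn_nonempty)
    show "?A \<noteq> {}" using G by auto
    fix \<C> assume ne: "\<C> \<noteq> {}" and ch: "subset.chain ?A \<C>"
    have mem: "partial_emb F H" "G \<subseteq> H" if "H \<in> \<C>" for H
      using ch that unfolding subset.chain_def by blast+
    have join: "\<exists>H\<in>\<C>. w \<in> H \<and> w' \<in> H" if ww: "w \<in> \<Union>\<C>" "w' \<in> \<Union>\<C>" for w w'
    proof -
      obtain H H' where "H \<in> \<C>" "w \<in> H" "H' \<in> \<C>" "w' \<in> H'" using ww by blast
      moreover have "H \<subseteq> H' \<or> H' \<subseteq> H" using ch calculation unfolding subset.chain_def by blast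
      ultimately show ?thesis by blast
    qed
    have "single_valued (\<Union>\<C>)"
    proof (rule single_valuedI)
      fix x y z assume "(x, y) \<in> \<Union>\<C>" "(x, z) \<in> \<Union>\<C>"
      then obtain H where "H \<in> \<C>" "(x, y) \<in> H" "(x, z) \<in> H" using join by blast
      then show "y = z" using mem unfolding partial_emb_def single_valued_def by blast
    qed
    moreover have "Id_on F \<subseteq> \<Union>\<C>" using ne mem(1) unfolding partial_emb_def by blast
    moreover have "(a + c, b + d) \<in> \<Union>\<C> \<and> (a * c, b * d) \<in> \<Union>\<C>"
      if cd: "(a, b) \<in> \<Union>\<C>" "(c, d) \<in> \<Union>\<C>" for a b c d
    proof -
      obtain H where "H \<in> \<C>" "(a, b) \<in> H" "(c, d) \<in> H" using join[OF cd] by blast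
      then show ?thesis using mem unfolding partial_emb_def by blast
    qed
    ultimately have "partial_emb F (\<Union>\<C>)" unfolding partial_emb_def by blast
    then show "\<Union>\<C> \<in> ?A" using ne mem(2) by blast
  qed
  then obtain M where M: "partial_emb F M" "G \<subseteq> M"
    and max: "\<And>X. partial_emb F X \<Longrightarrow> M \<subseteq> X \<Longrightarrow> X = M" by (auto simp: Ball_def)
  have dom: "a \<in> Domain M" for a
  proof -
    obtain p p' where "separable_poly p'" "degree p' > 0"
      and ext: "\<And>b. poly p' b = 0 \<Longrightarrow> \<exists>M'. partial_emb F M' \<and> M \<subseteq> M' \<and> (a, b) \<in> M'"
      using partial_emb_extend[OF F sc M(1), of a] by metis
    then obtain b where "poly p' b = 0" using sc unfolding separable_closure_of_def by blast
    then show ?thesis using ext max by blast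
  qed
  define \<sigma> where "\<sigma> a = (THE b. (a, b) \<in> M)" for a
  have \<sigma>: "(a, b) \<in> M \<longleftrightarrow> \<sigma> a = b" for a b
  proof -
    obtain b' where b': "(a, b') \<in> M" using dom[of a] by auto
    then have "\<sigma> a = b'" unfolding \<sigma>_def using partial_emb_unique[OF F sc M(1)] by blast
    then show ?thesis using b' partial_emb_unique[OF F sc M(1)] by blast
  qed
  note cl = partial_emb_closed[OF F sc M(1), unfolded \<sigma>]
  have add: "\<sigma> (x + y) = \<sigma> x + \<sigma> y" and mult: "\<sigma> (x * y) = \<sigma> x * \<sigma> y"
    and diff: "\<sigma> (x - y) = \<sigma> x - \<sigma> y" for x y using cl(4-6) by blast+
  have inj: "inj \<sigma>"
    using diff partial_emb_eq_0_iff[OF F sc M(1), unfolded \<sigma>] by (intro injI) (metis eq_iff_diff_eq_0)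
  \<comment> \<open>An injective map that fixes \<open>F\<close> permutes the finite set of roots of
    a polynomial over \<open>F\<close>.\<close>
  have surj: "y \<in> range \<sigma>" for y
  proof -
    obtain P where P: "P \<noteq> 0" "\<forall>i. coeff P i \<in> F" "poly P y = 0"
      using sc unfolding separable_closure_of_def by blast
    have ev: "\<sigma> (poly q x) = poly q (\<sigma> x)" if "\<forall>i. coeff q i \<in> F" for q x
      using that
    proof (induction q)
      case (pCons c q)
      have "c \<in> F" using pCons.prems[THEN spec, of 0] by simp
      moreover have "\<forall>i. coeff q i \<in> F" using pCons.prems by (metis coeff_pCons_Suc)
      ultimately show ?case using pCons.IH cl(1) by (simp add: add mult)
    qed (simp add: cl)
    let ?R = "{x. poly P x = 0}"
    have "finite ?R" using P(1) by (rule poly_roots_finite)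
    moreover have "\<sigma> ` ?R \<subseteq> ?R" using ev[OF P(2)] cl(2) by auto metis
    ultimately have "\<sigma> ` ?R = ?R" using inj by (intro endo_inj_surj) (auto intro: inj_on_subset)
    then show ?thesis using P(3) by blast
  qed
  have "\<sigma> \<in> gal F"
    using inj surj cl(1) unfolding gal_def by (auto simp: add mult bij_def)
  moreover have "\<sigma> a = b" if "(a, b) \<in> G" for a b using that M(2) \<sigma> by blast
  ultimately show ?thesis by (rule that)
qed

text \<open>An \<open>x\<close> outside \<open>F\<close> has a separable minimal polynomial of
  degree at least 2, hence a second root \<open>b\<close>; the embedding sending \<open>x\<close> to
  \<open>b\<close> extends to an automorphism that moves \<open>x\<close>.\<close>

lemma fixed_field_gal:
  fixes F :: "'k::field set"
  assumes F: "is_subfield F" and sc: "separable_closure_of F" and x: "\<And>\<gamma>. \<gamma> \<in> gal F \<Longrightarrow> \<gamma> x = x"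
  shows "x \<in> F"
proof (rule ccontr)
  assume nx: "x \<notin> F"
  have G: "partial_emb F (Id_on F)"
    unfolding partial_emb_def using subfield_closed[OF F] by (auto simp: single_valued_def)
  obtain p p' where pp: "(p, p') \<in> poly_graph (Id_on F)" and px: "poly p x = 0"
    and sep: "separable_poly p'" and d: "degree p' > 0" and d1: "degree p' = 1 \<Longrightarrow> x \<in> Domain (Id_on F)"
    and ext: "\<And>b. poly p' b = 0 \<Longrightarrow> \<exists>G'. partial_emb F G' \<and> Id_on F \<subseteq> G' \<and> (x, b) \<in> G'"
    using partial_emb_extend[OF F sc G, of x] by metis
  have "p' = p" using pp by (auto simp: poly_graph_def poly_eq_iff)
  then obtain r where r: "p' = [:- x, 1:] * r" using px by (metis poly_eq_0_iff_dvd dvdE)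
  have r0: "r \<noteq> 0" using r d by auto
  have "degree p' \<noteq> 1" using d1 nx by auto
  moreover have "degree p' = 1 + degree r" unfolding r using r0 by (subst degree_mult_eq) auto
  ultimately have "degree r > 0" by simp
  moreover have "separable_poly r" by (rule separable_poly_dvd[OF sep]) (simp only: r dvd_triv_right)
  ultimately obtain b where b: "poly r b = 0" using sc unfolding separable_closure_of_def by blast
  \<comment> \<open>A root of \<open>r\<close> equal to \<open>x\<close> would be a double root of
    \<open>p'\<close>, against separability.\<close>
  have "b \<noteq> x"
  proof
    assume "b = x"
    then have dr: "[:- x, 1:] dvd r" using b by (simp add: poly_eq_0_iff_dvd)
    have "[:- x, 1:] dvd p'" unfolding r by (rule dvd_triv_left)
    moreover have "[:- x, 1:] dvd pderiv p'"
      unfolding r pderiv_mult using dr by (intro dvd_add dvd_mult2) auto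
    ultimately have "is_unit [:- x, 1:]"
      using sep unfolding separable_poly_def by (meson coprime_common_divisor)
    then show False by (simp add: is_unit_iff_degree)
  qed
  moreover obtain G' where G': "partial_emb F G'" "(x, b) \<in> G'" using ext[of b] b r by auto
  moreover obtain \<gamma> where "\<gamma> \<in> gal F" "\<gamma> x = b"
    using partial_emb_extend_gal[OF F sc G'(1)] G'(2) by metis
  ultimately show False using x by blast
qed

section \<open>Independence of characters and Hilbert 90\<close>

lemma gal_comp: "\<gamma> \<in> gal F \<Longrightarrow> \<delta> \<in> gal F \<Longrightarrow> \<gamma> \<circ> \<delta> \<in> gal F"
  by (auto simp: gal_def bij_comp)

lemma gal_id: "id \<in> gal F"
  by (auto simp: gal_def)

text \<open>Relations and distinctness are tested on a multiplicative subset \<open>X\<close> only.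
  In Hilbert 90 this is a fixed field, on which finitely many automorphisms have to be told
  apart.\<close>

lemma dedekind_independence:
  fixes \<psi> :: "'i \<Rightarrow> 'm::monoid_mult \<Rightarrow> 'k::field"
  assumes "finite I" "1 \<in> X" "\<And>x y. x \<in> X \<Longrightarrow> y \<in> X \<Longrightarrow> x * y \<in> X"
    and "\<And>i. i \<in> I \<Longrightarrow> \<psi> i 1 = 1"
    and "\<And>i x y. i \<in> I \<Longrightarrow> x \<in> X \<Longrightarrow> y \<in> X \<Longrightarrow> \<psi> i (x * y) = \<psi> i x * \<psi> i y"
    and "\<And>i j. i \<in> I \<Longrightarrow> j \<in> I \<Longrightarrow> i \<noteq> j \<Longrightarrow> \<exists>x\<in>X. \<psi> i x \<noteq> \<psi> j x"
    and "\<And>x. x \<in> X \<Longrightarrow> (\<Sum>i\<in>I. a i * \<psi> i x) = 0" and "i \<in> I"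
  shows "a i = 0"
  using assms
proof (induction I arbitrary: a i rule: finite_induct)
  case (insert k I)
  note X = insert.prems(1,2)
  note one = insert.prems(3) and mult = insert.prems(4) and dist = insert.prems(5)
  note sum = insert.prems(6)
  have zero: "a j = 0" if j: "j \<in> I" for j
  proof -
    obtain x0 where x0: "x0 \<in> X" "\<psi> j x0 \<noteq> \<psi> k x0"
      using dist[of j k] j insert.hyps by auto
    have "(\<Sum>i\<in>I. (a i * (\<psi> i x0 - \<psi> k x0)) * \<psi> i x) = 0" if x: "x \<in> X" for x
    proof -
      \<comment> \<open>The relation at \<open>x0 * x\<close> minus \<open>\<psi> k x0\<close> times
        the relation at \<open>x\<close> has no term for \<open>k\<close>, while the coefficient of
        \<open>j\<close> is multiplied by a nonzero number.\<close>
      have "(\<Sum>i\<in>insert k I. a i * \<psi> i (x0 * x)) - \<psi> k x0 * (\<Sum>i\<in>insert k I. a i * \<psi> i x) = 0"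
        using sum X x0 x by simp
      also have "(\<Sum>i\<in>insert k I. a i * \<psi> i (x0 * x)) - \<psi> k x0 * (\<Sum>i\<in>insert k I. a i * \<psi> i x)
          = (\<Sum>i\<in>insert k I. (a i * (\<psi> i x0 - \<psi> k x0)) * \<psi> i x)"
        unfolding sum_distrib_left sum_subtractf[symmetric]
        by (rule sum.cong) (use mult x0 x in \<open>auto simp: algebra_simps\<close>)
      finally show ?thesis using insert.hyps by simp
    qed
    then have "a j * (\<psi> j x0 - \<psi> k x0) = 0"
      by (intro insert.IH[OF X _ _ _ _ j, of "\<lambda>i. a i * (\<psi> i x0 - \<psi> k x0)"])
        (use one mult dist in auto)
    then show ?thesis using x0 by simp
  qed
  have "(\<Sum>i\<in>insert k I. a i * \<psi> i 1) = a k" using insert.hyps one zero by simp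
  then have "a k = 0" using sum[OF X(1)] by simp
  then show ?case using zero insert.prems(7) by auto
qed simp

text \<open>Each element of \<open>S\<close> can only move among the roots of a polynomial over
  \<open>F\<close>. The finite set of restrictions replaces the Galois group of a finite
  extension.\<close>

lemma finite_gal_restrict:
  fixes F :: "'k::field set"
  assumes sc: "separable_closure_of F" and S: "finite S"
  shows "finite ((\<lambda>\<gamma>. restrict \<gamma> S) ` gal F)"
proof -
  have "\<exists>p. p \<noteq> 0 \<and> (\<forall>i. coeff p i \<in> F) \<and> poly p x = 0" for x
    using sc unfolding separable_closure_of_def by blast
  then obtain P where P: "\<And>x. P x \<noteq> 0" "\<And>x i. coeff (P x) i \<in> F" "\<And>x. poly (P x) x = 0" by metis
  have ev: "\<gamma> (poly q x) = poly q (\<gamma> x)" if "\<forall>i. coeff q i \<in> F" "\<gamma> \<in> gal F" for \<gamma> q x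
    using that(1)
  proof (induction q)
    case (pCons c q)
    have "c \<in> F" using pCons.prems[THEN spec, of 0] by simp
    moreover have "\<forall>i. coeff q i \<in> F" using pCons.prems by (metis coeff_pCons_Suc)
    ultimately show ?case using pCons.IH that(2) by (simp add: gal_def)
  qed (use gal_simps(3)[OF that(2)] in simp)
  have "(\<lambda>\<gamma>. restrict \<gamma> S) ` gal F \<subseteq> (\<Pi>\<^sub>E x\<in>S. {z. poly (P x) z = 0})"
    using ev P(2,3) gal_simps(3) by fastforce
  moreover have "finite (\<Pi>\<^sub>E x\<in>S. {z. poly (P x) z = 0})"
    using S P(1) by (intro finite_PiE poly_roots_finite) auto
  ultimately show ?thesis by (rule finite_subset)
qed

text \<open>The cocycle is trivial on the stabiliser of \<open>S\<close>, so it depends only on the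
  restriction to \<open>S\<close>. The classical sum \<open>a\<close> of the terms
  \<open>c \<sigma> * \<sigma> x\<close>, over representatives \<sigma> of the restrictions, solves
  the equation, and independence of characters supplies an \<open>x\<close> for which it is
  nonzero.\<close>

lemma hilbert_90:
  fixes F :: "'k::field set" and c :: "('k \<Rightarrow> 'k) \<Rightarrow> 'k"
  assumes sc: "separable_closure_of F" and S: "finite S"
    and nz: "\<And>\<gamma>. \<gamma> \<in> gal F \<Longrightarrow> c \<gamma> \<noteq> 0"
    and cocycle: "\<And>\<gamma> \<delta>. \<gamma> \<in> gal F \<Longrightarrow> \<delta> \<in> gal F \<Longrightarrow> c (\<gamma> \<circ> \<delta>) = c \<gamma> * \<gamma> (c \<delta>)"
    and smooth: "\<And>\<gamma>. \<gamma> \<in> gal F \<Longrightarrow> (\<And>x. x \<in> S \<Longrightarrow> \<gamma> x = x) \<Longrightarrow> c \<gamma> = 1"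
  obtains a where "a \<noteq> 0" "\<And>\<gamma>. \<gamma> \<in> gal F \<Longrightarrow> c \<gamma> * \<gamma> a = a"
proof -
  \<comment> \<open>The field fixed by the stabiliser of \<open>S\<close>; on it an automorphism is
    determined by its restriction to \<open>S\<close>.\<close>
  define X where "X = {x. \<forall>\<gamma>\<in>gal F. (\<forall>s\<in>S. \<gamma> s = s) \<longrightarrow> \<gamma> x = x}"
  define I where "I = (\<lambda>\<gamma>. restrict \<gamma> S) ` gal F"
  define rep where "rep i = (SOME \<gamma>. \<gamma> \<in> gal F \<and> restrict \<gamma> S = i)" for i
  have rep: "rep i \<in> gal F" "restrict (rep i) S = i" if "i \<in> I" for i
  proof -
    have "\<exists>\<gamma>. \<gamma> \<in> gal F \<and> restrict \<gamma> S = i" using that by (auto simp: I_def)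
    then have "rep i \<in> gal F \<and> restrict (rep i) S = i" unfolding rep_def by (rule someI_ex)
    then show "rep i \<in> gal F" "restrict (rep i) S = i" by auto
  qed
  have finI: "finite I" unfolding I_def using sc S by (rule finite_gal_restrict)
  have same: "c \<gamma> = c \<delta>" "x \<in> X \<Longrightarrow> \<gamma> x = \<delta> x"
    if gd: "\<gamma> \<in> gal F" "\<delta> \<in> gal F" "restrict \<gamma> S = restrict \<delta> S" for \<gamma> \<delta> x
  proof -
    let ?k = "ginv \<gamma> \<circ> \<delta>"
    have k: "?k \<in> gal F" using gd ginv_gal gal_comp by blast
    have ks: "?k s = s" if "s \<in> S" for s
      using fun_cong[OF gd(3), of s] that gal_simps(6)[OF gd(1)] by (simp, metis)
    have \<delta>: "\<delta> = \<gamma> \<circ> ?k" using gal_simps(5)[OF gd(1)] by auto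
    show "c \<gamma> = c \<delta>" by (subst \<delta>) (use cocycle[OF gd(1) k] smooth[OF k ks] gal_simps(2)[OF gd(1)] in simp)
    show "\<gamma> x = \<delta> x" if "x \<in> X"
    proof -
      have "?k x = x" using that k ks unfolding X_def by blast
      then show ?thesis by (subst \<delta>) simp
    qed
  qed
  have one: "id \<in> gal F" by (rule gal_id)
  let ?i = "restrict id S"
  have i: "?i \<in> I" unfolding I_def using one by blast
  have "\<exists>x\<in>X. (\<Sum>i\<in>I. c (rep i) * rep i x) \<noteq> 0"
  proof (rule ccontr)
    assume "\<not> ?thesis"
    then have z: "(\<Sum>i\<in>I. c (rep i) * rep i x) = 0" if "x \<in> X" for x using that by blast
    have "c (rep ?i) = 0"
    proof (rule dedekind_independence[where \<psi> = rep and a = "\<lambda>i. c (rep i)" and I = I and X = X, OF finI _ _ _ _ _ z i])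
      show "1 \<in> X" by (auto simp: X_def gal_simps(2))
      show "x * y \<in> X" if "x \<in> X" "y \<in> X" for x y using that by (auto simp: X_def gal_simps(1))
      show "rep i 1 = 1" if "i \<in> I" for i using rep(1)[OF that] by (rule gal_simps)
      show "rep i (x * y) = rep i x * rep i y" if "i \<in> I" for i x y
        using rep(1)[OF that] by (rule gal_simps)
      show "\<exists>x\<in>X. rep i x \<noteq> rep j x" if ij: "i \<in> I" "j \<in> I" "i \<noteq> j" for i j
      proof (rule ccontr)
        assume "\<not> ?thesis"
        moreover have "S \<subseteq> X" by (auto simp: X_def)
        ultimately have "restrict (rep i) S = restrict (rep j) S" by (intro restrict_ext) blast
        then show False using rep(2) ij by simp
      qed
    qed
    then show False using nz rep(1)[OF i] by blast
  qed
  then obtain x where x: "x \<in> X" and a0: "(\<Sum>i\<in>I. c (rep i) * rep i x) \<noteq> 0" by blast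
  define a where "a = (\<Sum>i\<in>I. c (rep i) * rep i x)"
  have "c \<gamma> * \<gamma> a = a" if g: "\<gamma> \<in> gal F" for \<gamma>
  proof -
    have lin: "\<gamma> (sum f I) = (\<Sum>i\<in>I. \<gamma> (f i))" for f
      using finI by (induction I) (use g gal_simps(3)[OF g] in \<open>auto simp: gal_def\<close>)
    \<comment> \<open>Left multiplication by \<gamma> permutes the restrictions, and the cocycle
      identity turns \<open>c \<gamma> * \<gamma> a\<close> into the reindexed sum
      \<open>a\<close>.\<close>
    define \<pi> where "\<pi> i = restrict (\<gamma> \<circ> rep i) S" for i
    have \<pi>I: "\<pi> i \<in> I" if "i \<in> I" for i
      unfolding I_def \<pi>_def using gal_comp[OF g rep(1)[OF that]] by blast
    have inj: "inj_on \<pi> I"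
    proof (rule inj_onI)
      fix i j assume ij: "i \<in> I" "j \<in> I" "\<pi> i = \<pi> j"
      have "rep i s = rep j s" if "s \<in> S" for s
        using fun_cong[OF ij(3), of s] that gal_simps(6)[OF g] by (simp add: \<pi>_def) metis
      then have "restrict (rep i) S = restrict (rep j) S" by (intro restrict_ext) blast
      then show "i = j" using rep(2) ij by simp
    qed
    have bij: "bij_betw \<pi> I I" using inj \<pi>I finI by (simp add: bij_betw_def endo_inj_surj image_subsetI)
    have "c \<gamma> * \<gamma> a = (\<Sum>i\<in>I. c \<gamma> * \<gamma> (c (rep i) * rep i x))"
      unfolding a_def lin sum_distrib_left ..
    also have "\<dots> = (\<Sum>i\<in>I. c (rep (\<pi> i)) * rep (\<pi> i) x)"
    proof (rule sum.cong[OF refl])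
      fix i assume i: "i \<in> I"
      have r: "restrict (rep (\<pi> i)) S = restrict (\<gamma> \<circ> rep i) S"
        using rep(2)[OF \<pi>I[OF i]] by (simp add: \<pi>_def)
      note s = same[OF rep(1)[OF \<pi>I[OF i]] gal_comp[OF g rep(1)[OF i]] r]
      show "c \<gamma> * \<gamma> (c (rep i) * rep i x) = c (rep (\<pi> i)) * rep (\<pi> i) x"
        using s(1) s(2)[OF x] cocycle[OF g rep(1)[OF i]] by (simp add: gal_simps(1)[OF g])
    qed
    also have "\<dots> = a" unfolding a_def using bij by (rule sum.reindex_bij_betw)
    finally show ?thesis .
  qed
  then show ?thesis using that a0 unfolding a_def by blast
qed

section \<open>Lattices and their characters\<close>

lemma zsc_succ: "zsc (k + 1) y = zsc k y + y"
proof (cases "0 \<le> k")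
  case True
  then have "nat (k + 1) = Suc (nat k)" by simp
  then show ?thesis using True by (simp add: zsc_def add.commute)
next
  case False
  then have "nat (- k) = Suc (nat (- (k + 1)))" by simp
  then show ?thesis using False by (cases "k = - 1") (auto simp: zsc_def)
qed

lemma zsc_0 [simp]: "zsc 0 y = 0" and zsc_1 [simp]: "zsc 1 y = y"
  by (simp_all add: zsc_def)

lemma zsc_add: "zsc (k + l) y = zsc k y + zsc l y"
proof (induction l rule: int_induct[where k = 0])
  case (step1 i)
  then show ?case using zsc_succ[of "k + i" y] zsc_succ[of i y] by (simp add: add.assoc)
next
  case (step2 i)
  then show ?case using zsc_succ[of "k + (i - 1)" y] zsc_succ[of "i - 1" y]
    by (simp add: algebra_simps)
qed simp

lemma zsc_uminus: "zsc (- k) y = - zsc k y"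
  using zsc_add[of k "- k" y] by (simp add: eq_neg_iff_add_eq_0 add.commute)

lemma zsc_diff: "zsc (k - l) y = zsc k y - zsc l y"
  using zsc_add[of k "- l" y] by (simp add: zsc_uminus)

lemma zsc_induct:
  assumes "P 0" "\<And>k. P k \<Longrightarrow> P (k + 1)" "\<And>k. P k \<Longrightarrow> P (k - 1)"
  shows "P (k :: int)"
  by (induction k rule: int_induct[where k = 0]) (use assms in auto)

lemma zsc_distrib: "zsc k (x + y) = zsc k x + zsc k y"
  by (induction k rule: zsc_induct) (simp_all add: zsc_add zsc_diff algebra_simps)

lemma zsc_zsc: "zsc k (zsc l y) = zsc (k * l) y"
  by (induction k rule: zsc_induct) (simp_all add: zsc_add zsc_diff algebra_simps)

lemma zsc_right_0 [simp]: "zsc k 0 = 0"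
  using zsc_distrib[of k 0 0] by simp

lemma zsc_minus_right: "zsc k (- y) = - zsc k y"
  using zsc_distrib[of k y "- y"] by (simp add: eq_neg_iff_add_eq_0 add.commute)

lemma additive_int_zsc:
  fixes c :: "'y::ab_group_add \<Rightarrow> int"
  assumes "Modules.additive c"
  shows "c (zsc k y) = k * c y"
  by (induction k rule: zsc_induct)
    (simp_all add: zsc_add zsc_diff Modules.additive.add[OF assms] Modules.additive.diff[OF assms]
      Modules.additive.zero[OF assms] algebra_simps)

section \<open>Sublattices and homomorphic sections\<close>

definition is_lattice :: "'y::ab_group_add set \<Rightarrow> bool" where
  "is_lattice L \<longleftrightarrow> 0 \<in> L \<and> (\<forall>x\<in>L. \<forall>y\<in>L. x + y \<in> L) \<and> (\<forall>x\<in>L. - x \<in> L)"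

lemma is_latticeD:
  assumes "is_lattice L"
  shows "0 \<in> L" "x \<in> L \<Longrightarrow> y \<in> L \<Longrightarrow> x + y \<in> L" "x \<in> L \<Longrightarrow> - x \<in> L"
    "x \<in> L \<Longrightarrow> y \<in> L \<Longrightarrow> x - y \<in> L" "x \<in> L \<Longrightarrow> zsc k x \<in> L"
proof -
  show 0: "0 \<in> L" and add: "x \<in> L \<Longrightarrow> y \<in> L \<Longrightarrow> x + y \<in> L" and neg: "x \<in> L \<Longrightarrow> - x \<in> L" for x y
    using assms by (auto simp: is_lattice_def)
  show diff: "x \<in> L \<Longrightarrow> y \<in> L \<Longrightarrow> x - y \<in> L" for x y using add[of x "- y"] neg by simp
  show "x \<in> L \<Longrightarrow> zsc k x \<in> L"
    by (induction k rule: zsc_induct) (auto simp: zsc_add zsc_diff 0 add diff)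
qed

lemma is_lattice_zspan: "is_lattice (zspan S)"
  unfolding is_lattice_def zspan_def by blast

lemma zspan_superset: "S \<subseteq> zspan S"
  unfolding zspan_def by blast

lemma zspan_least: "is_lattice L \<Longrightarrow> S \<subseteq> L \<Longrightarrow> zspan S \<subseteq> L"
  unfolding is_lattice_def zspan_def by blast

lemma int_subgroup_generator:
  fixes A :: "int set"
  assumes "0 \<in> A" "\<And>x y. x \<in> A \<Longrightarrow> y \<in> A \<Longrightarrow> x - y \<in> A"
  obtains m where "m \<in> A" "\<And>k. k \<in> A \<Longrightarrow> m dvd k" "0 \<le> m"
proof (cases "A = {0}")
  case True
  then show ?thesis using that[of 0] by auto
next
  case False
  have neg: "- x \<in> A" if "x \<in> A" for x using assms(2)[OF assms(1) that] by simp
  have add: "x + y \<in> A" if "x \<in> A" "y \<in> A" for x y using assms(2)[OF that(1) neg[OF that(2)]] by simp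
  obtain x where x: "x \<in> A" "x \<noteq> 0" using False assms(1) by blast
  then have "\<bar>x\<bar> \<in> A" using neg by (auto simp: abs_if)
  then have "\<exists>k. 0 < k \<and> int k \<in> A" using x by (intro exI[of _ "nat \<bar>x\<bar>"]) auto
  then obtain k where k: "0 < k" "int k \<in> A" "\<And>j. 0 < j \<Longrightarrow> int j \<in> A \<Longrightarrow> k \<le> j"
    using exists_least_iff[of "\<lambda>k. 0 < k \<and> int k \<in> A"] by (metis (no_types, lifting) not_le)
  have mult: "j * int k \<in> A" for j
    by (induction j rule: zsc_induct) (use assms k add in \<open>auto simp: algebra_simps\<close>)
  have "int k dvd l" if "l \<in> A" for l
  proof -
    have "l mod int k = l - l div int k * int k" by (simp add: minus_div_mult_eq_mod)
    then have "l mod int k \<in> A" using assms(2)[OF that mult[of "l div int k"]] by simp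
    moreover have "0 \<le> l mod int k" "l mod int k < int k" using k(1) by simp_all
    ultimately have "l mod int k = 0"
      using k(3)[of "nat (l mod int k)"] by (cases "l mod int k = 0") auto
    then show ?thesis by auto
  qed
  then show ?thesis using that[of "int k"] k by auto
qed

text \<open>Two forms of finiteness are extracted: jointly injective coordinate functions, for
  induction over sublattices, and finitely many generators, for extending characters one generator
  at a time.\<close>

lemma free_of_finite_rank_coordinates:
  assumes "free_of_finite_rank TYPE('y::ab_group_add)"
  obtains J :: "('y::ab_group_add \<Rightarrow> int) set" and B :: "'y::ab_group_add set" where "finite J" "\<And>c. c \<in> J \<Longrightarrow> Modules.additive c"
    "\<And>y. (\<And>c. c \<in> J \<Longrightarrow> c y = 0) \<Longrightarrow> y = 0" "finite B" "zspan B = UNIV"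
proof -
  obtain B :: "'y set" where B: "finite B"
    and ex: "\<forall>y. \<exists>!c. (\<forall>b. b \<notin> B \<longrightarrow> c b = 0) \<and> y = (\<Sum>b\<in>B. zsc (c b) b)"
    using assms unfolding free_of_finite_rank_def by blast
  then obtain c where c: "\<And>y b. b \<notin> B \<Longrightarrow> c y b = 0" "\<And>y. y = (\<Sum>b\<in>B. zsc (c y b) b)" by metis
  have uniq: "f = g" if "\<forall>b. b \<notin> B \<longrightarrow> f b = 0" "\<forall>b. b \<notin> B \<longrightarrow> g b = 0"
    "(\<Sum>b\<in>B. zsc (f b) b) = (\<Sum>b\<in>B. zsc (g b) b)" for f g
    using ex that by metis
  have add: "c (x + y) b = c x b + c y b" for x y b
  proof -
    have "c (x + y) = (\<lambda>b. c x b + c y b)"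
      by (rule uniq) (use c(1) c(2)[of x] c(2)[of y] c(2)[of "x + y"] in \<open>auto simp: zsc_add sum.distrib\<close>)
    then show ?thesis by simp
  qed
  have span: "y \<in> zspan B" for y
  proof -
    have "(\<Sum>b\<in>A. zsc (c y b) b) \<in> zspan B" if "A \<subseteq> B" for A
      using finite_subset[OF that B] that
    proof (induction A rule: finite_induct)
      case empty
      then show ?case using is_latticeD(1)[OF is_lattice_zspan] by simp
    next
      case (insert b A)
      then have "b \<in> zspan B" using zspan_superset[of B] by blast
      then show ?case using insert by (auto intro!: is_latticeD(2,5)[OF is_lattice_zspan])
    qed
    then show ?thesis using c(2)[of y] by (metis subset_refl)
  qed
  show ?thesis
  proof (rule that[of "(\<lambda>b y. c y b) ` B" B])
    show "Modules.additive f" if "f \<in> (\<lambda>b y. c y b) ` B" for f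
      using that by (auto simp: Modules.additive_def add)
    show "y = 0" if zero: "\<And>f. f \<in> (\<lambda>b y. c y b) ` B \<Longrightarrow> f y = 0" for y
    proof -
      have "c y b = 0" if "b \<in> B" for b using zero[OF imageI[OF that]] .
      then have "(\<Sum>b\<in>B. zsc (c y b) b) = 0" by (intro sum.neutral) auto
      then show ?thesis using c(2)[of y] by simp
    qed
  qed (use B span in auto)
qed

lemma additive_hom_int_pow:
  assumes "group H" and p: "\<And>a b. a \<in> carrier H \<Longrightarrow> b \<in> carrier H \<Longrightarrow> p (a \<otimes>\<^bsub>H\<^esub> b) = p a + p b"
    and d: "d \<in> carrier H"
  shows "p (d [^]\<^bsub>H\<^esub> (k::int)) = zsc k (p d)"
proof -
  interpret group H by fact
  have one: "p \<one>\<^bsub>H\<^esub> = 0" using p[of "\<one>\<^bsub>H\<^esub>" "\<one>\<^bsub>H\<^esub>"] by simp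
  have s: "p (d [^]\<^bsub>H\<^esub> (k + 1)) = p (d [^]\<^bsub>H\<^esub> k) + p d" for k :: int
    using d by (simp add: int_pow_mult p)
  show ?thesis
  proof (induction k rule: zsc_induct)
    case (3 k)
    then show ?case using s[of "k - 1"] by (simp add: zsc_diff algebra_simps)
  qed (simp_all add: one s zsc_add)
qed

text \<open>Sublattices are projective: peel off one coordinate function at a time.\<close>

lemma lattice_section:
  fixes H :: "('d, 'm) monoid_scheme" and p :: "'d \<Rightarrow> 'y::ab_group_add"
  assumes H: "comm_group H"
    and p: "\<And>a b. a \<in> carrier H \<Longrightarrow> b \<in> carrier H \<Longrightarrow> p (a \<otimes>\<^bsub>H\<^esub> b) = p a + p b"
    and J: "finite J" "\<And>c. c \<in> J \<Longrightarrow> Modules.additive (c :: 'y \<Rightarrow> int)"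
    and L: "is_lattice L" "\<And>y. y \<in> L \<Longrightarrow> (\<And>c. c \<in> J \<Longrightarrow> c y = 0) \<Longrightarrow> y = 0"
      "\<And>y. y \<in> L \<Longrightarrow> \<exists>a\<in>carrier H. p a = y"
  shows "\<exists>s. \<forall>x\<in>L. s x \<in> carrier H \<and> p (s x) = x \<and> (\<forall>y\<in>L. s (x + y) = s x \<otimes>\<^bsub>H\<^esub> s y)"
  using J L
proof (induction J arbitrary: L rule: finite_induct)
  interpret comm_group H by fact
  case empty
  then have "L = {0}" using is_latticeD(1)[of L] by blast
  moreover have "p \<one>\<^bsub>H\<^esub> = 0" using p[of "\<one>\<^bsub>H\<^esub>" "\<one>\<^bsub>H\<^esub>"] by simp
  ultimately show ?case by (intro exI[of _ "\<lambda>_. \<one>\<^bsub>H\<^esub>"]) auto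
next
  interpret comm_group H by fact
  case (insert c J)
  have c: "Modules.additive c" using insert.prems by simp
  note ca = Modules.additive.add[OF c] Modules.additive.diff[OF c] additive_int_zsc[OF c] Modules.additive.zero[OF c]
    Modules.additive.minus[OF c]
  note Ll = is_latticeD[OF insert.prems(2)]
  define L' where "L' = {y \<in> L. c y = 0}"
  have "is_lattice L'" unfolding L'_def is_lattice_def using Ll by (auto simp: ca)
  then have "\<exists>s. \<forall>x\<in>L'. s x \<in> carrier H \<and> p (s x) = x \<and> (\<forall>y\<in>L'. s (x + y) = s x \<otimes>\<^bsub>H\<^esub> s y)"
  proof (rule insert.IH[rotated])
    show "y = 0" if "y \<in> L'" "\<And>c. c \<in> J \<Longrightarrow> c y = 0" for y
      using insert.prems(3)[of y] that by (auto simp: L'_def)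
  qed (use insert.prems in \<open>auto simp: L'_def\<close>)
  then obtain s where s: "\<And>x. x \<in> L' \<Longrightarrow> s x \<in> carrier H" "\<And>x. x \<in> L' \<Longrightarrow> p (s x) = x"
    "\<And>x y. x \<in> L' \<Longrightarrow> y \<in> L' \<Longrightarrow> s (x + y) = s x \<otimes>\<^bsub>H\<^esub> s y" by blast
  have "0 \<in> c ` L" using Ll(1) ca(4) by (metis image_eqI)
  moreover have "x - y \<in> c ` L" if "x \<in> c ` L" "y \<in> c ` L" for x y
    using that Ll(4) by (auto simp flip: ca(2))
  ultimately obtain m where m: "m \<in> c ` L" "\<And>k. k \<in> c ` L \<Longrightarrow> m dvd k"
    using int_subgroup_generator[of "c ` L"] by metis
  then obtain l where l: "l \<in> L" "c l = m" by blast
  obtain d where d: "d \<in> carrier H" "p d = l" using insert.prems(4)[OF l(1)] by blast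
  \<comment> \<open>The division is exact on \<open>L\<close>. If \<open>m = 0\<close>, then
    \<open>c\<close> vanishes on \<open>L\<close>, and division by 0 yields the required 0.\<close>
  define k where "k y = c y div m" for y
  have k: "c y = k y * m" if "y \<in> L" for y using m(2) that by (simp add: k_def)
  have ka: "k (x + y) = k x + k y" if "x \<in> L" "y \<in> L" for x y
    using m(2) that by (simp add: k_def ca div_plus_div_distrib_dvd_left)
  \<comment> \<open>Subtracting the multiple of \<open>l\<close> with the same
    \<open>c\<close>-value lands in the kernel \<open>L'\<close>, where a section is already
    available.\<close>
  define r where "r y = y - zsc (k y) l" for y
  have r: "r y \<in> L'" if "y \<in> L" for y
    using that Ll l k by (auto simp: r_def L'_def ca)
  have ra: "r (x + y) = r x + r y" if "x \<in> L" "y \<in> L" for x y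
    using ka[OF that] by (simp add: r_def zsc_add)
  have "s (r (x + y)) \<otimes>\<^bsub>H\<^esub> d [^]\<^bsub>H\<^esub> k (x + y) = (s (r x) \<otimes>\<^bsub>H\<^esub> d [^]\<^bsub>H\<^esub> k x) \<otimes>\<^bsub>H\<^esub> (s (r y) \<otimes>\<^bsub>H\<^esub> d [^]\<^bsub>H\<^esub> k y)"
    if "x \<in> L" "y \<in> L" for x y
    using s r that d by (simp add: ra ka int_pow_mult m_ac)
  moreover have "p (s (r x) \<otimes>\<^bsub>H\<^esub> d [^]\<^bsub>H\<^esub> k x) = x" if "x \<in> L" for x
    using s r that d additive_hom_int_pow[of H p d "k x"] p is_group by (simp add: r_def)
  moreover have "s (r x) \<otimes>\<^bsub>H\<^esub> d [^]\<^bsub>H\<^esub> k x \<in> carrier H" if "x \<in> L" for x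
    using s r that d by simp
  ultimately show ?case by (intro exI[of _ "\<lambda>y. s (r y) \<otimes>\<^bsub>H\<^esub> d [^]\<^bsub>H\<^esub> k y"]) auto
qed

lemma lattice_section_free:
  fixes H :: "('d, 'm) monoid_scheme" and p :: "'d \<Rightarrow> 'y::ab_group_add"
  assumes "free_of_finite_rank TYPE('y)" "comm_group H"
    "\<And>a b. a \<in> carrier H \<Longrightarrow> b \<in> carrier H \<Longrightarrow> p (a \<otimes>\<^bsub>H\<^esub> b) = p a + p b"
    "is_lattice L" "\<And>y. y \<in> L \<Longrightarrow> \<exists>a\<in>carrier H. p a = y"
  obtains s where "\<And>x. x \<in> L \<Longrightarrow> s x \<in> carrier H" "\<And>x. x \<in> L \<Longrightarrow> p (s x) = x"
    "\<And>x y. x \<in> L \<Longrightarrow> y \<in> L \<Longrightarrow> s (x + y) = s x \<otimes>\<^bsub>H\<^esub> s y"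
proof -
  obtain J :: "('y \<Rightarrow> int) set" and B :: "'y set" where J: "finite J" "\<And>c. c \<in> J \<Longrightarrow> Modules.additive c"
    "\<And>y. (\<And>c. c \<in> J \<Longrightarrow> c y = 0) \<Longrightarrow> y = 0"
    using free_of_finite_rank_coordinates[OF assms(1)] by metis
  have "\<exists>s. \<forall>x\<in>L. s x \<in> carrier H \<and> p (s x) = x \<and> (\<forall>y\<in>L. s (x + y) = s x \<otimes>\<^bsub>H\<^esub> s y)"
    by (rule lattice_section[OF assms(2) _ J(1,2) assms(4) _ assms(5)]) (use assms(3) J(3) in blast)+
  then show ?thesis using that by blast
qed

text \<open>A root of \<open>t\<close> is the same as a homomorphic section of the group of pairs
  \<open>(y, w)\<close> with \<open>w^n = t y\<close> over \<open>L\<close>, and such sections exist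
  because sublattices are projective.\<close>

lemma chars_root:
  fixes t :: "'y::ab_group_add \<Rightarrow> 'k::field"
  assumes free: "free_of_finite_rank TYPE('y)" and L: "is_lattice L" and t: "t \<in> chars L"
    and root: "\<And>u::'k. u \<noteq> 0 \<Longrightarrow> \<exists>v. v ^ n = u" and n: "0 < n"
  obtains r where "r \<in> chars L" "\<And>y. r y ^ n = t y"
proof -
  define H :: "('y \<times> 'k) monoid" where
    "H = \<lparr>carrier = {(y, w). y \<in> L \<and> w ^ n = t y}, mult = (\<lambda>(y, w) (y', w'). (y + y', w * w')), one = (0, 1)\<rparr>"
  note Ll = is_latticeD[OF L]
  have ta: "t (x + y) = t x * t y" if "x \<in> L" "y \<in> L" for x y using t that by (simp add: chars_def)
  have nz: "t y \<noteq> 0" for y using t by (rule chars_nz)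
  have t0: "t 0 = 1" using ta[of 0 0] Ll(1) nz[of 0] by simp
  have tm: "t (- y) * t y = 1" if "y \<in> L" for y using ta[of "- y" y] Ll(3) that t0 by simp
  have cg: "comm_group H"
  proof (rule comm_groupI)
    fix x assume "x \<in> carrier H"
    then obtain y w where x: "x = (y, w)" "y \<in> L" "w ^ n = t y" by (auto simp: H_def)
    have "w \<noteq> 0" using x nz[of y] n by (metis zero_power)
    moreover have "inverse w ^ n = t (- y)" using x tm[of y] nz[of y] by (simp add: power_inverse field_simps)
    ultimately show "\<exists>y\<in>carrier H. y \<otimes>\<^bsub>H\<^esub> x = \<one>\<^bsub>H\<^esub>"
      using x Ll(3) by (intro bexI[of _ "(- y, inverse w)"]) (auto simp: H_def)
  qed (use Ll ta t0 in \<open>auto simp: H_def power_mult_distrib mult_ac add_ac\<close>)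
  have ex: "\<exists>a\<in>carrier H. fst a = y" if "y \<in> L" for y
    using root[OF nz[of y]] that by (auto simp: H_def)
  obtain s where s: "\<And>x. x \<in> L \<Longrightarrow> s x \<in> carrier H" "\<And>x. x \<in> L \<Longrightarrow> fst (s x) = x"
    "\<And>x y. x \<in> L \<Longrightarrow> y \<in> L \<Longrightarrow> s (x + y) = s x \<otimes>\<^bsub>H\<^esub> s y"
    by (rule lattice_section_free[OF free cg _ L ex])
      (auto simp: H_def split: prod.splits)
  define r where "r y = (if y \<in> L then snd (s y) else 1)" for y
  have rn: "r y ^ n = t y" for y
  proof (cases "y \<in> L")
    case True
    then show ?thesis using s(1,2)[OF True] by (auto simp: r_def H_def)
  next
    case False
    then show ?thesis using t by (simp add: r_def chars_def)
  qed
  moreover have "r (x + y) = r x * r y" if "x \<in> L" "y \<in> L" for x y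
    using s(3)[OF that] that Ll(2) by (simp add: r_def H_def case_prod_beta)
  moreover have "r y \<noteq> 0" for y using rn[of y] nz[of y] n by (metis zero_power)
  ultimately have "r \<in> chars L" by (auto simp: chars_def) (simp add: r_def)
  then show ?thesis using rn by (rule that)
qed

section \<open>Extension of characters to larger lattices\<close>

lemma chars_simps:
  assumes "is_lattice L" "t \<in> chars L"
  shows "t 0 = 1" "x \<in> L \<Longrightarrow> y \<in> L \<Longrightarrow> t (x + y) = t x * t y" "x \<in> L \<Longrightarrow> t (- x) = inverse (t x)"
    "x \<in> L \<Longrightarrow> y \<in> L \<Longrightarrow> t (x - y) = t x / t y" "x \<in> L \<Longrightarrow> t (zsc k x) = t x powi k"
proof -
  note Ll = is_latticeD[OF assms(1)]
  show ta: "t (x + y) = t x * t y" if "x \<in> L" "y \<in> L" for x y using assms that by (simp add: chars_def)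
  have nz: "t y \<noteq> 0" for y using assms(2) by (rule chars_nz)
  show t0: "t 0 = 1" using ta[of 0 0] Ll(1) nz[of 0] by simp
  show tm: "t (- x) = inverse (t x)" if "x \<in> L" for x
    using ta[of x "- x"] Ll(3) that t0 by (metis add.right_inverse inverse_unique)
  show td: "t (x - y) = t x / t y" if "x \<in> L" "y \<in> L" for x y
    using ta[of x "- y"] tm Ll(3) that by (simp add: divide_inverse)
  show "t (zsc k x) = t x powi k" if "x \<in> L"
  proof (induction k rule: zsc_induct)
    case (2 k)
    then show ?case using that Ll(5) nz[of x] by (simp add: zsc_add ta power_int_add)
  next
    case (3 k)
    then show ?case using that Ll(5) nz[of x] by (simp add: zsc_diff td power_int_diff)
  qed (simp add: t0)
qed

text \<open>If \<open>m\<close> generates the integers \<open>k\<close> with \<open>k b\<close> in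
  \<open>L\<close>, a solution \<open>w\<close> of \<open>w^m = t (m b)\<close> determines the
  extension: \<open>l + k b\<close> goes to \<open>t l * w^k\<close>. For \<open>m = 0\<close> no
  nonzero multiple of \<open>b\<close> lies in \<open>L\<close>, and \<open>w = 1\<close> will
  do.\<close>

lemma chars_extend_one:
  fixes t :: "'y::ab_group_add \<Rightarrow> 'k::field"
  assumes L: "is_lattice L" and t: "t \<in> chars L"
    and root: "\<And>(u::'k) n. u \<noteq> 0 \<Longrightarrow> 0 < n \<Longrightarrow> \<exists>v. v ^ n = u"
  obtains L' t' where "is_lattice L'" "L \<subseteq> L'" "b \<in> L'" "t' \<in> chars L'" "\<And>y. y \<in> L \<Longrightarrow> t' y = t y"
proof -
  note Ll = is_latticeD[OF L] and ts = chars_simps[OF L t]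
  have nz: "t y \<noteq> 0" for y using t by (rule chars_nz)
  obtain m where m: "zsc m b \<in> L" "\<And>k. zsc k b \<in> L \<Longrightarrow> m dvd k" "0 \<le> m"
    using int_subgroup_generator[of "{k. zsc k b \<in> L}"] Ll by (auto simp: zsc_diff)
  have "\<exists>w. w \<noteq> 0 \<and> w powi m = t (zsc m b)"
  proof (cases "m = 0")
    case True
    then show ?thesis by (intro exI[of _ 1]) (simp add: ts)
  next
    case False
    then obtain v where "v ^ nat m = t (zsc m b)" using root[OF nz, of "nat m"] m(3) by auto
    moreover have "v \<noteq> 0"
      using calculation m(3) False nz[of "zsc m b"] by (metis zero_power zero_less_nat_eq order_le_less)
    ultimately show ?thesis using m(3) by (auto simp: power_int_def)
  qed
  then obtain w where w: "w \<noteq> 0" "w powi m = t (zsc m b)" by blast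
  \<comment> \<open>The only source of ambiguity is a multiple of \<open>b\<close> that already lies
    in \<open>L\<close>.\<close>
  have tw: "t (zsc k b) = w powi k" if kb: "zsc k b \<in> L" for k
  proof -
    obtain q where q: "k = m * q" using m(2)[OF kb] by blast
    then have "zsc k b = zsc q (zsc m b)" by (simp add: zsc_zsc mult.commute)
    then show ?thesis using ts(5)[OF m(1)] by (simp add: q power_int_mult w)
  qed
  define L' where "L' = {l + zsc k b | l k. l \<in> L}"
  define P where "P y z \<longleftrightarrow> (\<exists>l k. l \<in> L \<and> y = l + zsc k b \<and> z = t l * w powi k)" for y z
  have uniq: "z = z'" if "P y z" "P y z'" for y z z'
  proof -
    from that obtain l k l' k' where a: "l \<in> L" "y = l + zsc k b" "z = t l * w powi k"
      "l' \<in> L" "y = l' + zsc k' b" "z' = t l' * w powi k'" unfolding P_def by blast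
    then have e: "zsc (k - k') b = l' - l" by (simp add: zsc_diff algebra_simps)
    then have "t (l' - l) = w powi (k - k')" using tw[of "k - k'"] Ll(4) a by simp
    then have "t l' * w powi k' = t l * w powi k"
      using ts(4)[OF a(4,1)] w nz[of l] by (simp add: power_int_diff field_simps)
    then show ?thesis using a by simp
  qed
  define t' where "t' y = (if y \<in> L' then THE z. P y z else 1)" for y
  have t': "t' y = z" if "P y z" for y z
  proof -
    have "y \<in> L'" using that by (auto simp: P_def L'_def)
    moreover have "(THE z. P y z) = z" using that uniq by blast
    ultimately show ?thesis by (simp add: t'_def)
  qed
  have P: "P (l + zsc k b) (t l * w powi k)" if "l \<in> L" for l k using that by (auto simp: P_def)
  note val = t'[OF P]
  have "is_lattice L'" unfolding is_lattice_def
  proof (intro conjI ballI)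
    show "0 \<in> L'" unfolding L'_def using Ll(1) by (auto intro!: exI[of _ 0])
    fix x assume "x \<in> L'"
    then obtain l k where x: "x = l + zsc k b" "l \<in> L" unfolding L'_def by blast
    then have "- x = - l + zsc (- k) b" by (simp add: zsc_uminus)
    then show "- x \<in> L'" using x Ll(3) unfolding L'_def by blast
    fix y assume "y \<in> L'"
    then obtain l' k' where y: "y = l' + zsc k' b" "l' \<in> L" unfolding L'_def by blast
    then have "x + y = (l + l') + zsc (k + k') b" using x by (simp add: zsc_add algebra_simps)
    then show "x + y \<in> L'" using x y Ll(2) unfolding L'_def by blast
  qed
  moreover have "L \<subseteq> L'"
  proof
    fix y assume "y \<in> L"
    moreover have "y = y + zsc 0 b" by simp
    ultimately show "y \<in> L'" unfolding L'_def by blast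
  qed
  moreover have "b \<in> L'"
  proof -
    have "b = 0 + zsc 1 b" by simp
    then show ?thesis using Ll(1) unfolding L'_def by blast
  qed
  moreover have "t' \<in> chars L'"
    unfolding chars_def
  proof (intro CollectI conjI ballI allI impI)
    fix x assume "x \<in> L'"
    then obtain l k where x: "x = l + zsc k b" "l \<in> L" unfolding L'_def by blast
    then show "t' x \<noteq> 0" using val w nz by simp
    fix y assume "y \<in> L'"
    then obtain l' k' where y: "y = l' + zsc k' b" "l' \<in> L" unfolding L'_def by blast
    then have "x + y = (l + l') + zsc (k + k') b" using x by (simp add: zsc_add algebra_simps)
    then have "t' (x + y) = t (l + l') * w powi (k + k')"
      using val[OF Ll(2)[OF x(2) y(2)], of "k + k'"] by simp
    then show "t' (x + y) = t' x * t' y"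
      using x y val w by (simp add: ts power_int_add mult_ac)
  qed (simp add: t'_def)
  moreover have "t' y = t y" if "y \<in> L" for y using val[OF that, of 0] by simp
  ultimately show ?thesis by (rule that)
qed

text \<open>The extension goes up to the whole ambient lattice, whose generators are at hand, and is
  then restricted to \<open>M\<close>. Roots of every order are required, so the application is to
  complex characters; a separable closure may lack roots of order its characteristic.\<close>

lemma chars_extend:
  fixes t :: "'y::ab_group_add \<Rightarrow> 'k::field"
  assumes free: "free_of_finite_rank TYPE('y)" and L: "is_lattice L" and M: "is_lattice M" "L \<subseteq> M"
    and t: "t \<in> chars L"
    and root: "\<And>(u::'k) n. u \<noteq> 0 \<Longrightarrow> 0 < n \<Longrightarrow> \<exists>v. v ^ n = u"
  obtains t' where "t' \<in> chars M" "\<And>y. y \<in> L \<Longrightarrow> t' y = t y"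
proof -
  obtain B :: "'y set" where B: "finite B" "zspan B = UNIV"
    using free_of_finite_rank_coordinates[OF free] by metis
  have "\<exists>N t'. is_lattice N \<and> L \<subseteq> N \<and> B \<subseteq> N \<and> t' \<in> chars N \<and> (\<forall>y\<in>L. t' y = t y)"
    using B(1)
  proof (induction B rule: finite_induct)
    case empty
    then show ?case using L t by blast
  next
    case (insert b A)
    then obtain N t' where N: "is_lattice N" "L \<subseteq> N" "A \<subseteq> N" "t' \<in> chars N" "\<forall>y\<in>L. t' y = t y" by blast
    obtain N' t'' where "is_lattice N'" "N \<subseteq> N'" "b \<in> N'" "t'' \<in> chars N'" "\<And>y. y \<in> N \<Longrightarrow> t'' y = t' y"
      using chars_extend_one[OF N(1,4) root, of b] by metis
    with N show ?case by (intro exI[of _ N'] exI[of _ t'']) auto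
  qed
  then obtain N t' where N: "is_lattice N" "B \<subseteq> N" "t' \<in> chars N" "\<forall>y\<in>L. t' y = t y" by blast
  have U: "N = UNIV" using zspan_least[OF N(1,2)] B(2) by auto
  show ?thesis
  proof (rule that[of "res M t'"])
    show "res M t' \<in> chars M" using N(3) is_latticeD(2)[OF M(1)] by (auto simp: chars_def res_def U)
    show "res M t' y = t y" if "y \<in> L" for y using N(4) that M(2) by (auto simp: res_def)
  qed
qed

section \<open>Simple coroots\<close>

context
  fixes \<Phi> :: "('y::ab_group_add \<Rightarrow> int) set" and cr \<Delta>
  assumes rd: "based_root_datum \<Phi> cr \<Delta>"
begin

lemma root_datumD:
  shows "finite \<Phi>" "\<alpha> \<in> \<Phi> \<Longrightarrow> Modules.additive \<alpha>" "inj_on cr \<Phi>" "\<alpha> \<in> \<Phi> \<Longrightarrow> \<alpha> (cr \<alpha>) = 2"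
    "\<alpha> \<in> \<Phi> \<Longrightarrow> reflection cr \<alpha> ` \<Phi> = \<Phi>" "\<alpha> \<in> \<Phi> \<Longrightarrow> coreflection cr \<alpha> ` (cr ` \<Phi>) = cr ` \<Phi>"
    "\<alpha> \<in> \<Phi> \<Longrightarrow> (\<lambda>y. 2 * \<alpha> y) \<notin> \<Phi>" "\<Delta> \<subseteq> \<Phi>" "finite \<Delta>"
    "(\<And>y. (\<Sum>\<alpha>\<in>\<Delta>. c \<alpha> * \<alpha> y) = 0) \<Longrightarrow> \<alpha> \<in> \<Delta> \<Longrightarrow> c \<alpha> = 0"
    "\<beta> \<in> \<Phi> \<Longrightarrow> \<exists>c :: ('y \<Rightarrow> int) \<Rightarrow> int. (\<forall>y. \<beta> y = (\<Sum>\<alpha>\<in>\<Delta>. c \<alpha> * \<alpha> y)) \<and>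
              ((\<forall>\<alpha>\<in>\<Delta>. 0 \<le> c \<alpha>) \<or> (\<forall>\<alpha>\<in>\<Delta>. c \<alpha> \<le> 0))"
  using rd finite_subset[of \<Delta> \<Phi>] unfolding based_root_datum_def Modules.additive_def by auto

lemma root_simps:
  assumes "\<alpha> \<in> \<Phi>"
  shows "\<alpha> (x + y) = \<alpha> x + \<alpha> y" "\<alpha> (x - y) = \<alpha> x - \<alpha> y" "\<alpha> (- x) = - \<alpha> x" "\<alpha> 0 = 0" "\<alpha> (zsc k x) = k * \<alpha> x"
  using root_datumD(2)[OF assms] Modules.additive.add Modules.additive.diff Modules.additive.minus
    Modules.additive.zero additive_int_zsc by blast+

lemma root_coreflection: "\<beta> \<in> \<Phi> \<Longrightarrow> \<beta> (coreflection cr \<alpha> y) = reflection cr \<alpha> \<beta> y"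
  by (simp add: coreflection_def reflection_def root_simps)

lemma coreflection_simps:
  assumes "\<alpha> \<in> \<Phi>"
  shows "coreflection cr \<alpha> (x + y) = coreflection cr \<alpha> x + coreflection cr \<alpha> y"
    "coreflection cr \<alpha> (- x) = - coreflection cr \<alpha> x" "coreflection cr \<alpha> 0 = 0"
    "coreflection cr \<alpha> (zsc k x) = zsc k (coreflection cr \<alpha> x)"
    "coreflection cr \<alpha> (coreflection cr \<alpha> x) = x" "coreflection cr \<alpha> (cr \<alpha>) = - cr \<alpha>"
proof -
  show "coreflection cr \<alpha> (x + y) = coreflection cr \<alpha> x + coreflection cr \<alpha> y"
    "coreflection cr \<alpha> (- x) = - coreflection cr \<alpha> x" "coreflection cr \<alpha> 0 = 0"
    using assms by (simp_all add: coreflection_def root_simps zsc_add zsc_uminus)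
  show "coreflection cr \<alpha> (zsc k x) = zsc k (coreflection cr \<alpha> x)"
    using zsc_distrib[of k x "zsc (- \<alpha> x) (cr \<alpha>)"] assms
    by (simp add: coreflection_def root_simps zsc_zsc zsc_uminus zsc_minus_right)
  have "\<alpha> (coreflection cr \<alpha> x) = - \<alpha> x"
    using assms by (simp add: coreflection_def root_simps root_datumD(4))
  then show "coreflection cr \<alpha> (coreflection cr \<alpha> x) = x"
    by (subst coreflection_def) (simp add: coreflection_def zsc_uminus)
  have "zsc 2 (cr \<alpha>) = cr \<alpha> + cr \<alpha>" using zsc_add[of 1 1 "cr \<alpha>"] by simp
  then show "coreflection cr \<alpha> (cr \<alpha>) = - cr \<alpha>" by (simp add: coreflection_def root_datumD(4)[OF assms])
qed

text \<open>A Weyl-invariant form on cocharacters. It recovers a root from its coroot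
  \<open>a\<close> as \<open>\<alpha> y = 2 (y, a) / (a, a)\<close>, and so yields the compatibility
  of roots and coroots that the axioms do not state.\<close>

definition root_form :: "'y \<Rightarrow> 'y \<Rightarrow> int" where
  "root_form x y = (\<Sum>\<gamma>\<in>\<Phi>. \<gamma> x * \<gamma> y)"

lemma root_form_coreflection:
  assumes "\<alpha> \<in> \<Phi>"
  shows "root_form (coreflection cr \<alpha> x) (coreflection cr \<alpha> y) = root_form x y"
proof -
  have "inj_on (reflection cr \<alpha>) \<Phi>"
    using root_datumD(5)[OF assms] root_datumD(1) by (simp add: eq_card_imp_inj_on)
  then have "(\<Sum>\<gamma>\<in>reflection cr \<alpha> ` \<Phi>. \<gamma> x * \<gamma> y) = (\<Sum>\<gamma>\<in>\<Phi>. reflection cr \<alpha> \<gamma> x * reflection cr \<alpha> \<gamma> y)"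
    by (simp add: sum.reindex)
  then show ?thesis
    unfolding root_form_def root_datumD(5)[OF assms] by (simp add: root_coreflection)
qed

text \<open>Invariance under the reflection in \<alpha>, which negates the coroot, gives an equation
  where \<open>root_form y (cr \<alpha>)\<close> occurs on both sides with opposite signs.\<close>

lemma root_form_coroot:
  assumes "\<alpha> \<in> \<Phi>"
  shows "\<alpha> y * root_form (cr \<alpha>) (cr \<alpha>) = 2 * root_form y (cr \<alpha>)"
proof -
  have "root_form y (cr \<alpha>) = root_form (y - zsc (\<alpha> y) (cr \<alpha>)) (- cr \<alpha>)"
    using root_form_coreflection[OF assms, of y "cr \<alpha>"]
    by (simp add: coreflection_simps[OF assms] coreflection_def[of _ _ y])
  also have "\<dots> = - root_form y (cr \<alpha>) + \<alpha> y * root_form (cr \<alpha>) (cr \<alpha>)"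
    unfolding root_form_def sum_distrib_left sum_negf[symmetric] sum.distrib[symmetric]
    by (rule sum.cong) (auto simp: root_simps algebra_simps)
  finally show ?thesis by simp
qed

text \<open>The summand of \<alpha> itself is 4, and the others are squares.\<close>

lemma root_form_pos:
  assumes "\<alpha> \<in> \<Phi>"
  shows "root_form (cr \<alpha>) (cr \<alpha>) > 0"
proof -
  have "\<alpha> (cr \<alpha>) * \<alpha> (cr \<alpha>) \<le> root_form (cr \<alpha>) (cr \<alpha>)"
    unfolding root_form_def using root_datumD(1) assms by (intro member_le_sum) auto
  then show ?thesis using root_datumD(4)[OF assms] by simp
qed

lemma root_form_sym: "root_form x y = root_form y x"
  by (simp add: root_form_def mult.commute)

text \<open>The axioms say only that reflections permute roots and coroots separately. Some root
  \<gamma> has the reflected coroot, and comparison through \<open>root_form\<close> shows that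
  \<gamma> is the reflected root.\<close>

lemma coroot_reflection:
  assumes "\<alpha> \<in> \<Phi>" "\<beta> \<in> \<Phi>"
  shows "reflection cr \<alpha> \<beta> \<in> \<Phi>" "cr (reflection cr \<alpha> \<beta>) = coreflection cr \<alpha> (cr \<beta>)"
proof -
  show "reflection cr \<alpha> \<beta> \<in> \<Phi>" using root_datumD(5)[OF assms(1)] assms(2) by blast
  obtain \<gamma> where \<gamma>: "\<gamma> \<in> \<Phi>" "cr \<gamma> = coreflection cr \<alpha> (cr \<beta>)"
    using root_datumD(6)[OF assms(1)] assms(2) by (metis imageE image_eqI)
  have "\<gamma> y = reflection cr \<alpha> \<beta> y" for y
  proof -
    have "\<gamma> y * root_form (cr \<gamma>) (cr \<gamma>) = 2 * root_form y (coreflection cr \<alpha> (cr \<beta>))"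
      using root_form_coroot[OF \<gamma>(1)] \<gamma>(2) by simp
    also have "\<dots> = 2 * root_form (coreflection cr \<alpha> y) (cr \<beta>)"
      using root_form_coreflection[OF assms(1), of "coreflection cr \<alpha> y" "cr \<beta>"]
      by (simp add: coreflection_simps[OF assms(1)])
    also have "\<dots> = \<beta> (coreflection cr \<alpha> y) * root_form (cr \<gamma>) (cr \<gamma>)"
      using root_form_coroot[OF assms(2)] by (simp add: \<gamma>(2) root_form_coreflection[OF assms(1)])
    finally show ?thesis using root_form_pos[OF \<gamma>(1)] root_coreflection[OF assms(2)] by simp
  qed
  then have "\<gamma> = reflection cr \<alpha> \<beta>" by blast
  then show "cr (reflection cr \<alpha> \<beta>) = coreflection cr \<alpha> (cr \<beta>)" using \<gamma>(2) by simp
qed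

text \<open>Pairing the relation with an arbitrary \<open>y\<close> under \<open>root_form\<close>
  turns it into a relation between the simple roots, with coefficients scaled by the positive
  numbers \<open>root_form (cr \<alpha>) (cr \<alpha>)\<close>.\<close>

lemma simple_coroots_independent:
  assumes "(\<Sum>\<alpha>\<in>\<Delta>. zsc (c \<alpha>) (cr \<alpha>)) = 0" "\<alpha> \<in> \<Delta>"
  shows "c \<alpha> = 0"
proof -
  have S: "\<delta> \<in> \<Phi>" if "\<delta> \<in> \<Delta>" for \<delta> using root_datumD(8) that by blast
  have lin: "\<gamma> (\<Sum>\<alpha>\<in>A. zsc (c \<alpha>) (cr \<alpha>)) = (\<Sum>\<alpha>\<in>A. c \<alpha> * \<gamma> (cr \<alpha>))" if "\<gamma> \<in> \<Phi>" for \<gamma> A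
    by (induction A rule: infinite_finite_induct) (auto simp: root_simps[OF that])
  have "(\<Sum>\<delta>\<in>\<Delta>. (c \<delta> * root_form (cr \<delta>) (cr \<delta>)) * \<delta> y) = 0" for y
  proof -
    have "(\<Sum>\<delta>\<in>\<Delta>. (c \<delta> * root_form (cr \<delta>) (cr \<delta>)) * \<delta> y) = (\<Sum>\<delta>\<in>\<Delta>. c \<delta> * (2 * root_form y (cr \<delta>)))"
      by (rule sum.cong) (auto simp: S simp flip: root_form_coroot)
    also have "\<dots> = 2 * (\<Sum>\<gamma>\<in>\<Phi>. \<gamma> y * (\<Sum>\<delta>\<in>\<Delta>. c \<delta> * \<gamma> (cr \<delta>)))"
      unfolding root_form_def sum_distrib_left
      by (subst sum.swap) (simp add: mult_ac)
    also have "\<dots> = 2 * (\<Sum>\<gamma>\<in>\<Phi>. \<gamma> y * \<gamma> 0)"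
      using assms(1) by (simp flip: lin)
    also have "\<dots> = 0" by (simp add: root_simps)
    finally show ?thesis .
  qed
  then have "c \<alpha> * root_form (cr \<alpha>) (cr \<alpha>) = 0" using assms(2) by (rule root_datumD(10))
  then show ?thesis using root_form_pos[OF S[OF assms(2)]] by simp
qed

text \<open>Every root is obtained from a simple one by simple reflections: a positive root that is not
  simple can be lowered.\<close>

lemma coroots_in_lattice:
  assumes L: "is_lattice L" and N: "\<And>\<alpha> y. \<alpha> \<in> \<Phi> \<Longrightarrow> N (coreflection cr \<alpha> y) = N y"
    and simple: "\<And>\<alpha>. \<alpha> \<in> \<Delta> \<Longrightarrow> zsc (N (cr \<alpha>)) (cr \<alpha>) \<in> L"
    and stable: "\<And>\<alpha> y. \<alpha> \<in> \<Delta> \<Longrightarrow> y \<in> L \<Longrightarrow> coreflection cr \<alpha> y \<in> L"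
    and \<beta>: "\<beta> \<in> \<Phi>"
  shows "zsc (N (cr \<beta>)) (cr \<beta>) \<in> L"
proof -
  have S: "\<delta> \<in> \<Phi>" if "\<delta> \<in> \<Delta>" for \<delta> using root_datumD(8) that by blast
  have pos: "zsc (N (cr \<beta>)) (cr \<beta>) \<in> L"
    if "\<beta> \<in> \<Phi>" "\<And>y. \<beta> y = (\<Sum>\<alpha>\<in>\<Delta>. c \<alpha> * \<alpha> y)" "\<And>\<alpha>. \<alpha> \<in> \<Delta> \<Longrightarrow> 0 \<le> c \<alpha>" for \<beta> c
    using that
  proof (induction "nat (\<Sum>\<alpha>\<in>\<Delta>. c \<alpha>)" arbitrary: \<beta> c rule: less_induct)
    case less
    note \<beta> = less.prems(1) and c = less.prems(2) and c0 = less.prems(3)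
    \<comment> \<open>The sum is \<beta> at its own coroot, that is 2, so some simple \<alpha>
      occurring in \<beta> pairs positively with this coroot.\<close>
    have "(\<Sum>\<alpha>\<in>\<Delta>. c \<alpha> * \<alpha> (cr \<beta>)) > 0" using c[of "cr \<beta>"] root_datumD(4)[OF \<beta>] by simp
    then obtain \<alpha> where \<alpha>: "\<alpha> \<in> \<Delta>" "c \<alpha> * \<alpha> (cr \<beta>) > 0" by (meson not_le sum_nonpos)
    then have p: "c \<alpha> > 0" "\<alpha> (cr \<beta>) > 0" using c0[of \<alpha>] by (auto simp: zero_less_mult_iff)
    \<comment> \<open>Through the symmetric form, positivity of \<open>\<alpha> (cr \<beta>)\<close>
      passes to \<open>\<beta> (cr \<alpha>)\<close>, the amount by which the reflection lowers the
      height.\<close>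
    have "root_form (cr \<beta>) (cr \<alpha>) > 0"
      using root_form_coroot[OF S[OF \<alpha>(1)], of "cr \<beta>"] root_form_pos[OF S[OF \<alpha>(1)]] p(2)
      by (metis mult_pos_pos zero_less_mult_pos zero_less_numeral)
    then have q: "\<beta> (cr \<alpha>) > 0"
      using root_form_coroot[OF \<beta>, of "cr \<alpha>"] root_form_pos[OF \<beta>] root_form_sym[of "cr \<beta>"]
      by (metis mult_pos_pos zero_less_mult_pos2 zero_less_numeral)
    show ?case
    proof (cases "\<beta> = \<alpha>")
      case True
      then show ?thesis using simple \<alpha>(1) by simp
    next
      case False
      \<comment> \<open>Otherwise \<beta> is a positive multiple of \<alpha>: the factor divides 2,
        the value 1 is excluded by the case distinction and the value 2 by reducedness.\<close>
      have "\<exists>\<delta>\<in>\<Delta>. \<delta> \<noteq> \<alpha> \<and> c \<delta> \<noteq> 0"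
      proof (rule ccontr)
        assume "\<not> ?thesis"
        then have "(\<Sum>\<delta>\<in>\<Delta>. c \<delta> * \<delta> y) = (\<Sum>\<delta>\<in>\<Delta>. if \<delta> = \<alpha> then c \<alpha> * \<alpha> y else 0)" for y
          by (intro sum.cong) auto
        then have eq: "\<beta> y = c \<alpha> * \<alpha> y" for y using c[of y] \<alpha>(1) root_datumD(9) by simp
        have "c \<alpha> * \<alpha> (cr \<beta>) = 2" using eq[of "cr \<beta>"] root_datumD(4)[OF \<beta>] by simp
        then have "c \<alpha> dvd 2" by (metis dvd_triv_left)
        then have "c \<alpha> \<le> 2" by (simp add: zdvd_imp_le)
        then have "c \<alpha> = 1 \<or> c \<alpha> = 2" using p(1) by auto
        then show False
        proof
          assume "c \<alpha> = 1"
          then show False using eq False by auto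
        next
          assume "c \<alpha> = 2"
          then have "\<beta> = (\<lambda>y. 2 * \<alpha> y)" using eq by auto
          then show False using root_datumD(7)[OF S[OF \<alpha>(1)]] \<beta> by simp
        qed
      qed
      then obtain \<delta> where \<delta>: "\<delta> \<in> \<Delta>" "\<delta> \<noteq> \<alpha>" "c \<delta> > 0" using c0 by force
      define \<beta>' where "\<beta>' = reflection cr \<alpha> \<beta>"
      note \<beta>' = coroot_reflection[OF S[OF \<alpha>(1)] \<beta>, folded \<beta>'_def]
      define c' where "c' = c(\<alpha> := c \<alpha> - \<beta> (cr \<alpha>))"
      have split: "(\<Sum>\<delta>\<in>\<Delta>. c' \<delta> * f \<delta>) = (\<Sum>\<delta>\<in>\<Delta>. c \<delta> * f \<delta>) - \<beta> (cr \<alpha>) * f \<alpha>" for f :: "('y \<Rightarrow> int) \<Rightarrow> int"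
        using root_datumD(9) \<alpha>(1) by (simp add: sum.remove[of \<Delta> \<alpha>] c'_def algebra_simps)
      have c'e: "\<beta>' y = (\<Sum>\<alpha>\<in>\<Delta>. c' \<alpha> * \<alpha> y)" for y
        by (simp add: split \<beta>'_def reflection_def c)
      obtain d where d: "\<And>y. \<beta>' y = (\<Sum>\<alpha>\<in>\<Delta>. d \<alpha> * \<alpha> y)" "(\<forall>\<alpha>\<in>\<Delta>. 0 \<le> d \<alpha>) \<or> (\<forall>\<alpha>\<in>\<Delta>. d \<alpha> \<le> 0)"
        using root_datumD(11)[OF \<beta>'(1)] by blast
      have "(\<Sum>\<alpha>\<in>\<Delta>. (c' \<alpha> - d \<alpha>) * \<alpha> y) = 0" for y
        using d(1)[of y] c'e[of y] by (simp add: left_diff_distrib sum_subtractf)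
      then have cd: "c' \<alpha> = d \<alpha>" if "\<alpha> \<in> \<Delta>" for \<alpha>
        using root_datumD(10)[of "\<lambda>\<alpha>. c' \<alpha> - d \<alpha>" \<alpha>] that by simp
      \<comment> \<open>The reflection changes only the coefficient of \<alpha>; the one at \<delta>
        stays positive, which forces all coefficients of the lowered root to be nonnegative.\<close>
      have "d \<delta> > 0" using cd[OF \<delta>(1)] \<delta> by (simp add: c'_def)
      then have c'0: "0 \<le> c' \<alpha>" if "\<alpha> \<in> \<Delta>" for \<alpha> using d(2) cd that \<delta>(1) by force
      have "sum c' \<Delta> = sum c \<Delta> - \<beta> (cr \<alpha>)" using split[of "\<lambda>_. 1"] by simp
      moreover have "sum c' \<Delta> \<ge> 0" using c'0 by (rule sum_nonneg)
      ultimately have "nat (sum c' \<Delta>) < nat (sum c \<Delta>)" using q by simp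
      then have "zsc (N (cr \<beta>')) (cr \<beta>') \<in> L" using less.hyps[of c' \<beta>'] \<beta>'(1) c'e c'0 by blast
      then have "coreflection cr \<alpha> (zsc (N (cr \<beta>')) (cr \<beta>')) \<in> L" using stable \<alpha>(1) by blast
      then show ?thesis
        by (simp add: coreflection_simps[OF S[OF \<alpha>(1)]] \<beta>'(2) N[OF S[OF \<alpha>(1)]])
    qed
  qed
  obtain c where c: "\<And>y. \<beta> y = (\<Sum>\<alpha>\<in>\<Delta>. c \<alpha> * \<alpha> y)" and sgn: "(\<forall>\<alpha>\<in>\<Delta>. 0 \<le> c \<alpha>) \<or> (\<forall>\<alpha>\<in>\<Delta>. c \<alpha> \<le> 0)"
    using root_datumD(11)[OF \<beta>] by blast
  show ?thesis using sgn
  proof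
    assume "\<forall>\<alpha>\<in>\<Delta>. 0 \<le> c \<alpha>"
    then show ?thesis using pos[OF \<beta> c] by blast
  next
    assume neg: "\<forall>\<alpha>\<in>\<Delta>. c \<alpha> \<le> 0"
    \<comment> \<open>A negative root is replaced by its negative, the reflection of \<beta> in
      itself; invariance of \<open>N\<close> keeps the multiplier the same.\<close>
    note r = coroot_reflection[OF \<beta> \<beta>]
    have "reflection cr \<beta> \<beta> y = (\<Sum>\<alpha>\<in>\<Delta>. (- c \<alpha>) * \<alpha> y)" for y
      using c[of y] root_datumD(4)[OF \<beta>] by (simp add: reflection_def sum_negf)
    then have "zsc (N (cr (reflection cr \<beta> \<beta>))) (cr (reflection cr \<beta> \<beta>)) \<in> L"
      using pos[OF r(1), of "\<lambda>\<alpha>. - c \<alpha>"] neg by auto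
    then have "- zsc (N (cr \<beta>)) (cr \<beta>) \<in> L"
      using N[OF \<beta>, of "cr \<beta>"] by (simp add: r(2) coreflection_simps[OF \<beta>] zsc_minus_right)
    then show ?thesis using is_latticeD(3)[OF L] by fastforce
  qed
qed

end

section \<open>Weyl-invariant quadratic forms\<close>

lemma polar_simps:
  assumes "quadratic_form Q"
  shows "polar Q (x + x') y = polar Q x y + polar Q x' y" "polar Q x y = polar Q y x"
    "polar Q 0 y = 0" "polar Q (- x) y = - polar Q x y" "polar Q (zsc k x) y = k * polar Q x y"
    "polar Q x x = 2 * Q x"
proof -
  show add: "polar Q (x + x') y = polar Q x y + polar Q x' y" for x x' y
    using assms by (simp add: quadratic_form_def)
  then have a: "Modules.additive (\<lambda>x. polar Q x y)" for y by (simp add: Modules.additive_def)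
  show "polar Q x y = polar Q y x" by (simp add: polar_def add.commute)
  show "polar Q 0 y = 0" using Modules.additive.zero[OF a] .
  show "polar Q (- x) y = - polar Q x y" using Modules.additive.minus[OF a] .
  show "polar Q (zsc k x) y = k * polar Q x y" using additive_int_zsc[OF a] .
  have "zsc 2 x = x + x" using zsc_add[of 1 1 x] by simp
  moreover have "Q (zsc 2 x) = 2\<^sup>2 * Q x" using assms unfolding quadratic_form_def by blast
  ultimately show "polar Q x x = 2 * Q x" by (simp add: polar_def)
qed

text \<open>The polar form \<open>B\<close> inherits the invariance of \<open>Q\<close>; reflecting
  both arguments gives \<open>B(a, y) = - B(a, y) + 2 \<alpha>(y) Q(a)\<close> for the coroot
  \<open>a\<close>.\<close>

lemma polar_coroot:
  assumes rd: "based_root_datum \<Phi> cr \<Delta>" and Q: "quadratic_form Q" and \<alpha>: "\<alpha> \<in> \<Phi>"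
    and inv: "\<And>y. Q (coreflection cr \<alpha> y) = Q y"
  shows "polar Q (cr \<alpha>) y = \<alpha> y * Q (cr \<alpha>)"
proof -
  note B = polar_simps[OF Q]
  have inv2: "polar Q (coreflection cr \<alpha> x) (coreflection cr \<alpha> y) = polar Q x y" for x y
    unfolding polar_def by (simp add: inv flip: coreflection_simps(1)[OF rd \<alpha>])
  have "polar Q (cr \<alpha>) y = polar Q (- cr \<alpha>) (y - zsc (\<alpha> y) (cr \<alpha>))"
    using inv2[of "cr \<alpha>" y] by (simp add: coreflection_simps(6)[OF rd \<alpha>] coreflection_def[of _ _ y])
  also have "\<dots> = - polar Q (cr \<alpha>) y + \<alpha> y * (2 * Q (cr \<alpha>))"
    using B(1)[of y "- zsc (\<alpha> y) (cr \<alpha>)" "- cr \<alpha>"] by (simp add: B(2)[of "- cr \<alpha>"] B(2)[of y] B(4,5,6))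
      (simp add: B(2)[of _ "- cr \<alpha>"] B(4,5,6))
  finally show ?thesis by simp
qed

section \<open>The extension and its distinguished splitting\<close>

locale bd =
  fixes C :: "('y::ab_group_add, 'k::field, 'd, 'e) bd_data"
  assumes setting: "bd_setting C"
begin

abbreviation gmult :: "'d \<Rightarrow> 'd \<Rightarrow> 'd" (infixl "\<cdot>" 70) where
  "a \<cdot> b \<equiv> a \<otimes>\<^bsub>grp (Dx C)\<^esub> b"
abbreviation "G \<equiv> grp (Dx C)"
abbreviation "e \<equiv> emb (Dx C)"
abbreviation "pr \<equiv> prj (Dx C)"
abbreviation "act \<equiv> gact (Dx C)"
abbreviation "\<Gamma> \<equiv> gal (base C)"
abbreviation "n \<equiv> deg C"

lemma ext: "gm_extension (base C) UNIV (Dx C)"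
  using setting by (rule bd_settingD)

sublocale D: group G
  using ext by (rule gm_extensionD)

lemma bd_facts:
  shows "is_subfield (base C)" "separable_closure_of (base C)" "free_of_finite_rank TYPE('y)"
    "has_commutator (Dx C) (polar (Qf C))" "odd n \<Longrightarrow> even (Qf C y)"
    "\<alpha> \<in> simple C \<Longrightarrow> sQ C \<alpha> \<in> carrier (grp (DQ C)) \<and> prj (DQ C) (sQ C \<alpha>) = coroot C \<alpha>"
    "\<alpha> \<in> simple C \<Longrightarrow> \<gamma> \<in> \<Gamma> \<Longrightarrow> gact (DQ C) \<gamma> (sQ C \<alpha>) = sQ C \<alpha>"
    "fmap C \<in> hom (grp (DQ C)) G"
    "a \<in> carrier (grp (DQ C)) \<Longrightarrow> pr (fmap C a) = prj (DQ C) a"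
    "\<gamma> \<in> \<Gamma> \<Longrightarrow> a \<in> carrier (grp (DQ C)) \<Longrightarrow> fmap C (gact (DQ C) \<gamma> a) = act \<gamma> (fmap C a)"
proof -
  note A = setting[unfolded bd_setting_def]
  have "local_field (base C) \<or> global_field (base C)" using A by (elim conjE)
  then show "is_subfield (base C)" by (auto simp: local_field_def global_field_def)
  show "separable_closure_of (base C)" using A by (elim conjE)
  show "free_of_finite_rank TYPE('y)"
    using bd_settingD(5)[OF setting] by (simp add: based_root_datum_def)
  show "has_commutator (Dx C) (polar (Qf C))" using A by (elim conjE)
  have "odd n \<longrightarrow> (\<forall>y. even (Qf C y))" using A by (elim conjE)
  then show "odd n \<Longrightarrow> even (Qf C y)" by blast
  have "\<forall>\<alpha>\<in>simple C. sQ C \<alpha> \<in> carrier (grp (DQ C)) \<and> prj (DQ C) (sQ C \<alpha>) = coroot C \<alpha> \<and>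
        (\<forall>\<gamma>\<in>\<Gamma>. gact (DQ C) \<gamma> (sQ C \<alpha>) = sQ C \<alpha>)" using A by (elim conjE)
  then show "\<alpha> \<in> simple C \<Longrightarrow> sQ C \<alpha> \<in> carrier (grp (DQ C)) \<and> prj (DQ C) (sQ C \<alpha>) = coroot C \<alpha>"
    "\<alpha> \<in> simple C \<Longrightarrow> \<gamma> \<in> \<Gamma> \<Longrightarrow> gact (DQ C) \<gamma> (sQ C \<alpha>) = sQ C \<alpha>" by blast+
  show "fmap C \<in> hom (grp (DQ C)) G" using A by (elim conjE)
  have "\<forall>a\<in>carrier (grp (DQ C)). pr (fmap C a) = prj (DQ C) a" using A by (elim conjE)
  then show "a \<in> carrier (grp (DQ C)) \<Longrightarrow> pr (fmap C a) = prj (DQ C) a" by blast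
  have "\<forall>\<gamma>\<in>\<Gamma>. \<forall>a\<in>carrier (grp (DQ C)). fmap C (gact (DQ C) \<gamma> a) = act \<gamma> (fmap C a)"
    using A by (elim conjE)
  then show "\<gamma> \<in> \<Gamma> \<Longrightarrow> a \<in> carrier (grp (DQ C)) \<Longrightarrow> fmap C (gact (DQ C) \<gamma> a) = act \<gamma> (fmap C a)"
    by blast
qed

lemmas rd = bd_settingD(5)[OF setting]
lemmas quad = bd_settingD(6)[OF setting]
lemmas n_pos = bd_settingD(1)[OF setting]

lemma e_central: "u \<noteq> 0 \<Longrightarrow> a \<in> carrier G \<Longrightarrow> e u \<cdot> a = a \<cdot> e u"
proof -
  have "\<forall>u. \<forall>a\<in>carrier G. u \<noteq> 0 \<longrightarrow> e u \<cdot> a = a \<cdot> e u"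
    using ext unfolding gm_extension_def by (elim conjE)
  then show "u \<noteq> 0 \<Longrightarrow> a \<in> carrier G \<Longrightarrow> e u \<cdot> a = a \<cdot> e u" by blast
qed

lemma e_simps:
  shows "u \<noteq> 0 \<Longrightarrow> e u \<in> carrier G" "u \<noteq> 0 \<Longrightarrow> v \<noteq> 0 \<Longrightarrow> e (u * v) = e u \<cdot> e v"
    "u \<noteq> 0 \<Longrightarrow> pr (e u) = 0" "e 1 = \<one>\<^bsub>G\<^esub>"
    "u \<noteq> 0 \<Longrightarrow> v \<noteq> 0 \<Longrightarrow> e u = e v \<longleftrightarrow> u = v"
proof -
  show e_in: "u \<noteq> 0 \<Longrightarrow> e u \<in> carrier G" for u using gm_extensionD(2)[OF ext] .
  show e_mult: "u \<noteq> 0 \<Longrightarrow> v \<noteq> 0 \<Longrightarrow> e (u * v) = e u \<cdot> e v" for u v using gm_extensionD(3)[OF ext] .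
  have "{a \<in> carrier G. pr a = 0} = e ` (- {0})"
    using ext unfolding gm_extension_def by (elim conjE)
  then show "u \<noteq> 0 \<Longrightarrow> pr (e u) = 0" by blast
  show "e 1 = \<one>\<^bsub>G\<^esub>" using e_mult[of 1 1] e_in[of 1] by (metis D.l_cancel_one mult_1 one_neq_zero)
  show "u \<noteq> 0 \<Longrightarrow> v \<noteq> 0 \<Longrightarrow> e u = e v \<longleftrightarrow> u = v"
    using gm_extensionD(4)[OF ext] by (auto dest: inj_onD)
qed

lemma pr_simps:
  shows "a \<in> carrier G \<Longrightarrow> b \<in> carrier G \<Longrightarrow> pr (a \<cdot> b) = pr a + pr b"
    "\<exists>a\<in>carrier G. pr a = y" "pr \<one>\<^bsub>G\<^esub> = 0" "a \<in> carrier G \<Longrightarrow> pr (inv\<^bsub>G\<^esub> a) = - pr a"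
    "a \<in> carrier G \<Longrightarrow> pr (a [^]\<^bsub>G\<^esub> (k::int)) = zsc k (pr a)"
proof -
  have "\<forall>a\<in>carrier G. \<forall>b\<in>carrier G. pr (a \<cdot> b) = pr a + pr b"
    using ext unfolding gm_extension_def by (elim conjE)
  then show m: "a \<in> carrier G \<Longrightarrow> b \<in> carrier G \<Longrightarrow> pr (a \<cdot> b) = pr a + pr b" for a b by blast
  have "pr ` carrier G = UNIV"
    using ext unfolding gm_extension_def by (elim conjE)
  then show "\<exists>a\<in>carrier G. pr a = y" by (metis UNIV_I imageE)
  show o: "pr \<one>\<^bsub>G\<^esub> = 0" using m[of "\<one>\<^bsub>G\<^esub>" "\<one>\<^bsub>G\<^esub>"] by simp
  show "a \<in> carrier G \<Longrightarrow> pr (inv\<^bsub>G\<^esub> a) = - pr a"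
    using m[of a "inv\<^bsub>G\<^esub> a"] o by (simp add: eq_neg_iff_add_eq_0 add.commute)
  show "a \<in> carrier G \<Longrightarrow> pr (a [^]\<^bsub>G\<^esub> (k::int)) = zsc k (pr a)"
    using additive_hom_int_pow[OF D.is_group, of pr] m by blast
qed

lemma act_simps:
  assumes "\<gamma> \<in> \<Gamma>"
  shows "a \<in> carrier G \<Longrightarrow> act \<gamma> a \<in> carrier G" "a \<in> carrier G \<Longrightarrow> b \<in> carrier G \<Longrightarrow> act \<gamma> (a \<cdot> b) = act \<gamma> a \<cdot> act \<gamma> b"
    "a \<in> carrier G \<Longrightarrow> pr (act \<gamma> a) = pr a" "u \<noteq> 0 \<Longrightarrow> act \<gamma> (e u) = e (\<gamma> u)"
    "a \<in> carrier G \<Longrightarrow> act (ginv \<gamma>) (act \<gamma> a) = a" "a \<in> carrier G \<Longrightarrow> act \<gamma> (act (ginv \<gamma>) a) = a"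
    "act \<gamma> \<one>\<^bsub>G\<^esub> = \<one>\<^bsub>G\<^esub>"
proof -
  note h = gm_extensionD(5)[OF ext assms]
  show "a \<in> carrier G \<Longrightarrow> act \<gamma> a \<in> carrier G" "a \<in> carrier G \<Longrightarrow> b \<in> carrier G \<Longrightarrow> act \<gamma> (a \<cdot> b) = act \<gamma> a \<cdot> act \<gamma> b"
    using h by (auto simp: hom_def)
  have "\<forall>\<gamma>\<in>\<Gamma>. \<forall>a\<in>carrier G. pr (act \<gamma> a) = pr a"
    using ext unfolding gm_extension_def by (elim conjE)
  then show "a \<in> carrier G \<Longrightarrow> pr (act \<gamma> a) = pr a" using assms by blast
  show "u \<noteq> 0 \<Longrightarrow> act \<gamma> (e u) = e (\<gamma> u)" using gm_extensionD(8)[OF ext assms] .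
  have i: "ginv \<gamma> \<circ> \<gamma> = id" "\<gamma> \<circ> ginv \<gamma> = id" using gal_simps[OF assms] by (auto simp: fun_eq_iff)
  show "a \<in> carrier G \<Longrightarrow> act (ginv \<gamma>) (act \<gamma> a) = a" "a \<in> carrier G \<Longrightarrow> act \<gamma> (act (ginv \<gamma>) a) = a"
    using gm_extensionD(7)[OF ext ginv_gal[OF assms] assms] gm_extensionD(7)[OF ext assms ginv_gal[OF assms]]
      gm_extensionD(6)[OF ext] i by metis+
  show "act \<gamma> \<one>\<^bsub>G\<^esub> = \<one>\<^bsub>G\<^esub>" using hom_one[OF h D.is_group D.is_group] .
qed

lemma same_fibre:
  assumes "a \<in> carrier G" "b \<in> carrier G" "pr a = pr b"
  obtains u where "u \<noteq> 0" "b = a \<cdot> e u"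
proof -
  have "{a \<in> carrier G. pr a = 0} = e ` (- {0})"
    using ext unfolding gm_extension_def by (elim conjE)
  moreover have "inv\<^bsub>G\<^esub> a \<cdot> b \<in> {a \<in> carrier G. pr a = 0}" using assms by (simp add: pr_simps)
  ultimately obtain u where "u \<noteq> 0" "inv\<^bsub>G\<^esub> a \<cdot> b = e u" by auto
  moreover have "b = a \<cdot> (inv\<^bsub>G\<^esub> a \<cdot> b)" using assms by (simp flip: D.m_assoc)
  ultimately show ?thesis using that by metis
qed

lemma root_exists:
  fixes u :: 'k
  assumes "u \<noteq> 0"
  obtains v where "v ^ n = u" "v \<noteq> 0"
  using nth_root_exists[OF bd_facts(2) bd_settingD(2)[OF setting] n_pos assms] .

lemma YQn_lattice: "is_lattice (YQn C)"
  unfolding is_lattice_def YQn_def by (auto simp: polar_simps(1,3,4)[OF quad])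

lemma YSC_lattice: "is_lattice (YSC C)"
  unfolding YSC_def by (rule is_lattice_zspan)

lemmas YSC_sub = YSC_subset_YQn[OF setting]

text \<open>The commutator is a sign. For even \<open>n\<close> the divisibility defining
  \<open>YQn\<close> makes the exponent even, for odd \<open>n\<close> the evenness of
  \<open>Qf C\<close> does. The preimage of \<open>YQn\<close> is thus abelian, as the construction
  of sections demands.\<close>

lemma comm_over_YQn:
  assumes "a \<in> carrier G" "b \<in> carrier G" "pr a \<in> YQn C"
  shows "a \<cdot> b = b \<cdot> a"
proof -
  have "even (polar (Qf C) (pr a) (pr b))"
  proof (cases "even n")
    case True
    have "int n dvd polar (Qf C) (pr a) (pr b)" using assms(3) by (simp add: YQn_def)
    moreover have "2 dvd int n" using True by simp
    ultimately show ?thesis by (meson dvd_trans)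
  next
    case False
    then show ?thesis using bd_facts(5) by (simp add: polar_def)
  qed
  moreover have "a \<cdot> b = e (sgn_pow (polar (Qf C) (pr a) (pr b))) \<cdot> (b \<cdot> a)"
    using bd_facts(4) assms unfolding has_commutator_def by blast
  ultimately show ?thesis using assms by (simp add: sgn_pow_def e_simps)
qed

lemma comm_group_over_YQn: "comm_group (G\<lparr>carrier := {d \<in> carrier G. pr d \<in> YQn C}\<rparr>)"
proof (rule comm_groupI; simp)
  note L = is_latticeD[OF YQn_lattice]
  show "pr \<one>\<^bsub>G\<^esub> \<in> YQn C" using L(1) by (simp add: pr_simps)
  show "pr (x \<cdot> y) \<in> YQn C" if "x \<in> carrier G \<and> pr x \<in> YQn C" "y \<in> carrier G \<and> pr y \<in> YQn C" for x y
    using L(2) that by (simp add: pr_simps)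
  show "\<exists>y. y \<in> carrier G \<and> pr y \<in> YQn C \<and> y \<cdot> x = \<one>\<^bsub>G\<^esub>" if "x \<in> carrier G \<and> pr x \<in> YQn C" for x
    using L(3) that by (intro exI[of _ "inv\<^bsub>G\<^esub> x"]) (simp add: pr_simps)
qed (auto simp: D.m_assoc intro: comm_over_YQn)

lemma splitting_exists:
  assumes "is_lattice L" "L \<subseteq> YQn C"
  obtains s where "s \<in> splittings C L"
proof -
  let ?H = "G\<lparr>carrier := {d \<in> carrier G. pr d \<in> YQn C}\<rparr>"
  obtain s where s: "\<And>x. x \<in> L \<Longrightarrow> s x \<in> carrier ?H" "\<And>x. x \<in> L \<Longrightarrow> pr (s x) = x"
    "\<And>x y. x \<in> L \<Longrightarrow> y \<in> L \<Longrightarrow> s (x + y) = s x \<otimes>\<^bsub>?H\<^esub> s y"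
  proof (rule lattice_section_free[OF bd_facts(3) comm_group_over_YQn _ assms(1), of pr])
    show "\<exists>a\<in>carrier ?H. pr a = y" if "y \<in> L" for y using pr_simps(2)[of y] that assms(2) by auto
  qed (auto simp: pr_simps)
  show ?thesis
    by (rule that[of "\<lambda>y. if y \<in> L then s y else \<one>\<^bsub>G\<^esub>"])
      (use s is_latticeD(2)[OF assms(1)] in \<open>auto simp: splittings_def\<close>)
qed

lemma splittingsD:
  assumes "s \<in> splittings C L"
  shows "s y \<in> carrier G" "y \<in> L \<Longrightarrow> pr (s y) = y" "x \<in> L \<Longrightarrow> y \<in> L \<Longrightarrow> s (x + y) = s x \<cdot> s y"
    "y \<notin> L \<Longrightarrow> s y = \<one>\<^bsub>G\<^esub>"
proof -
  show "s y \<in> carrier G" using assms by (cases "y \<in> L") (auto simp: splittings_def)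
qed (use assms in \<open>auto simp: splittings_def\<close>)

lemma splittings_simps:
  assumes L: "is_lattice L" and s: "s \<in> splittings C L"
  shows "s 0 = \<one>\<^bsub>G\<^esub>" "y \<in> L \<Longrightarrow> s (- y) = inv\<^bsub>G\<^esub> s y"
proof -
  note S = splittingsD[OF s] and Ll = is_latticeD[OF L]
  show 0: "s 0 = \<one>\<^bsub>G\<^esub>" using S(3)[of 0 0] Ll(1) S(1)[of 0] by simp
  show "y \<in> L \<Longrightarrow> s (- y) = inv\<^bsub>G\<^esub> s y"
    using S(3)[of "- y" y] 0 Ll(3) S(1) by (simp add: D.inv_equality)
qed

lemma splittings_eqI:
  assumes s: "s \<in> splittings C (zspan S)" "s' \<in> splittings C (zspan S)"
    and eq: "\<And>y. y \<in> S \<Longrightarrow> s y = s' y"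
  shows "s = s'"
proof
  let ?L = "{y \<in> zspan S. s y = s' y}"
  note Z = is_lattice_zspan
  have "is_lattice ?L" unfolding is_lattice_def
    using is_latticeD[OF Z] splittings_simps[OF Z s(1)] splittings_simps[OF Z s(2)]
      splittingsD(3)[OF s(1)] splittingsD(3)[OF s(2)] by auto
  moreover have "S \<subseteq> ?L" using zspan_superset eq by blast
  ultimately have "zspan S \<subseteq> ?L" by (rule zspan_least)
  then show "s y = s' y" for y
    using splittingsD(4)[OF s(1), of y] splittingsD(4)[OF s(2), of y] by (cases "y \<in> zspan S") auto
qed

section \<open>The lattice \<open>YSC\<close> and its pinned splitting\<close>

definition gen :: "('y \<Rightarrow> int) \<Rightarrow> 'y" where
  "gen \<alpha> = zsc (n_root C \<alpha>) (coroot C \<alpha>)"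

lemma n_root_pos: "n_root C \<alpha> > 0"
proof -
  let ?g = "gcd (int n) (Qf C (coroot C \<alpha>))"
  have "?g * n_root C \<alpha> = int n" by (simp add: n_root_def)
  then have "0 < ?g * n_root C \<alpha>" using n_pos by simp
  moreover have "0 \<le> ?g" by simp
  ultimately show ?thesis by (simp only: zero_less_mult_iff) linarith
qed

text \<open>Identifies \<open>n_root C \<alpha>\<close> as the order of
  \<open>Qf C (coroot C \<alpha>)\<close> modulo \<open>n\<close>, the form in which reflected
  generators can be tested.\<close>

lemma n_root_dvd_iff: "n_root C \<alpha> dvd k \<longleftrightarrow> int n dvd k * Qf C (coroot C \<alpha>)"
proof -
  let ?q = "Qf C (coroot C \<alpha>)"
  let ?g = "gcd (int n) ?q"
  have g: "?g \<noteq> 0" using n_pos by simp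
  have n: "int n = ?g * n_root C \<alpha>" by (simp add: n_root_def)
  have q: "?q = ?g * (?q div ?g)" by simp
  have cop: "coprime (n_root C \<alpha>) (?q div ?g)"
    unfolding n_root_def using g by (intro div_gcd_coprime) auto
  have "int n dvd k * ?q \<longleftrightarrow> ?g * n_root C \<alpha> dvd ?g * (k * (?q div ?g))"
    by (rule arg_cong2[OF n trans[OF arg_cong[OF q, of "(*) k"] mult.left_commute]])
  also have "\<dots> \<longleftrightarrow> n_root C \<alpha> dvd k * (?q div ?g)" using g dvd_mult_cancel_left by blast
  also have "\<dots> \<longleftrightarrow> n_root C \<alpha> dvd k" using cop by (simp add: coprime_dvd_mult_left_iff)
  finally show ?thesis by simp
qed

text \<open>The span of the simple generators is stable under simple reflections: reflecting
  \<open>gen \<delta>\<close> in \<alpha> subtracts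
  \<open>n_root C \<delta> * \<alpha> (coroot C \<delta>)\<close> times the coroot of \<alpha>, and
  symmetry of the polar form makes \<open>n_root C \<alpha>\<close> divide this number. The other
  generators follow by lowering roots.\<close>

lemma YSC_simple: "YSC C = zspan (gen ` simple C)"
proof
  note rdD = root_datumD[OF rd] and inv = bd_settingD(7)[OF setting, rule_format]
  have S: "\<alpha> \<in> roots C" if "\<alpha> \<in> simple C" for \<alpha> using rdD(8) that by blast
  show "zspan (gen ` simple C) \<subseteq> YSC C" unfolding YSC_def
    by (intro zspan_least is_lattice_zspan order_trans[OF _ zspan_superset])
      (use S in \<open>auto simp: gen_def\<close>)
  let ?L = "zspan (gen ` simple C)"
  have L: "is_lattice ?L" by (rule is_lattice_zspan)
  note Ll = is_latticeD[OF L]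
  have gen_in: "gen \<alpha> \<in> ?L" if "\<alpha> \<in> simple C" for \<alpha> using zspan_superset[of "gen ` simple C"] that by blast
  have stable: "coreflection (coroot C) \<alpha> y \<in> ?L" if \<alpha>: "\<alpha> \<in> simple C" and "y \<in> ?L" for \<alpha> y
  proof -
    let ?M = "{y. coreflection (coroot C) \<alpha> y \<in> ?L}"
    note cs = coreflection_simps[OF rd S[OF \<alpha>]]
    have "is_lattice ?M" unfolding is_lattice_def using Ll by (auto simp: cs)
    moreover have "gen \<delta> \<in> ?M" if \<delta>: "\<delta> \<in> simple C" for \<delta>
    proof -
      have "int n dvd n_root C \<delta> * Qf C (coroot C \<delta>)" using n_root_dvd_iff[of \<delta> "n_root C \<delta>"] by simp
      then have "int n dvd n_root C \<delta> * Qf C (coroot C \<delta>) * \<delta> (coroot C \<alpha>)" by (rule dvd_mult2)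
      moreover have "\<alpha> (coroot C \<delta>) * Qf C (coroot C \<alpha>) = \<delta> (coroot C \<alpha>) * Qf C (coroot C \<delta>)"
        using polar_coroot[OF rd quad S[OF \<alpha>] inv[OF S[OF \<alpha>]], of "coroot C \<delta>"]
          polar_coroot[OF rd quad S[OF \<delta>] inv[OF S[OF \<delta>]], of "coroot C \<alpha>"]
          polar_simps(2)[OF quad, of "coroot C \<alpha>"] by simp
      ultimately have "int n dvd n_root C \<delta> * \<alpha> (coroot C \<delta>) * Qf C (coroot C \<alpha>)"
        by (simp add: mult_ac)
      then have "n_root C \<alpha> dvd n_root C \<delta> * \<alpha> (coroot C \<delta>)" by (simp add: n_root_dvd_iff)
      then obtain k where k: "n_root C \<delta> * \<alpha> (coroot C \<delta>) = k * n_root C \<alpha>" by (metis dvdE mult.commute)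
      have "coreflection (coroot C) \<alpha> (gen \<delta>) = gen \<delta> - zsc k (gen \<alpha>)"
        by (simp add: coreflection_def gen_def root_simps[OF rd S[OF \<alpha>]] k zsc_zsc)
      then show ?thesis using gen_in \<alpha> \<delta> Ll by simp
    qed
    ultimately have "?L \<subseteq> ?M" by (intro zspan_least) auto
    then show ?thesis using \<open>y \<in> ?L\<close> by blast
  qed
  \<comment> \<open>The multiplier depends on the coroot only through \<open>Qf C\<close>, hence is
    Weyl invariant.\<close>
  define N where "N v = int n div gcd (int n) (Qf C v)" for v
  have nr: "n_root C \<alpha> = N (coroot C \<alpha>)" for \<alpha> by (simp add: n_root_def N_def)
  have "zsc (n_root C \<beta>) (coroot C \<beta>) \<in> ?L" if "\<beta> \<in> roots C" for \<beta>
    unfolding nr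
    by (rule coroots_in_lattice[OF rd L _ _ stable that])
      (use gen_in inv in \<open>auto simp: N_def gen_def n_root_def\<close>)
  then show "YSC C \<subseteq> ?L" unfolding YSC_def by (intro zspan_least[OF L]) auto
qed

text \<open>With coordinates dual to the simple generators, a character of \<open>YSC\<close> can be
  prescribed on them; this is how \<open>s_psi\<close> is obtained.\<close>

lemma YSC_coordinates:
  "\<exists>k. (\<forall>x\<in>YSC C. \<forall>y\<in>YSC C. \<forall>\<alpha>\<in>simple C. k (x + y) \<alpha> = k x \<alpha> + k y \<alpha>) \<and>
     (\<forall>\<alpha>\<in>simple C. \<forall>\<beta>\<in>simple C. k (gen \<alpha>) \<beta> = (if \<beta> = \<alpha> then 1 else 0 :: int))"
proof -
  have fin: "finite (simple C)" using root_datumD(9)[OF rd] .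
  let ?s = "\<lambda>c. \<Sum>\<alpha>\<in>simple C. zsc (c \<alpha>) (gen \<alpha>)"
  have s_add: "?s (\<lambda>\<alpha>. c \<alpha> + d \<alpha>) = ?s c + ?s d" for c d by (simp add: zsc_add sum.distrib)
  have s_neg: "?s (\<lambda>\<alpha>. - c \<alpha>) = - ?s c" for c by (simp add: zsc_uminus sum_negf)
  have s_unit: "?s (\<lambda>\<beta>. if \<beta> = \<alpha> then 1 else 0) = gen \<alpha>" if "\<alpha> \<in> simple C" for \<alpha>
  proof -
    have "?s (\<lambda>\<beta>. if \<beta> = \<alpha> then 1 else 0) = (\<Sum>\<beta>\<in>simple C. if \<beta> = \<alpha> then gen \<alpha> else 0)"
      by (intro sum.cong) auto
    then show ?thesis using that fin by simp
  qed
  have inj: "c \<alpha> = d \<alpha>" if "?s c = ?s d" "\<alpha> \<in> simple C" for c d \<alpha>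
  proof -
    have "?s (\<lambda>\<alpha>. c \<alpha> + - d \<alpha>) = 0" using that(1) by (simp only: s_add s_neg) simp
    then have "(\<Sum>\<alpha>\<in>simple C. zsc ((c \<alpha> + - d \<alpha>) * n_root C \<alpha>) (coroot C \<alpha>)) = 0"
      by (simp add: gen_def zsc_zsc)
    from simple_coroots_independent[OF rd this that(2)] show ?thesis using n_root_pos[of \<alpha>] by simp
  qed
  let ?L = "range ?s"
  have "is_lattice ?L" unfolding is_lattice_def
  proof (intro conjI ballI)
    show "0 \<in> ?L" by (rule image_eqI[of _ _ "\<lambda>_. 0"]) auto
    fix x assume "x \<in> ?L"
    then obtain c where c: "x = ?s c" by blast
    have "- x = ?s (\<lambda>\<alpha>. - c \<alpha>)" by (simp only: c s_neg)
    then show "- x \<in> ?L" by (rule range_eqI[where x = "\<lambda>\<alpha>. - c \<alpha>"])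
    fix y assume "y \<in> ?L"
    then obtain d where d: "y = ?s d" by blast
    have "x + y = ?s (\<lambda>\<alpha>. c \<alpha> + d \<alpha>)" by (simp only: c d s_add)
    then show "x + y \<in> ?L" by (rule range_eqI[where x = "\<lambda>\<alpha>. c \<alpha> + d \<alpha>"])
  qed
  moreover have "gen ` simple C \<subseteq> ?L" 
  proof
    fix x assume "x \<in> gen ` simple C"
    then obtain \<alpha> where "\<alpha> \<in> simple C" "x = gen \<alpha>" by blast
    then have "x = ?s (\<lambda>\<beta>. if \<beta> = \<alpha> then 1 else 0)" by (simp only: s_unit)
    then show "x \<in> ?L" by (rule range_eqI[where x = "\<lambda>\<beta>. if \<beta> = \<alpha> then 1 else 0"])
  qed
  ultimately have sub: "YSC C \<subseteq> ?L" unfolding YSC_simple by (rule zspan_least)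
  define k where "k y = (SOME c. ?s c = y)" for y
  have k: "?s (k y) = y" if "y \<in> YSC C" for y
  proof -
    have "\<exists>c. ?s c = y" using sub that by blast
    then show ?thesis unfolding k_def by (rule someI_ex)
  qed
  show ?thesis
  proof (intro exI[of _ k] conjI ballI)
    show "k (x + y) \<alpha> = k x \<alpha> + k y \<alpha>" if "x \<in> YSC C" "y \<in> YSC C" "\<alpha> \<in> simple C" for x y \<alpha>
      using inj[of "k (x + y)" "\<lambda>\<alpha>. k x \<alpha> + k y \<alpha>" \<alpha>] k that is_latticeD(2)[OF YSC_lattice]
      by (simp only: s_add)
    show "k (gen \<alpha>) \<beta> = (if \<beta> = \<alpha> then 1 else 0)" if "\<alpha> \<in> simple C" "\<beta> \<in> simple C" for \<alpha> \<beta>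
    proof -
      have "gen \<alpha> \<in> YSC C" unfolding YSC_simple using zspan_superset[of "gen ` simple C"] that by blast
      then show ?thesis using inj[of "k (gen \<alpha>)" "\<lambda>\<beta>. if \<beta> = \<alpha> then 1 else 0" \<beta>] k s_unit that by simp
    qed
  qed
qed

lemma pinned_lift:
  assumes "\<alpha> \<in> simple C"
  shows "fmap C (sQ C \<alpha>) \<in> carrier G" "pr (fmap C (sQ C \<alpha>)) = coroot C \<alpha>"
    "\<gamma> \<in> \<Gamma> \<Longrightarrow> act \<gamma> (fmap C (sQ C \<alpha>)) = fmap C (sQ C \<alpha>)"
proof -
  have q: "sQ C \<alpha> \<in> carrier (grp (DQ C))" "prj (DQ C) (sQ C \<alpha>) = coroot C \<alpha>"
    using bd_facts(6)[OF assms] by auto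
  show "fmap C (sQ C \<alpha>) \<in> carrier G" using bd_facts(8) q(1) by (auto simp: hom_def)
  show "pr (fmap C (sQ C \<alpha>)) = coroot C \<alpha>" using bd_facts(9)[OF q(1)] q(2) by simp
  show "act \<gamma> (fmap C (sQ C \<alpha>)) = fmap C (sQ C \<alpha>)" if "\<gamma> \<in> \<Gamma>"
    using bd_facts(10)[OF that q(1)] bd_facts(7)[OF assms that] by simp
qed

text \<open>The description \<open>THE\<close> in the definition of \<open>s_psi\<close> has exactly
  one solution. An arbitrary splitting misses the pinned values on the generators by scalars
  \<open>u \<alpha>\<close>; multiplying it by the character with these values gives existence, and
  the generators force uniqueness.\<close>

lemma s_psi:
  shows "s_psi C \<in> splittings C (YSC C)"
    "\<alpha> \<in> simple C \<Longrightarrow> s_psi C (gen \<alpha>) = fmap C (sQ C \<alpha>) [^]\<^bsub>G\<^esub> n_root C \<alpha>"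
proof -
  define l where "l \<alpha> = fmap C (sQ C \<alpha>) [^]\<^bsub>G\<^esub> n_root C \<alpha>" for \<alpha>
  have l: "l \<alpha> \<in> carrier G" "pr (l \<alpha>) = gen \<alpha>" if "\<alpha> \<in> simple C" for \<alpha>
    using pinned_lift[OF that] by (auto simp: l_def gen_def pr_simps)
  have gen_in: "gen \<alpha> \<in> YSC C" if "\<alpha> \<in> simple C" for \<alpha>
    unfolding YSC_simple using zspan_superset[of "gen ` simple C"] that by blast
  obtain s where s: "s \<in> splittings C (YSC C)" by (rule splitting_exists[OF YSC_lattice YSC_sub])
  note S = splittingsD[OF s]
  have "\<exists>u. u \<noteq> 0 \<and> l \<alpha> = s (gen \<alpha>) \<cdot> e u" if "\<alpha> \<in> simple C" for \<alpha>
    using same_fibre[OF S(1) l(1)[OF that]] S(2)[OF gen_in[OF that]] l(2)[OF that] by metis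
  then obtain u where u: "\<And>\<alpha>. \<alpha> \<in> simple C \<Longrightarrow> u \<alpha> \<noteq> 0" "\<And>\<alpha>. \<alpha> \<in> simple C \<Longrightarrow> l \<alpha> = s (gen \<alpha>) \<cdot> e (u \<alpha>)"
    by metis
  obtain k where kk: "\<forall>x\<in>YSC C. \<forall>y\<in>YSC C. \<forall>\<alpha>\<in>simple C. k (x + y) \<alpha> = k x \<alpha> + k y \<alpha>"
    "\<forall>\<alpha>\<in>simple C. \<forall>\<beta>\<in>simple C. k (gen \<alpha>) \<beta> = (if \<beta> = \<alpha> then 1 else 0 :: int)"
    using YSC_coordinates by (elim exE conjE)
  have k: "x \<in> YSC C \<Longrightarrow> y \<in> YSC C \<Longrightarrow> \<alpha> \<in> simple C \<Longrightarrow> k (x + y) \<alpha> = k x \<alpha> + k y \<alpha>"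
    "\<alpha> \<in> simple C \<Longrightarrow> \<beta> \<in> simple C \<Longrightarrow> k (gen \<alpha>) \<beta> = (if \<beta> = \<alpha> then 1 else 0)" for x y \<alpha> \<beta>
    using kk by simp_all
  define t where "t y = (\<Prod>\<alpha>\<in>simple C. u \<alpha> powi k y \<alpha>)" for y
  have fin: "finite (simple C)" using root_datumD(9)[OF rd] .
  have t0: "t y \<noteq> 0" for y using u(1) fin by (simp add: t_def)
  have ta: "t (x + y) = t x * t y" if "x \<in> YSC C" "y \<in> YSC C" for x y
    unfolding t_def prod.distrib[symmetric]
    by (rule prod.cong) (use k(1) that u(1) in \<open>auto simp: power_int_add\<close>)
  have tg: "t (gen \<alpha>) = u \<alpha>" if "\<alpha> \<in> simple C" for \<alpha>
  proof -
    have "t (gen \<alpha>) = (\<Prod>\<beta>\<in>simple C. if \<beta> = \<alpha> then u \<alpha> else 1)"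
      unfolding t_def by (rule prod.cong) (use k(2)[OF that] in auto)
    then show ?thesis using that fin by simp
  qed
  define s' where "s' y = (if y \<in> YSC C then s y \<cdot> e (t y) else \<one>\<^bsub>G\<^esub>)" for y
  have s': "s' \<in> splittings C (YSC C)"
    unfolding splittings_def
  proof (intro CollectI conjI ballI allI impI)
    fix x assume x: "x \<in> YSC C"
    then show "s' x \<in> carrier G" "pr (s' x) = x" using S t0 by (auto simp: s'_def e_simps pr_simps)
    fix y assume y: "y \<in> YSC C"
    have "s x \<cdot> s y \<cdot> (e (t x) \<cdot> e (t y)) = (s x \<cdot> e (t x)) \<cdot> (s y \<cdot> e (t y))"
      using S(1) t0 e_simps(1) e_central by (metis (no_types, lifting) D.m_assoc D.m_closed)
    then show "s' (x + y) = s' x \<cdot> s' y"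
      using x y S(3) ta t0 is_latticeD(2)[OF YSC_lattice] by (simp add: s'_def e_simps)
  qed (simp add: s'_def)
  have g': "s' (gen \<alpha>) = l \<alpha>" if "\<alpha> \<in> simple C" for \<alpha>
    using that gen_in tg u(2) by (simp add: s'_def)
  have "s_psi C = s'"
    unfolding s_psi_def
  proof (rule the_equality)
    show "s' \<in> splittings C (YSC C) \<and> (\<forall>\<alpha>\<in>simple C. s' (zsc (n_root C \<alpha>) (coroot C \<alpha>)) =
        fmap C (sQ C \<alpha>) [^]\<^bsub>G\<^esub> n_root C \<alpha>)"
      using s' g' by (simp add: gen_def l_def)
    fix s'' assume s'': "s'' \<in> splittings C (YSC C) \<and> (\<forall>\<alpha>\<in>simple C. s'' (zsc (n_root C \<alpha>) (coroot C \<alpha>)) =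
        fmap C (sQ C \<alpha>) [^]\<^bsub>G\<^esub> n_root C \<alpha>)"
    show "s'' = s'"
      by (rule splittings_eqI[of _ "gen ` simple C"])
        (use s'' s' g' in \<open>auto simp: gen_def l_def YSC_simple[symmetric, unfolded gen_def]\<close>)
  qed
  then show "s_psi C \<in> splittings C (YSC C)" "\<alpha> \<in> simple C \<Longrightarrow> s_psi C (gen \<alpha>) = fmap C (sQ C \<alpha>) [^]\<^bsub>G\<^esub> n_root C \<alpha>"
    using s' g' by (auto simp: l_def)
qed

text \<open>A Galois conjugate of \<open>s_psi\<close> is again a splitting, and on the generators
  its values are unchanged, being powers of rational lifts.\<close>

lemma act_s_psi:
  assumes "\<gamma> \<in> \<Gamma>"
  shows "act \<gamma> (s_psi C y) = s_psi C y"
proof -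
  note A = act_simps[OF assms] and S = splittingsD[OF s_psi(1)]
  have "(\<lambda>y. act \<gamma> (s_psi C y)) \<in> splittings C (YSC C)"
    using A S by (auto simp: splittings_def)
  moreover have "act \<gamma> (s_psi C (gen \<alpha>)) = s_psi C (gen \<alpha>)" if \<alpha>: "\<alpha> \<in> simple C" for \<alpha>
  proof -
    have "act \<gamma> (fmap C (sQ C \<alpha>) [^]\<^bsub>G\<^esub> n_root C \<alpha>) = act \<gamma> (fmap C (sQ C \<alpha>)) [^]\<^bsub>G\<^esub> n_root C \<alpha>"
      by (rule hom_int_pow[OF gm_extensionD(5)[OF ext assms] pinned_lift(1)[OF \<alpha>] D.is_group D.is_group])
    then show ?thesis using s_psi(2)[OF \<alpha>] pinned_lift(3)[OF \<alpha> assms] by simp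
  qed
  ultimately have "(\<lambda>y. act \<gamma> (s_psi C y)) = s_psi C"
    using s_psi(1) unfolding YSC_simple by (intro splittings_eqI[of _ "gen ` simple C"]) auto
  then show ?thesis by (rule fun_cong)
qed

text \<open>The obstruction is the cocycle by which Galois moves an arbitrary lift
  \<open>d0\<close>. Smoothness makes it trivial on the stabiliser of a finite set, so Hilbert 90
  applies.\<close>

lemma rational_lift:
  obtains d where "d \<in> carrier G" "pr d = y" "\<And>\<gamma>. \<gamma> \<in> \<Gamma> \<Longrightarrow> act \<gamma> d = d"
proof -
  obtain d0 where d0: "d0 \<in> carrier G" "pr d0 = y" using pr_simps(2) by blast
  have "\<exists>u. u \<noteq> 0 \<and> act \<gamma> d0 = d0 \<cdot> e u" if "\<gamma> \<in> \<Gamma>" for \<gamma>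
    using same_fibre[OF d0(1) act_simps(1)[OF that d0(1)]] act_simps(3)[OF that d0(1)] by metis
  then obtain c where c: "\<And>\<gamma>. \<gamma> \<in> \<Gamma> \<Longrightarrow> c \<gamma> \<noteq> 0" "\<And>\<gamma>. \<gamma> \<in> \<Gamma> \<Longrightarrow> act \<gamma> d0 = d0 \<cdot> e (c \<gamma>)" by metis
  have uniq: "u = v" if "d0 \<cdot> e u = d0 \<cdot> e v" "u \<noteq> 0" "v \<noteq> 0" for u v
    using that d0(1) e_simps(1,5) by (metis D.Units_l_cancel D.Units_eq)
  have "\<forall>a\<in>carrier G. \<exists>S. finite S \<and> (\<forall>\<gamma>\<in>\<Gamma>. (\<forall>x\<in>S. \<gamma> x = x) \<longrightarrow> act \<gamma> a = a)"
    using ext unfolding gm_extension_def by (elim conjE)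
  then obtain S where S: "finite S" "\<forall>\<gamma>\<in>\<Gamma>. (\<forall>x\<in>S. \<gamma> x = x) \<longrightarrow> act \<gamma> d0 = d0" using d0(1) by blast
  obtain a where a: "a \<noteq> 0" "\<And>\<gamma>. \<gamma> \<in> \<Gamma> \<Longrightarrow> c \<gamma> * \<gamma> a = a"
  proof (rule hilbert_90[OF bd_facts(2) S(1), of c])
    show "c (\<gamma> \<circ> \<delta>) = c \<gamma> * \<gamma> (c \<delta>)" if g: "\<gamma> \<in> \<Gamma>" "\<delta> \<in> \<Gamma>" for \<gamma> \<delta>
    proof (rule uniq)
      have nz: "\<gamma> (c \<delta>) \<noteq> 0" using c(1)[OF g(2)] gal_simps(7)[OF g(1)] by simp
      have "d0 \<cdot> e (c (\<gamma> \<circ> \<delta>)) = act \<gamma> (act \<delta> d0)"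
        using c(2)[OF gal_comp[OF g]] gm_extensionD(7)[OF ext g d0(1)] by simp
      also have "\<dots> = d0 \<cdot> e (c \<gamma>) \<cdot> e (\<gamma> (c \<delta>))"
        using c g d0 act_simps(2,4)[OF g(1)] by (simp add: e_simps)
      also have "\<dots> = d0 \<cdot> e (c \<gamma> * \<gamma> (c \<delta>))" using nz c(1)[OF g(1)] d0 by (simp add: e_simps D.m_assoc)
      finally show "d0 \<cdot> e (c (\<gamma> \<circ> \<delta>)) = d0 \<cdot> e (c \<gamma> * \<gamma> (c \<delta>))" .
      show "c \<gamma> * \<gamma> (c \<delta>) \<noteq> 0" using nz c(1)[OF g(1)] by simp
      show "c (\<gamma> \<circ> \<delta>) \<noteq> 0" using c(1) gal_comp g by blast
    qed
    show "c \<gamma> = 1" if "\<gamma> \<in> \<Gamma>" "\<And>x. x \<in> S \<Longrightarrow> \<gamma> x = x" for \<gamma>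
      by (rule uniq) (use c S(2) that d0 in \<open>auto simp: e_simps\<close>)
  qed (use c(1) in auto)
  show ?thesis
  proof (rule that[of "d0 \<cdot> e a"])
    show "d0 \<cdot> e a \<in> carrier G" "pr (d0 \<cdot> e a) = y" using d0 a(1) by (auto simp: e_simps pr_simps)
    fix \<gamma> assume g: "\<gamma> \<in> \<Gamma>"
    have nz: "\<gamma> a \<noteq> 0" using a(1) gal_simps(7)[OF g] by simp
    have "act \<gamma> (d0 \<cdot> e a) = d0 \<cdot> e (c \<gamma>) \<cdot> e (\<gamma> a)"
      using d0 a(1) c(2)[OF g] act_simps(2,4)[OF g] by (simp add: e_simps)
    also have "\<dots> = d0 \<cdot> e (c \<gamma> * \<gamma> a)" using nz c(1)[OF g] d0 by (simp add: e_simps D.m_assoc)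
    finally show "act \<gamma> (d0 \<cdot> e a) = d0 \<cdot> e a" using a(2)[OF g] by simp
  qed
qed

lemma D_Qn_simps:
  shows "d \<in> D_Qn C \<Longrightarrow> d \<in> carrier G" "d \<in> D_Qn C \<Longrightarrow> pr d \<in> YQn C"
    "d \<in> D_Qn C \<Longrightarrow> \<gamma> \<in> \<Gamma> \<Longrightarrow> act \<gamma> d = d"
    "d \<in> D_Qn C \<Longrightarrow> d' \<in> D_Qn C \<Longrightarrow> d \<cdot> d' \<in> D_Qn C"
    "y \<in> YSC C \<Longrightarrow> s_psi C y \<in> D_Qn C" "u \<noteq> 0 \<Longrightarrow> e u \<in> D_Qn C \<longleftrightarrow> u \<in> base C"
    "y \<in> YQn C \<Longrightarrow> \<exists>d\<in>D_Qn C. pr d = y"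
proof -
  show "d \<in> D_Qn C \<Longrightarrow> d \<in> carrier G" "d \<in> D_Qn C \<Longrightarrow> pr d \<in> YQn C" "d \<in> D_Qn C \<Longrightarrow> \<gamma> \<in> \<Gamma> \<Longrightarrow> act \<gamma> d = d"
    by (auto simp: D_Qn_def)
  show "d \<in> D_Qn C \<Longrightarrow> d' \<in> D_Qn C \<Longrightarrow> d \<cdot> d' \<in> D_Qn C"
    using is_latticeD(2)[OF YQn_lattice] by (auto simp: D_Qn_def pr_simps act_simps)
  show "y \<in> YSC C \<Longrightarrow> s_psi C y \<in> D_Qn C"
    using splittingsD[OF s_psi(1)] act_s_psi YSC_sub by (auto simp: D_Qn_def)
  show "e u \<in> D_Qn C \<longleftrightarrow> u \<in> base C" if u: "u \<noteq> 0"
  proof -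
    have "act \<gamma> (e u) = e u \<longleftrightarrow> \<gamma> u = u" if "\<gamma> \<in> \<Gamma>" for \<gamma>
      using act_simps(4)[OF that u] e_simps(5)[of "\<gamma> u" u] gal_simps(7)[OF that, of u] u by simp
    then have "e u \<in> D_Qn C \<longleftrightarrow> (\<forall>\<gamma>\<in>\<Gamma>. \<gamma> u = u)"
      using u is_latticeD(1)[OF YQn_lattice] by (auto simp: D_Qn_def e_simps)
    moreover have "\<dots> \<longleftrightarrow> u \<in> base C"
      using fixed_field_gal[OF bd_facts(1,2), of u] by (auto simp: gal_def)
    ultimately show ?thesis by simp
  qed
  show "y \<in> YQn C \<Longrightarrow> \<exists>d\<in>D_Qn C. pr d = y"
    by (rule rational_lift[of y]) (auto simp: D_Qn_def)
qed

end

section \<open>The groupoid of base points\<close>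

context bd
begin

section \<open>Groups of characters and their torsion\<close>

lemma That_simps:
  shows "(\<lambda>_. 1) \<in> That C" "t \<in> That C \<Longrightarrow> t' \<in> That C \<Longrightarrow> fmult t t' \<in> That C"
    "t \<in> That C \<Longrightarrow> (\<lambda>y. inverse (t y)) \<in> That C" "t \<in> That C \<Longrightarrow> t y \<noteq> 0"
    "\<gamma> \<in> \<Gamma> \<Longrightarrow> t \<in> That C \<Longrightarrow> \<gamma> \<circ> t \<in> That C" "t \<in> That C \<Longrightarrow> y \<notin> YQn C \<Longrightarrow> t y = 1"
  unfolding That_def by (rule chars_closed chars_nz chars_gal; assumption)+ (simp add: chars_def)

lemma That_SC_simps:
  shows "(\<lambda>_. 1) \<in> That_SC C" "t \<in> That_SC C \<Longrightarrow> t' \<in> That_SC C \<Longrightarrow> fmult t t' \<in> That_SC C"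
    "t \<in> That_SC C \<Longrightarrow> (\<lambda>y. inverse (t y)) \<in> That_SC C" "t \<in> That_SC C \<Longrightarrow> t y \<noteq> 0"
    "\<gamma> \<in> \<Gamma> \<Longrightarrow> t \<in> That_SC C \<Longrightarrow> \<gamma> \<circ> t \<in> That_SC C" "t \<in> That_SC C \<Longrightarrow> y \<notin> YSC C \<Longrightarrow> t y = 1"
  unfolding That_SC_def by (rule chars_closed chars_nz chars_gal; assumption)+ (simp add: chars_def)

lemma Ttilde_simps:
  shows "(\<lambda>_. 1) \<in> Ttilde C" "t \<in> Ttilde C \<Longrightarrow> t' \<in> Ttilde C \<Longrightarrow> fmult t t' \<in> Ttilde C"
    "t \<in> Ttilde C \<Longrightarrow> (\<lambda>y. inverse (t y)) \<in> Ttilde C" "t \<in> Ttilde C \<Longrightarrow> t y \<noteq> 0"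
    "t \<in> Ttilde C \<Longrightarrow> y \<notin> YQn C \<Longrightarrow> t y = 1"
  unfolding Ttilde_def by (rule chars_closed chars_nz; assumption)+ (simp add: chars_def)

lemma eps_simps:
  shows "a ^ n = 1 \<Longrightarrow> b ^ n = 1 \<Longrightarrow> eps C (a * b) = eps C a * eps C b" "a ^ n = 1 \<Longrightarrow> eps C a \<noteq> 0"
    "eps C 1 = 1" "\<gamma> \<in> \<Gamma> \<Longrightarrow> a ^ n = 1 \<Longrightarrow> \<gamma> a = a"
    "a ^ n = 1 \<Longrightarrow> eps C (inverse a) = inverse (eps C a)"
proof -
  show m: "a ^ n = 1 \<Longrightarrow> b ^ n = 1 \<Longrightarrow> eps C (a * b) = eps C a * eps C b" and "a ^ n = 1 \<Longrightarrow> eps C a \<noteq> 0"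
    and "\<gamma> \<in> \<Gamma> \<Longrightarrow> a ^ n = 1 \<Longrightarrow> \<gamma> a = a" for a b
    using bd_eps[OF setting] by blast+
  show o: "eps C 1 = 1" using bd_eps(3)[OF setting, of 1 1] by simp
  show "a ^ n = 1 \<Longrightarrow> eps C (inverse a) = inverse (eps C a)"
  proof -
    assume a: "a ^ n = 1"
    then have "a \<noteq> 0" using n_pos by (metis zero_power zero_neq_one)
    then show ?thesis using m[OF a, of "inverse a"] a o by (simp add: power_inverse inverse_unique)
  qed
qed

lemma tors_simps:
  shows "(\<lambda>_. 1) \<in> tors n (That C)"
    "\<xi> \<in> tors n (That C) \<Longrightarrow> \<xi>' \<in> tors n (That C) \<Longrightarrow> fmult \<xi> \<xi>' \<in> tors n (That C)"
    "\<xi> \<in> tors n (That C) \<Longrightarrow> (\<lambda>y. inverse (\<xi> y)) \<in> tors n (That C)"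
    "\<xi> \<in> tors n (That C) \<Longrightarrow> \<xi> \<in> That C" "\<xi> \<in> tors n (That C) \<Longrightarrow> \<xi> y ^ n = 1"
    "\<gamma> \<in> \<Gamma> \<Longrightarrow> \<xi> \<in> tors n (That C) \<Longrightarrow> \<gamma> \<circ> \<xi> = \<xi>"
    "\<xi> \<in> tors n (That C) \<Longrightarrow> res (YSC C) \<xi> \<in> tors n (That_SC C)"
    "\<xi> \<in> tors n (That C) \<Longrightarrow> \<zeta> \<in> Ttilde C \<Longrightarrow> (\<lambda>y. inverse (eps C (\<xi> y)) * \<zeta> y) \<in> Ttilde C"
proof -
  show "(\<lambda>_. 1) \<in> tors n (That C)" by (simp add: tors_def That_simps)
  show "\<xi> \<in> tors n (That C) \<Longrightarrow> \<xi>' \<in> tors n (That C) \<Longrightarrow> fmult \<xi> \<xi>' \<in> tors n (That C)"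
    using That_simps(2) by (auto simp: tors_def) (auto simp: fmult_def power_mult_distrib)
  show "\<xi> \<in> tors n (That C) \<Longrightarrow> (\<lambda>y. inverse (\<xi> y)) \<in> tors n (That C)"
    using That_simps(3) by (auto simp: tors_def power_inverse)
  show T: "\<xi> \<in> tors n (That C) \<Longrightarrow> \<xi> \<in> That C" and p: "\<xi> \<in> tors n (That C) \<Longrightarrow> \<xi> y ^ n = 1" for y
    by (auto simp: tors_def)
  show "\<gamma> \<in> \<Gamma> \<Longrightarrow> \<xi> \<in> tors n (That C) \<Longrightarrow> \<gamma> \<circ> \<xi> = \<xi>"
    using eps_simps(4) p by (auto simp: fun_eq_iff)
  show "\<xi> \<in> tors n (That C) \<Longrightarrow> res (YSC C) \<xi> \<in> tors n (That_SC C)"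
    using res_That[OF setting T] p by (auto simp: tors_def) (auto simp: res_def)
  assume x: "\<xi> \<in> tors n (That C)" and z: "\<zeta> \<in> Ttilde C"
  have "(\<lambda>y. eps C (\<xi> y)) \<in> Ttilde C"
    using T[OF x] eps_simps(1-3) p[OF x] by (auto simp: chars_def That_def Ttilde_def)
  from Ttilde_simps(2)[OF Ttilde_simps(3)[OF this] z]
  show "(\<lambda>y. inverse (eps C (\<xi> y)) * \<zeta> y) \<in> Ttilde C" by (simp add: fmult_def)
qed

lemma tors_SC_simps:
  shows "(\<lambda>_. 1) \<in> tors n (That_SC C)"
    "\<xi> \<in> tors n (That_SC C) \<Longrightarrow> \<xi>' \<in> tors n (That_SC C) \<Longrightarrow> fmult \<xi> \<xi>' \<in> tors n (That_SC C)"
    "\<xi> \<in> tors n (That_SC C) \<Longrightarrow> (\<lambda>y. inverse (\<xi> y)) \<in> tors n (That_SC C)"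
    "\<xi> \<in> tors n (That_SC C) \<Longrightarrow> \<xi> \<in> That_SC C" "\<xi> \<in> tors n (That_SC C) \<Longrightarrow> \<xi> y ^ n = 1"
    "\<gamma> \<in> \<Gamma> \<Longrightarrow> \<xi> \<in> tors n (That_SC C) \<Longrightarrow> \<gamma> \<circ> \<xi> = \<xi>"
    "\<xi> \<in> tors n (That_SC C) \<Longrightarrow> \<zeta> \<in> Ttilde_SC C \<Longrightarrow> (\<lambda>y. inverse (eps C (\<xi> y)) * \<zeta> y) \<in> Ttilde_SC C"
proof -
  show "(\<lambda>_. 1) \<in> tors n (That_SC C)" by (simp add: tors_def That_SC_simps)
  show "\<xi> \<in> tors n (That_SC C) \<Longrightarrow> \<xi>' \<in> tors n (That_SC C) \<Longrightarrow> fmult \<xi> \<xi>' \<in> tors n (That_SC C)"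
    using That_SC_simps(2) by (auto simp: tors_def) (auto simp: fmult_def power_mult_distrib)
  show "\<xi> \<in> tors n (That_SC C) \<Longrightarrow> (\<lambda>y. inverse (\<xi> y)) \<in> tors n (That_SC C)"
    using That_SC_simps(3) by (auto simp: tors_def power_inverse)
  show T: "\<xi> \<in> tors n (That_SC C) \<Longrightarrow> \<xi> \<in> That_SC C" and p: "\<xi> \<in> tors n (That_SC C) \<Longrightarrow> \<xi> y ^ n = 1" for y
    by (auto simp: tors_def)
  show "\<gamma> \<in> \<Gamma> \<Longrightarrow> \<xi> \<in> tors n (That_SC C) \<Longrightarrow> \<gamma> \<circ> \<xi> = \<xi>"
    using eps_simps(4) p by (auto simp: fun_eq_iff)
  assume x: "\<xi> \<in> tors n (That_SC C)" and z: "\<zeta> \<in> Ttilde_SC C"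
  have "(\<lambda>y. eps C (\<xi> y)) \<in> chars (YSC C)"
    using T[OF x] eps_simps(1-3) p[OF x] by (auto simp: chars_def That_SC_def)
  from chars_closed(2)[OF chars_closed(3)[OF this] z[unfolded Ttilde_SC_def]]
  show "(\<lambda>y. inverse (eps C (\<xi> y)) * \<zeta> y) \<in> Ttilde_SC C" by (simp add: fmult_def Ttilde_SC_def)
qed

text \<open>Scalars are central, so the quotient of two splittings is multiplicative.\<close>

lemma quotient_char:
  assumes L: "is_lattice L" and s: "s \<in> splittings C L" "s' \<in> splittings C L"
  obtains q where "q \<in> chars L" "\<And>y. s' y = e (q y) \<cdot> s y"
proof -
  note S = splittingsD[OF s(1)] and S' = splittingsD[OF s(2)]
  have "\<exists>u. u \<noteq> 0 \<and> s' y = e u \<cdot> s y" if "y \<in> L" for y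
  proof -
    have "pr (s y) = pr (s' y)" using S(2) S'(2) that by simp
    then obtain u where "u \<noteq> 0" "s' y = s y \<cdot> e u" by (rule same_fibre[OF S(1) S'(1)])
    then show ?thesis using e_central[OF _ S(1)] by auto
  qed
  then obtain u where u: "\<And>y. y \<in> L \<Longrightarrow> u y \<noteq> 0" "\<And>y. y \<in> L \<Longrightarrow> s' y = e (u y) \<cdot> s y" by metis
  define q where "q y = (if y \<in> L then u y else 1)" for y
  have q: "s' y = e (q y) \<cdot> s y" for y
    using u S(4) S'(4) by (auto simp: q_def e_simps)
  have nz: "q y \<noteq> 0" for y using u(1) by (simp add: q_def)
  have "q (x + y) = q x * q y" if xy: "x \<in> L" "y \<in> L" for x y
  proof -
    have "e (q (x + y)) \<cdot> (s x \<cdot> s y) = (e (q x) \<cdot> s x) \<cdot> (e (q y) \<cdot> s y)"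
      using S(3)[OF xy] S'(3)[OF xy] q[of "x + y"] q[of x] q[of y] by simp
    also have "\<dots> = e (q x) \<cdot> ((s x \<cdot> e (q y)) \<cdot> s y)" using nz S(1) by (simp add: e_simps D.m_assoc)
    also have "\<dots> = e (q x) \<cdot> ((e (q y) \<cdot> s x) \<cdot> s y)" using nz S(1) by (simp add: e_central)
    also have "\<dots> = e (q x * q y) \<cdot> (s x \<cdot> s y)" using nz S(1) by (simp add: e_simps D.m_assoc)
    finally have "e (q (x + y)) = e (q x * q y)" using nz S(1) by (simp add: e_simps(1))
    then show ?thesis using nz by (simp add: e_simps(5))
  qed
  then have "q \<in> chars L" using nz by (auto simp: chars_def) (simp add: q_def)
  then show ?thesis using q by (rule that)
qed

section \<open>Objects and their trivialisations over \<open>YSC\<close>\<close>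

lemma is_objectD:
  fixes z :: "('h, 'y, 'k, 'd) gobj"
  assumes "is_object C z"
  shows "tor z \<noteq> {}" "t \<in> That C \<Longrightarrow> x \<in> tor z \<Longrightarrow> tact z t x \<in> tor z" "x \<in> tor z \<Longrightarrow> tact z (\<lambda>_. 1) x = x"
    "t \<in> That C \<Longrightarrow> t' \<in> That C \<Longrightarrow> x \<in> tor z \<Longrightarrow> tact z t (tact z t' x) = tact z (fmult t t') x"
    "x \<in> tor z \<Longrightarrow> x' \<in> tor z \<Longrightarrow> \<exists>t\<in>That C. x' = tact z t x"
    "t \<in> That C \<Longrightarrow> t' \<in> That C \<Longrightarrow> x \<in> tor z \<Longrightarrow> tact z t x = tact z t' x \<longleftrightarrow> t = t'"
    "x \<in> tor z \<Longrightarrow> hmap z x \<in> splittings C (YQn C)"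
    "t \<in> That C \<Longrightarrow> x \<in> tor z \<Longrightarrow> hmap z (tact z t x) y = e (t y ^ n) \<cdot> hmap z x y"
proof -
  note A = assms[unfolded is_object_def]
  have B: "tor z \<noteq> {}" "\<forall>t\<in>That C. \<forall>x\<in>tor z. tact z t x \<in> tor z" "\<forall>x\<in>tor z. tact z (\<lambda>_. 1) x = x"
    "\<forall>t\<in>That C. \<forall>t'\<in>That C. \<forall>x\<in>tor z. tact z (fmult t t') x = tact z t (tact z t' x)"
    "\<forall>x\<in>tor z. \<forall>x'\<in>tor z. \<exists>!t. t \<in> That C \<and> tact z t x = x'"
    "\<forall>x\<in>tor z. hmap z x \<in> splittings C (YQn C)"
    "\<forall>t\<in>That C. \<forall>x\<in>tor z. \<forall>y. hmap z (tact z t x) y = e (t y ^ n) \<cdot> hmap z x y"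
    by (insert A, (elim conjE, assumption)+)
  show "tor z \<noteq> {}" by (fact B)
  show "t \<in> That C \<Longrightarrow> x \<in> tor z \<Longrightarrow> tact z t x \<in> tor z" "x \<in> tor z \<Longrightarrow> tact z (\<lambda>_. 1) x = x"
    "t \<in> That C \<Longrightarrow> t' \<in> That C \<Longrightarrow> x \<in> tor z \<Longrightarrow> tact z t (tact z t' x) = tact z (fmult t t') x"
    "x \<in> tor z \<Longrightarrow> hmap z x \<in> splittings C (YQn C)"
    "t \<in> That C \<Longrightarrow> x \<in> tor z \<Longrightarrow> hmap z (tact z t x) y = e (t y ^ n) \<cdot> hmap z x y"
    using B by simp_all
  show "x \<in> tor z \<Longrightarrow> x' \<in> tor z \<Longrightarrow> \<exists>t\<in>That C. x' = tact z t x" using B(5) by metis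
  show "t \<in> That C \<Longrightarrow> t' \<in> That C \<Longrightarrow> x \<in> tor z \<Longrightarrow> tact z t x = tact z t' x \<longleftrightarrow> t = t'"
    using B(2,5) by metis
qed

lemma hmap_in: "is_object C z \<Longrightarrow> x \<in> tor z \<Longrightarrow> hmap z x y \<in> carrier G"
  by (rule splittingsD(1)[OF is_objectD(7)])

lemma jclsE:
  fixes z :: "('h, 'y, 'k, 'd) gobj"
  assumes "is_object C z"
  obtains j0 \<zeta>0 where "\<And>x. x \<in> tor z \<Longrightarrow> j0 x \<in> That_SC C"
    "\<And>t x. t \<in> That C \<Longrightarrow> x \<in> tor z \<Longrightarrow> j0 (tact z t x) = fmult (res (YSC C) t) (j0 x)"
    "\<And>x y. x \<in> tor z \<Longrightarrow> y \<in> YSC C \<Longrightarrow> e (j0 x y ^ n) \<cdot> s_psi C y = hmap z x y"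
    "\<zeta>0 \<in> Ttilde_SC C" "jcls z = j_class C (tor z) j0 \<zeta>0"
proof -
  have "\<exists>j \<zeta>. (\<forall>x\<in>tor z. j x \<in> That_SC C) \<and>
        (\<forall>t\<in>That C. \<forall>x\<in>tor z. j (tact z t x) = fmult (res (YSC C) t) (j x)) \<and>
        (\<forall>x\<in>tor z. \<forall>y\<in>YSC C. e (j x y ^ n) \<cdot> s_psi C y = hmap z x y) \<and>
        \<zeta> \<in> Ttilde_SC C \<and> jcls z = j_class C (tor z) j \<zeta>"
    using assms unfolding is_object_def by (elim conjE)
  then show ?thesis using that by blast
qed

text \<open>The axioms speak of one representative of the class. Torsion twists preserve its
  properties and generate the same class, so every representative inherits them.\<close>

lemma jclsD:
  fixes z :: "('h, 'y, 'k, 'd) gobj"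
  assumes "is_object C z" "(j, \<zeta>) \<in> jcls z"
  shows "x \<in> tor z \<Longrightarrow> j x \<in> That_SC C"
    "t \<in> That C \<Longrightarrow> x \<in> tor z \<Longrightarrow> j (tact z t x) = fmult (res (YSC C) t) (j x)"
    "x \<in> tor z \<Longrightarrow> y \<in> YSC C \<Longrightarrow> e (j x y ^ n) \<cdot> s_psi C y = hmap z x y"
    "\<zeta> \<in> Ttilde_SC C" "j \<in> extensional (tor z)"
    "jcls z = j_class C (tor z) j \<zeta>"
proof -
  obtain j0 \<zeta>0 where j0: "\<And>x. x \<in> tor z \<Longrightarrow> j0 x \<in> That_SC C"
    "\<And>t x. t \<in> That C \<Longrightarrow> x \<in> tor z \<Longrightarrow> j0 (tact z t x) = fmult (res (YSC C) t) (j0 x)"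
    "\<And>x y. x \<in> tor z \<Longrightarrow> y \<in> YSC C \<Longrightarrow> e (j0 x y ^ n) \<cdot> s_psi C y = hmap z x y"
    "\<zeta>0 \<in> Ttilde_SC C" "jcls z = j_class C (tor z) j0 \<zeta>0" using jclsE[OF assms(1)] by metis
  obtain \<xi> where \<xi>: "\<xi> \<in> tors n (That_SC C)" and j: "j = (\<lambda>x\<in>tor z. fmult \<xi> (j0 x))"
    and \<zeta>: "\<zeta> = (\<lambda>y. inverse (eps C (\<xi> y)) * \<zeta>0 y)"
    using assms(2) unfolding j0(5) j_class_def by auto
  note T = tors_SC_simps and O = is_objectD[OF assms(1)]
  show "x \<in> tor z \<Longrightarrow> j x \<in> That_SC C" using j0(1) T(4)[OF \<xi>] That_SC_simps(2) by (simp add: j)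
  show "t \<in> That C \<Longrightarrow> x \<in> tor z \<Longrightarrow> j (tact z t x) = fmult (res (YSC C) t) (j x)"
    using j0(2) O(2) by (simp add: j fmult_def mult_ac)
  show "x \<in> tor z \<Longrightarrow> y \<in> YSC C \<Longrightarrow> e (j x y ^ n) \<cdot> s_psi C y = hmap z x y"
    using j0(3) T(5)[OF \<xi>] by (simp add: j fmult_def power_mult_distrib)
  show "\<zeta> \<in> Ttilde_SC C" unfolding \<zeta> using T(7)[OF \<xi> j0(4)] .
  show "j \<in> extensional (tor z)" by (simp add: j)
  define P where "P \<eta> = (\<lambda>x\<in>tor z. fmult \<eta> (j0 x), \<lambda>y. inverse (eps C (\<eta> y)) * \<zeta>0 y)" for \<eta>
  have shift: "(\<lambda>x\<in>tor z. fmult \<eta> (j x), \<lambda>y. inverse (eps C (\<eta> y)) * \<zeta> y) = P (fmult \<eta> \<xi>)"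
    if "\<eta> \<in> tors n (That_SC C)" for \<eta>
    using eps_simps(1)[OF T(5)[OF that] T(5)[OF \<xi>]]
    by (auto simp: P_def j \<zeta> fmult_def mult_ac fun_eq_iff restrict_def)
  have img: "(\<lambda>\<eta>. fmult \<eta> \<xi>) ` tors n (That_SC C) = tors n (That_SC C)"
  proof (intro equalityI subsetI)
    fix \<eta> assume \<eta>: "\<eta> \<in> tors n (That_SC C)"
    have "\<eta> = fmult (fmult \<eta> (\<lambda>y. inverse (\<xi> y))) \<xi>"
      using That_SC_simps(4)[OF T(4)[OF \<xi>]] by (auto simp: fmult_def)
    then show "\<eta> \<in> (\<lambda>\<eta>. fmult \<eta> \<xi>) ` tors n (That_SC C)" using T(2)[OF \<eta> T(3)[OF \<xi>]] by blast
  qed (use T(2) \<xi> in auto)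
  have "jcls z = P ` tors n (That_SC C)" unfolding j0(5) j_class_def P_def ..
  also have "\<dots> = (\<lambda>\<eta>. P (fmult \<eta> \<xi>)) ` tors n (That_SC C)" by (subst img[symmetric]) (simp add: image_image)
  also have "\<dots> = j_class C (tor z) j \<zeta>" unfolding j_class_def using shift by (intro image_cong) auto
  finally show "jcls z = j_class C (tor z) j \<zeta>" .
qed

lemma jcls_nonempty:
  fixes z :: "('h, 'y, 'k, 'd) gobj"
  assumes "is_object C z"
  obtains j \<zeta> where "(j, \<zeta>) \<in> jcls z"
proof -
  obtain j0 \<zeta>0 where "jcls z = j_class C (tor z) j0 \<zeta>0" using jclsE[OF assms] by metis
  then have "(\<lambda>x\<in>tor z. fmult (\<lambda>_. 1) (j0 x), \<lambda>y. inverse (eps C 1) * \<zeta>0 y) \<in> jcls z"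
    unfolding j_class_def using tors_SC_simps(1) by blast
  then show ?thesis by (rule that)
qed

lemma jcls_twist:
  fixes z :: "('h, 'y, 'k, 'd) gobj"
  assumes "is_object C z" "(j, \<zeta>) \<in> jcls z" "\<eta> \<in> tors n (That_SC C)"
  shows "(\<lambda>x\<in>tor z. fmult \<eta> (j x), \<lambda>y. inverse (eps C (\<eta> y)) * \<zeta> y) \<in> jcls z"
  unfolding jclsD(6)[OF assms(1,2)] j_class_def using assms(3) by blast

lemma jcls_cases:
  fixes z :: "('h, 'y, 'k, 'd) gobj"
  assumes "is_object C z" "(j, \<zeta>) \<in> jcls z" "(j', \<zeta>') \<in> jcls z"
  obtains \<eta> where "\<eta> \<in> tors n (That_SC C)" "j' = (\<lambda>x\<in>tor z. fmult \<eta> (j x))"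
    "\<zeta>' = (\<lambda>y. inverse (eps C (\<eta> y)) * \<zeta> y)"
  using assms(3) unfolding jclsD(6)[OF assms(1,2)] j_class_def by auto

section \<open>Morphisms through representing pairs\<close>

definition rep :: "('h, 'y, 'k, 'd) gobj \<Rightarrow> ('h, 'y, 'k, 'd) gobj \<Rightarrow> ('h \<Rightarrow> 'h) \<Rightarrow> ('y \<Rightarrow> complex) \<Rightarrow> bool" where
  "rep z z' f \<zeta> \<longleftrightarrow> f \<in> tor z \<rightarrow> tor z' \<and>
     (\<forall>t\<in>That C. \<forall>x\<in>tor z. f (tact z t x) = tact z' t (f x)) \<and>
     (\<forall>x\<in>tor z. hmap z' (f x) = hmap z x) \<and>
     \<zeta> \<in> Ttilde C \<and>
     (\<forall>(j, \<zeta>')\<in>jcls z'. (compose (tor z) j f, fmult \<zeta>' (res (YSC C) \<zeta>)) \<in> jcls z)"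

lemma Mor_iff: "m \<in> Mor C z z' \<longleftrightarrow> (\<exists>f \<zeta>. m = mor_class C z z' f \<zeta> \<and> rep z z' f \<zeta>)"
  unfolding Mor_def rep_def by blast

lemma repD:
  assumes "rep z z' f \<zeta>"
  shows "x \<in> tor z \<Longrightarrow> f x \<in> tor z'" "t \<in> That C \<Longrightarrow> x \<in> tor z \<Longrightarrow> f (tact z t x) = tact z' t (f x)"
    "x \<in> tor z \<Longrightarrow> hmap z' (f x) = hmap z x" "\<zeta> \<in> Ttilde C"
    "(j, \<zeta>') \<in> jcls z' \<Longrightarrow> (compose (tor z) j f, fmult \<zeta>' (res (YSC C) \<zeta>)) \<in> jcls z"
  using assms unfolding rep_def by auto

text \<open>Compatibility with \<open>j\<close> need only be tested on one representative: the
  others are its torsion twists, and a twist over the target carries over to the same twist over the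
  source.\<close>

lemma repI:
  fixes z z' :: "('h, 'y, 'k, 'd) gobj"
  assumes z: "is_object C z" "is_object C z'"
    and f: "\<And>x. x \<in> tor z \<Longrightarrow> f x \<in> tor z'"
      "\<And>t x. t \<in> That C \<Longrightarrow> x \<in> tor z \<Longrightarrow> f (tact z t x) = tact z' t (f x)"
      "\<And>x. x \<in> tor z \<Longrightarrow> hmap z' (f x) = hmap z x" "\<zeta> \<in> Ttilde C"
    and j: "(j, \<zeta>') \<in> jcls z'" "(compose (tor z) j f, fmult \<zeta>' (res (YSC C) \<zeta>)) \<in> jcls z"
  shows "rep z z' f \<zeta>"
proof -
  have "(compose (tor z) i f, fmult \<omega> (res (YSC C) \<zeta>)) \<in> jcls z" if i: "(i, \<omega>) \<in> jcls z'" for i \<omega>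
  proof -
    obtain \<eta> where \<eta>: "\<eta> \<in> tors n (That_SC C)" "i = (\<lambda>x\<in>tor z'. fmult \<eta> (j x))"
      "\<omega> = (\<lambda>y. inverse (eps C (\<eta> y)) * \<zeta>' y)" using jcls_cases[OF z(2) j(1) i] by metis
    have "compose (tor z) i f = (\<lambda>x\<in>tor z. fmult \<eta> (compose (tor z) j f x))"
      using f(1) by (auto simp: compose_def \<eta>(2) restrict_def)
    moreover have "fmult \<omega> (res (YSC C) \<zeta>) = (\<lambda>y. inverse (eps C (\<eta> y)) * fmult \<zeta>' (res (YSC C) \<zeta>) y)"
      by (simp add: \<eta>(3) fmult_def mult_ac)
    ultimately show ?thesis using jcls_twist[OF z(1) j(2) \<eta>(1)] by simp
  qed
  then show ?thesis unfolding rep_def using f by auto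
qed

lemma rep_twist:
  fixes z z' :: "('h, 'y, 'k, 'd) gobj"
  assumes z: "is_object C z" "is_object C z'" and r: "rep z z' f \<zeta>" and \<xi>: "\<xi> \<in> tors n (That C)"
  shows "rep z z' (\<lambda>x\<in>tor z. tact z' \<xi> (f x)) (\<lambda>y. inverse (eps C (\<xi> y)) * \<zeta> y)"
proof -
  note R = repD[OF r] and O = is_objectD[OF z(1)] and O' = is_objectD[OF z(2)] and T = tors_simps
  have \<xi>T: "\<xi> \<in> That C" using T(4)[OF \<xi>] .
  obtain j \<zeta>' where j: "(j, \<zeta>') \<in> jcls z'" by (rule jcls_nonempty[OF z(2)])
  show ?thesis
  proof (rule repI[OF z _ _ _ _ j])
    show "(\<lambda>x\<in>tor z. tact z' \<xi> (f x)) (tact z t x) = tact z' t ((\<lambda>x\<in>tor z. tact z' \<xi> (f x)) x)"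
      if "t \<in> That C" "x \<in> tor z" for t x
    proof -
      have "fmult \<xi> t = fmult t \<xi>" by (simp add: fmult_def mult.commute)
      then show ?thesis using that O(2) O'(4) R(1,2) \<xi>T by simp
    qed
    show "hmap z' ((\<lambda>x\<in>tor z. tact z' \<xi> (f x)) x) = hmap z x" if "x \<in> tor z" for x
      using that R(1,3) O'(8) \<xi>T T(5)[OF \<xi>] hmap_in[OF z(1)] by (auto simp: e_simps)
    have "compose (tor z) j (\<lambda>x\<in>tor z. tact z' \<xi> (f x)) = (\<lambda>x\<in>tor z. fmult (res (YSC C) \<xi>) (compose (tor z) j f x))"
      using jclsD(2)[OF z(2) j \<xi>T] R(1) by (auto simp: compose_def restrict_def)
    moreover have "fmult \<zeta>' (res (YSC C) (\<lambda>y. inverse (eps C (\<xi> y)) * \<zeta> y))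
        = (\<lambda>y. inverse (eps C (res (YSC C) \<xi> y)) * fmult \<zeta>' (res (YSC C) \<zeta>) y)"
      by (auto simp: res_def fmult_def eps_simps(3))
    ultimately show "(compose (tor z) j (\<lambda>x\<in>tor z. tact z' \<xi> (f x)),
        fmult \<zeta>' (res (YSC C) (\<lambda>y. inverse (eps C (\<xi> y)) * \<zeta> y))) \<in> jcls z"
      using jcls_twist[OF z(1) R(5)[OF j] T(7)[OF \<xi>]] by simp
  qed (use R O'(2) \<xi>T T(8)[OF \<xi>] in auto)
qed

lemma mor_class_eq:
  fixes z z' :: "('h, 'y, 'k, 'd) gobj"
  assumes z': "is_object C z'" and f: "\<And>x. x \<in> tor z \<Longrightarrow> f x \<in> tor z'" and m: "(f', \<zeta>') \<in> mor_class C z z' f \<zeta>"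
  shows "mor_class C z z' f' \<zeta>' = mor_class C z z' f \<zeta>"
proof -
  note O' = is_objectD[OF z'] and T = tors_simps
  obtain \<xi> where \<xi>: "\<xi> \<in> tors n (That C)" and f': "f' = (\<lambda>x\<in>tor z. tact z' \<xi> (f x))"
    and \<zeta>': "\<zeta>' = (\<lambda>y. inverse (eps C (\<xi> y)) * \<zeta> y)" using m unfolding mor_class_def by auto
  define P where "P \<eta> = (\<lambda>x\<in>tor z. tact z' \<eta> (f x), \<lambda>y. inverse (eps C (\<eta> y)) * \<zeta> y)" for \<eta>
  have shift: "(\<lambda>x\<in>tor z. tact z' \<eta> (f' x), \<lambda>y. inverse (eps C (\<eta> y)) * \<zeta>' y) = P (fmult \<eta> \<xi>)"
    if "\<eta> \<in> tors n (That C)" for \<eta>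
    using eps_simps(1)[OF T(5)[OF that] T(5)[OF \<xi>]] O'(4)[OF T(4)[OF that] T(4)[OF \<xi>] f]
    by (auto simp: P_def f' \<zeta>' fun_eq_iff restrict_def fmult_def mult_ac)
  have img: "(\<lambda>\<eta>. fmult \<eta> \<xi>) ` tors n (That C) = tors n (That C)"
  proof (intro equalityI subsetI)
    fix \<eta> assume \<eta>: "\<eta> \<in> tors n (That C)"
    have "\<eta> = fmult (fmult \<eta> (\<lambda>y. inverse (\<xi> y))) \<xi>"
      using That_simps(4)[OF T(4)[OF \<xi>]] by (auto simp: fmult_def)
    then show "\<eta> \<in> (\<lambda>\<eta>. fmult \<eta> \<xi>) ` tors n (That C)" using T(2)[OF \<eta> T(3)[OF \<xi>]] by blast
  qed (use T(2) \<xi> in auto)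
  have "mor_class C z z' f \<zeta> = P ` tors n (That C)" unfolding mor_class_def P_def ..
  also have "\<dots> = (\<lambda>\<eta>. P (fmult \<eta> \<xi>)) ` tors n (That C)" by (subst img[symmetric]) (simp add: image_image)
  also have "\<dots> = mor_class C z z' f' \<zeta>'" unfolding mor_class_def using shift by (intro image_cong) auto
  finally show ?thesis by simp
qed

lemma Mor_elem:
  fixes z z' :: "('h, 'y, 'k, 'd) gobj"
  assumes z: "is_object C z" "is_object C z'" and m: "m \<in> Mor C z z'" "(f, \<zeta>) \<in> m"
  shows "rep z z' f \<zeta>" "m = mor_class C z z' f \<zeta>"
proof -
  obtain f0 \<zeta>0 where m0: "m = mor_class C z z' f0 \<zeta>0" "rep z z' f0 \<zeta>0" using m(1) unfolding Mor_iff by blast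
  have "f0 x \<in> tor z'" if "x \<in> tor z" for x using repD(1)[OF m0(2) that] .
  then show "m = mor_class C z z' f \<zeta>" using mor_class_eq[OF z(2), of z f0] m(2) m0(1) by auto
  show "rep z z' f \<zeta>" using m(2) rep_twist[OF z m0(2)] unfolding m0(1) mor_class_def by auto
qed

lemma Mor_nonempty:
  assumes "m \<in> Mor C z z'"
  obtains f \<zeta> where "(f, \<zeta>) \<in> m"
proof -
  obtain f \<zeta> where m: "m = mor_class C z z' f \<zeta>" using assms unfolding Mor_iff by blast
  have "(\<lambda>x\<in>tor z. tact z' (\<lambda>_. 1) (f x), \<lambda>y. inverse (eps C 1) * \<zeta> y) \<in> m"
    unfolding m mor_class_def using tors_simps(1) by blast
  then show ?thesis by (rule that)
qed

lemma restrict_in_mor_class: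
  fixes z z' :: "('h, 'y, 'k, 'd) gobj"
  assumes "is_object C z'" "\<And>x. x \<in> tor z \<Longrightarrow> f x \<in> tor z'"
  shows "(\<lambda>x\<in>tor z. f x, \<zeta>) \<in> mor_class C z z' f \<zeta>"
  unfolding mor_class_def using is_objectD(3)[OF assms(1)] assms(2) tors_simps(1)
  by (intro image_eqI[of _ _ "\<lambda>_. 1"]) (auto simp: eps_simps(3) restrict_def)

lemma rep_comp:
  fixes z z' z'' :: "('h, 'y, 'k, 'd) gobj"
  assumes r: "rep z z' f \<zeta>" and r': "rep z' z'' f' \<zeta>'"
    and z: "is_object C z" "is_object C z'" "is_object C z''"
  shows "rep z z'' (compose (tor z) f' f) (fmult \<zeta>' \<zeta>)"
    "mor_comp z (mor_class C z' z'' f' \<zeta>') (mor_class C z z' f \<zeta>) = mor_class C z z'' (compose (tor z) f' f) (fmult \<zeta>' \<zeta>)"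
proof -
  note R = repD[OF r] and R' = repD[OF r']
  note O = is_objectD[OF z(1)] and O' = is_objectD[OF z(2)] and O'' = is_objectD[OF z(3)] and T = tors_simps
  obtain j \<omega> where j: "(j, \<omega>) \<in> jcls z''" by (rule jcls_nonempty[OF z(3)])
  show "rep z z'' (compose (tor z) f' f) (fmult \<zeta>' \<zeta>)"
  proof (rule repI[OF z(1,3) _ _ _ _ j])
    have "compose (tor z) j (compose (tor z) f' f) = compose (tor z) (compose (tor z') j f') f"
      using R(1) by (auto simp: compose_def restrict_def)
    moreover have "fmult \<omega> (res (YSC C) (fmult \<zeta>' \<zeta>)) = fmult (fmult \<omega> (res (YSC C) \<zeta>')) (res (YSC C) \<zeta>)"
      by (auto simp: fmult_def res_def)
    ultimately show "(compose (tor z) j (compose (tor z) f' f), fmult \<omega> (res (YSC C) (fmult \<zeta>' \<zeta>))) \<in> jcls z"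
      using R(5)[OF R'(5)[OF j]] by simp
  qed (use R R' O Ttilde_simps(2) in \<open>auto simp: compose_def\<close>)
  define P where "P \<eta> = (\<lambda>x\<in>tor z. tact z'' \<eta> (compose (tor z) f' f x), \<lambda>y. inverse (eps C (\<eta> y)) * fmult \<zeta>' \<zeta> y)" for \<eta>
  \<comment> \<open>Twists by \<xi> and \<open>\<xi>'\<close> compose to the twist by their product,
    by equivariance and multiplicativity of \<epsilon>; hence the composites of all representatives
    form a single class.\<close>
  have step: "(compose (tor z) (\<lambda>x\<in>tor z'. tact z'' \<xi>' (f' x)) (\<lambda>x\<in>tor z. tact z' \<xi> (f x)),
      fmult (\<lambda>y. inverse (eps C (\<xi>' y)) * \<zeta>' y) (\<lambda>y. inverse (eps C (\<xi> y)) * \<zeta> y)) = P (fmult \<xi>' \<xi>)"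
    if \<xi>: "\<xi> \<in> tors n (That C)" "\<xi>' \<in> tors n (That C)" for \<xi> \<xi>'
  proof -
    have "tact z'' \<xi>' (f' (tact z' \<xi> (f x))) = tact z'' (fmult \<xi>' \<xi>) (f' (f x))" if "x \<in> tor z" for x
      using R'(1,2) R(1) O''(4) T(4) \<xi> that by simp
    moreover have "inverse (eps C (\<xi>' y)) * \<zeta>' y * (inverse (eps C (\<xi> y)) * \<zeta> y)
        = inverse (eps C (\<xi>' y * \<xi> y)) * (\<zeta>' y * \<zeta> y)" for y
      using eps_simps(1)[OF T(5)[OF \<xi>(2)] T(5)[OF \<xi>(1)]] by simp
    ultimately show ?thesis
      using O'(2) R(1) T(4)[OF \<xi>(1)] by (auto simp: P_def compose_def fmult_def restrict_def fun_eq_iff)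
  qed
  show "mor_comp z (mor_class C z' z'' f' \<zeta>') (mor_class C z z' f \<zeta>) = mor_class C z z'' (compose (tor z) f' f) (fmult \<zeta>' \<zeta>)"
  proof (intro equalityI subsetI)
    fix p assume "p \<in> mor_comp z (mor_class C z' z'' f' \<zeta>') (mor_class C z z' f \<zeta>)"
    then obtain \<xi> \<xi>' where \<xi>: "\<xi> \<in> tors n (That C)" "\<xi>' \<in> tors n (That C)" and
      "p = (compose (tor z) (\<lambda>x\<in>tor z'. tact z'' \<xi>' (f' x)) (\<lambda>x\<in>tor z. tact z' \<xi> (f x)),
      fmult (\<lambda>y. inverse (eps C (\<xi>' y)) * \<zeta>' y) (\<lambda>y. inverse (eps C (\<xi> y)) * \<zeta> y))"
      unfolding mor_comp_def mor_class_def by auto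
    then have "p = P (fmult \<xi>' \<xi>)" using step by simp
    then show "p \<in> mor_class C z z'' (compose (tor z) f' f) (fmult \<zeta>' \<zeta>)"
      unfolding mor_class_def using T(2)[OF \<xi>(2,1)] by (simp add: P_def)
  next
    fix p assume "p \<in> mor_class C z z'' (compose (tor z) f' f) (fmult \<zeta>' \<zeta>)"
    then obtain \<xi> where \<xi>: "\<xi> \<in> tors n (That C)" "p = P \<xi>" unfolding mor_class_def P_def by blast
    have "fmult \<xi> (\<lambda>_. 1) = \<xi>" by (simp add: fmult_def)
    then have "p = (compose (tor z) (\<lambda>x\<in>tor z'. tact z'' \<xi> (f' x)) (\<lambda>x\<in>tor z. tact z' (\<lambda>_. 1) (f x)),
      fmult (\<lambda>y. inverse (eps C (\<xi> y)) * \<zeta>' y) (\<lambda>y. inverse (eps C 1) * \<zeta> y))"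
      using step[OF T(1) \<xi>(1)] \<xi>(2) by simp
    then show "p \<in> mor_comp z (mor_class C z' z'' f' \<zeta>') (mor_class C z z' f \<zeta>)"
      unfolding mor_comp_def mor_class_def using \<xi>(1) T(1) by blast
  qed
qed

lemma rep_bij:
  fixes z z' :: "('h, 'y, 'k, 'd) gobj"
  assumes r: "rep z z' f \<zeta>" and z: "is_object C z" "is_object C z'"
  shows "bij_betw f (tor z) (tor z')"
proof -
  note R = repD[OF r] and O = is_objectD[OF z(1)] and O' = is_objectD[OF z(2)]
  have "inj_on f (tor z)"
  proof (rule inj_onI)
    fix x x' assume x: "x \<in> tor z" "x' \<in> tor z" "f x = f x'"
    obtain t where t: "t \<in> That C" "x' = tact z t x" using O(5)[OF x(1,2)] by blast
    have "tact z' t (f x) = tact z' (\<lambda>_. 1) (f x)" using R(1,2) t x O'(3) by metis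
    then have "t = (\<lambda>_. 1)" using O'(6)[OF t(1) That_simps(1) R(1)[OF x(1)]] by simp
    then show "x = x'" using t O(3)[OF x(1)] by simp
  qed
  moreover have "f ` tor z = tor z'"
  proof
    show "f ` tor z \<subseteq> tor z'" using R(1) by blast
    show "tor z' \<subseteq> f ` tor z"
    proof
      fix x' assume x': "x' \<in> tor z'"
      obtain x where x: "x \<in> tor z" using O(1) by blast
      obtain t where t: "t \<in> That C" "x' = tact z' t (f x)" using O'(5)[OF R(1)[OF x] x'] by blast
      then have "x' = f (tact z t x)" using R(2) x by simp
      then show "x' \<in> f ` tor z" using O(2)[OF t(1) x] by blast
    qed
  qed
  ultimately show ?thesis by (simp add: bij_betw_def)
qed

lemma rep_inv:
  fixes z z' :: "('h, 'y, 'k, 'd) gobj"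
  assumes r: "rep z z' f \<zeta>" and z: "is_object C z" "is_object C z'"
  defines "g \<equiv> (\<lambda>x\<in>tor z'. inv_into (tor z) f x)"
  shows "rep z' z g (\<lambda>y. inverse (\<zeta> y))"
    "mor_inv z z' (mor_class C z z' f \<zeta>) = mor_class C z' z g (\<lambda>y. inverse (\<zeta> y))"
proof -
  note R = repD[OF r] and O = is_objectD[OF z(1)] and O' = is_objectD[OF z(2)] and T = tors_simps
  note bij = rep_bij[OF r z]
  have g: "g x' \<in> tor z" "f (g x') = x'" if "x' \<in> tor z'" for x'
    using that bij unfolding g_def
    by (auto simp: bij_betw_def inv_into_into f_inv_into_f)
  have gf: "g x' = x \<longleftrightarrow> x' = f x" if "x' \<in> tor z'" "x \<in> tor z" for x x'
    using g[OF that(1)] that bij by (metis bij_betw_def inj_onD)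
  have ge: "g (tact z' t x') = tact z t (g x')" if "t \<in> That C" "x' \<in> tor z'" for t x'
    using gf[of "tact z' t x'" "tact z t (g x')"] O(2) O'(2) R(2) g that by simp
  obtain j \<omega> where j: "(j, \<omega>) \<in> jcls z'" by (rule jcls_nonempty[OF z(2)])
  show "rep z' z g (\<lambda>y. inverse (\<zeta> y))"
  proof (rule repI[OF z(2,1) _ _ _ _ R(5)[OF j]])
    show "hmap z (g x) = hmap z' x" if "x \<in> tor z'" for x using R(3)[OF g(1)[OF that]] g(2)[OF that] by simp
    have "compose (tor z') (compose (tor z) j f) g = j"
      using g jclsD(5)[OF z(2) j] by (auto simp: compose_def extensional_def fun_eq_iff)
    moreover have "fmult (fmult \<omega> (res (YSC C) \<zeta>)) (res (YSC C) (\<lambda>y. inverse (\<zeta> y))) = \<omega>"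
      using Ttilde_simps(4)[OF R(4)] by (auto simp: fmult_def res_def)
    ultimately show "(compose (tor z') (compose (tor z) j f) g,
        fmult (fmult \<omega> (res (YSC C) \<zeta>)) (res (YSC C) (\<lambda>y. inverse (\<zeta> y)))) \<in> jcls z'" using j by simp
  qed (use g ge Ttilde_simps(3) R(4) in auto)
  define P where "P \<eta> = (\<lambda>x\<in>tor z'. tact z \<eta> (g x), \<lambda>y. inverse (eps C (\<eta> y)) * inverse (\<zeta> y))" for \<eta>
  \<comment> \<open>Inverting a twisted pair gives the inverse twist of the inverse pair, and
    inversion permutes the torsion group.\<close>
  have step: "(\<lambda>x\<in>tor z'. inv_into (tor z) (\<lambda>x\<in>tor z. tact z' \<xi> (f x)) x, \<lambda>y. inverse (inverse (eps C (\<xi> y)) * \<zeta> y))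
      = P (\<lambda>y. inverse (\<xi> y))" if \<xi>: "\<xi> \<in> tors n (That C)" for \<xi>
  proof -
    let ?f = "\<lambda>x\<in>tor z. tact z' \<xi> (f x)"
    have inj: "inj_on ?f (tor z)"
      using rep_bij[OF rep_twist[OF z r \<xi>] z] by (simp add: bij_betw_def)
    have "inv_into (tor z) ?f x = tact z (\<lambda>y. inverse (\<xi> y)) (g x)" if x: "x \<in> tor z'" for x
    proof (rule inv_into_f_eq[OF inj])
      show t: "tact z (\<lambda>y. inverse (\<xi> y)) (g x) \<in> tor z" using O(2) T(3,4) \<xi> g x by blast
      have "fmult \<xi> (\<lambda>y. inverse (\<xi> y)) = (\<lambda>_. 1)"
        using That_simps(4)[OF T(4)[OF \<xi>]] by (auto simp: fmult_def)
      then show "?f (tact z (\<lambda>y. inverse (\<xi> y)) (g x)) = x"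
        using t R(2) O'(3,4) T(3,4) \<xi> g x by simp
    qed
    moreover have "inverse (inverse (eps C (\<xi> y)) * \<zeta> y) = inverse (eps C (inverse (\<xi> y))) * inverse (\<zeta> y)" for y
      using eps_simps(5)[OF T(5)[OF \<xi>]] by simp
    ultimately show ?thesis by (auto simp: P_def restrict_def fun_eq_iff)
  qed
  have "mor_inv z z' (mor_class C z z' f \<zeta>) = (\<lambda>\<xi>. P (\<lambda>y. inverse (\<xi> y))) ` tors n (That C)"
    unfolding mor_inv_def mor_class_def image_image using step by (intro image_cong) auto
  also have "\<dots> = P ` ((\<lambda>\<xi> y. inverse (\<xi> y)) ` tors n (That C))" by (simp add: image_image)
  also have "(\<lambda>\<xi> y. inverse (\<xi> y)) ` tors n (That C) = tors n (That C)"
  proof (intro equalityI subsetI)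
    fix \<eta> assume "\<eta> \<in> tors n (That C)"
    then show "\<eta> \<in> (\<lambda>\<xi> y. inverse (\<xi> y)) ` tors n (That C)"
      using T(3) by (intro image_eqI[of _ _ "\<lambda>y. inverse (\<eta> y)"]) auto
  qed (use T(3) in auto)
  also have "P ` tors n (That C) = mor_class C z' z g (\<lambda>y. inverse (\<zeta> y))" unfolding mor_class_def P_def ..
  finally show "mor_inv z z' (mor_class C z z' f \<zeta>) = mor_class C z' z g (\<lambda>y. inverse (\<zeta> y))" .
qed

section \<open>Galois conjugation of objects and morphisms\<close>

lemma conj_simps [simp]:
  "tor (conj_obj C \<gamma> z) = tor z" "tact (conj_obj C \<gamma> z) t = tact z (ginv \<gamma> \<circ> t)"
  "hmap (conj_obj C \<gamma> z) x y = act \<gamma> (hmap z x y)"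
  "jcls (conj_obj C \<gamma> z) = (\<lambda>(j, \<zeta>). (\<lambda>x\<in>tor z. \<gamma> \<circ> j x, \<zeta>)) ` jcls z"
  by (simp_all add: conj_obj_def)

text \<open>Galois fixes \<open>s_psi\<close> and the torsion of \<open>That_SC\<close>, so
  composing \<open>j\<close> with \<gamma> again gives a torsion class of maps to the object defined
  by \<open>s_psi\<close>.\<close>

lemma is_object_conj:
  fixes z :: "('h, 'y, 'k, 'd) gobj"
  assumes z: "is_object C z" and \<gamma>: "\<gamma> \<in> \<Gamma>"
  shows "is_object C (conj_obj C \<gamma> z)"
proof -
  note O = is_objectD[OF z] and g = gal_simps[OF \<gamma>] and A = act_simps[OF \<gamma>]
  have \<gamma>': "ginv \<gamma> \<in> \<Gamma>" using ginv_gal[OF \<gamma>] .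
  note g' = gal_simps[OF \<gamma>']
  note Tg = That_simps(5)[OF \<gamma>] and Tg' = That_simps(5)[OF \<gamma>']
  have comp: "ginv \<gamma> \<circ> fmult t t' = fmult (ginv \<gamma> \<circ> t) (ginv \<gamma> \<circ> t')" for t t' :: "'y \<Rightarrow> 'k"
    by (auto simp: fmult_def g')
  have one: "ginv \<gamma> \<circ> (\<lambda>_. 1) = (\<lambda>_::'y. 1)" by (auto simp: g')
  obtain j0 \<zeta>0 where j0: "\<And>x. x \<in> tor z \<Longrightarrow> j0 x \<in> That_SC C"
    "\<And>t x. t \<in> That C \<Longrightarrow> x \<in> tor z \<Longrightarrow> j0 (tact z t x) = fmult (res (YSC C) t) (j0 x)"
    "\<And>x y. x \<in> tor z \<Longrightarrow> y \<in> YSC C \<Longrightarrow> e (j0 x y ^ n) \<cdot> s_psi C y = hmap z x y"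
    "\<zeta>0 \<in> Ttilde_SC C" "jcls z = j_class C (tor z) j0 \<zeta>0" using jclsE[OF z] by metis
  let ?z = "conj_obj C \<gamma> z"
  have h: "hmap ?z x \<in> splittings C (YQn C)" if "x \<in> tor z" for x
    using splittingsD[OF O(7)[OF that]] A by (auto simp: splittings_def)
  have hact: "hmap ?z (tact ?z t x) y = e (t y ^ n) \<cdot> hmap ?z x y" if t: "t \<in> That C" and x: "x \<in> tor z" for t x y
  proof -
    have nz: "ginv \<gamma> (t y) \<noteq> 0" using g'(7) That_simps(4)[OF t] by simp
    have "hmap ?z (tact ?z t x) y = act \<gamma> (e (ginv \<gamma> (t y) ^ n) \<cdot> hmap z x y)"
      using O(8)[OF Tg'[OF t] x] by simp
    also have "\<dots> = e (t y ^ n) \<cdot> hmap ?z x y"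
      using A(2)[OF e_simps(1) hmap_in[OF z x]] A(4) nz by (simp add: g)
    finally show ?thesis .
  qed
  have tr: "\<exists>!t. t \<in> That C \<and> tact ?z t x = x'" if x: "x \<in> tor z" "x' \<in> tor z" for x x'
  proof -
    obtain t where t: "t \<in> That C" "x' = tact z t x" using O(5)[OF x] by blast
    have e: "ginv \<gamma> \<circ> (\<gamma> \<circ> t) = t" by (auto simp: g)
    show ?thesis
    proof (rule ex1I[of _ "\<gamma> \<circ> t"])
      show "\<gamma> \<circ> t \<in> That C \<and> tact ?z (\<gamma> \<circ> t) x = x'" using t e Tg by simp
      fix t' assume t': "t' \<in> That C \<and> tact ?z t' x = x'"
      then have a: "t' \<in> That C" and b: "tact z (ginv \<gamma> \<circ> t') x = tact z t x" using t(2) by auto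
      have "ginv \<gamma> \<circ> t' = t" by (rule iffD1[OF O(6)[OF Tg'[OF a] t(1) x(1)] b])
      then show "t' = \<gamma> \<circ> t" by (auto simp: g)
    qed
  qed
  define j where "j x = \<gamma> \<circ> j0 x" for x
  have jT: "j x \<in> That_SC C" if "x \<in> tor z" for x
    unfolding j_def using That_SC_simps(5)[OF \<gamma> j0(1)[OF that]] .
  have jact: "j (tact ?z t x) = fmult (res (YSC C) t) (j x)" if "t \<in> That C" "x \<in> tor z" for t x
    using j0(2)[OF Tg'[OF that(1)] that(2)] by (auto simp: j_def fmult_def res_def g)
  have jh: "e (j x y ^ n) \<cdot> s_psi C y = hmap ?z x y" if x: "x \<in> tor z" and y: "y \<in> YSC C" for x y
  proof -
    have nz: "j0 x y \<noteq> 0" using That_SC_simps(4)[OF j0(1)[OF x]] .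
    have "hmap ?z x y = act \<gamma> (e (j0 x y ^ n) \<cdot> s_psi C y)" using j0(3)[OF x y] by simp
    also have "\<dots> = e (\<gamma> (j0 x y ^ n)) \<cdot> s_psi C y"
      using A(2)[OF e_simps(1) splittingsD(1)[OF s_psi(1)]] A(4) act_s_psi[OF \<gamma>] nz by simp
    finally show ?thesis by (simp add: j_def g)
  qed
  have jc: "jcls ?z = j_class C (tor z) j \<zeta>0"
    unfolding conj_simps j0(5) j_class_def image_image
  proof (rule image_cong[OF refl])
    fix \<xi> assume \<xi>: "\<xi> \<in> tors n (That_SC C)"
    have "\<gamma> (\<xi> y) = \<xi> y" for y using fun_cong[OF tors_SC_simps(6)[OF \<gamma> \<xi>], of y] by simp
    then show "(\<lambda>(j, \<zeta>). (\<lambda>x\<in>tor z. \<gamma> \<circ> j x, \<zeta>)) (\<lambda>x\<in>tor z. fmult \<xi> (j0 x), \<lambda>y. inverse (eps C (\<xi> y)) * \<zeta>0 y) =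
         (\<lambda>x\<in>tor z. fmult \<xi> (j x), \<lambda>y. inverse (eps C (\<xi> y)) * \<zeta>0 y)"
      by (auto simp: j_def fmult_def g restrict_def fun_eq_iff)
  qed
  show ?thesis unfolding is_object_def
  proof (intro conjI exI[of _ j] exI[of _ \<zeta>0] ballI allI)
    show "tact ?z (fmult t t') x = tact ?z t (tact ?z t' x)" if "t \<in> That C" "t' \<in> That C" "x \<in> tor ?z" for t t' x
      using O(4)[OF Tg' Tg', OF that(1,2)] that(3) by (simp add: comp)
  qed (use O Tg' h hact tr jT jact jh jc j0(4) one in \<open>simp_all\<close>)
qed

text \<open>Galois fixes the torsion of \<open>That\<close>, so the conjugated action on the target
  produces the same twists. This is what justifies defining \<open>conj_mor\<close> as the
  identity.\<close>

lemma rep_conj: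
  fixes z z' :: "('h, 'y, 'k, 'd) gobj"
  assumes r: "rep z z' f \<zeta>" and z: "is_object C z" "is_object C z'" and \<gamma>: "\<gamma> \<in> \<Gamma>"
  shows "rep (conj_obj C \<gamma> z) (conj_obj C \<gamma> z') f \<zeta>"
    "mor_class C (conj_obj C \<gamma> z) (conj_obj C \<gamma> z') f \<zeta> = mor_class C z z' f \<zeta>"
proof -
  note R = repD[OF r]
  have \<gamma>': "ginv \<gamma> \<in> \<Gamma>" using ginv_gal[OF \<gamma>] .
  obtain j \<omega> where j: "(j, \<omega>) \<in> jcls z'" by (rule jcls_nonempty[OF z(2)])
  then have j': "(\<lambda>x\<in>tor z'. \<gamma> \<circ> j x, \<omega>) \<in> jcls (conj_obj C \<gamma> z')" by force
  show "rep (conj_obj C \<gamma> z) (conj_obj C \<gamma> z') f \<zeta>"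
  proof (rule repI[OF is_object_conj[OF z(1) \<gamma>] is_object_conj[OF z(2) \<gamma>] _ _ _ _ j'])
    have "compose (tor z) (\<lambda>x\<in>tor z'. \<gamma> \<circ> j x) f = (\<lambda>x\<in>tor z. \<gamma> \<circ> compose (tor z) j f x)"
      using R(1) by (auto simp: compose_def restrict_def)
    then show "(compose (tor (conj_obj C \<gamma> z)) (\<lambda>x\<in>tor z'. \<gamma> \<circ> j x) f, fmult \<omega> (res (YSC C) \<zeta>))
        \<in> jcls (conj_obj C \<gamma> z)"
      unfolding conj_simps by (intro image_eqI[OF _ R(5)[OF j]]) simp
    show "hmap (conj_obj C \<gamma> z') (f x) = hmap (conj_obj C \<gamma> z) x" if "x \<in> tor (conj_obj C \<gamma> z)" for x
      using R(3) that by (auto simp: fun_eq_iff)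
  qed (use R That_simps(5)[OF \<gamma>'] in auto)
  show "mor_class C (conj_obj C \<gamma> z) (conj_obj C \<gamma> z') f \<zeta> = mor_class C z z' f \<zeta>"
    unfolding mor_class_def by (intro image_cong refl) (simp add: tors_simps(6)[OF \<gamma>'])
qed

text \<open>The Galois action is known to compose only on the carrier, and \<open>hmap z x\<close>
  is known to lie there only for \<open>x\<close> in the torsor. The two objects are therefore
  equated after overwriting \<open>hmap\<close>, which is compared on the torsor alone.\<close>

lemma conj_conj:
  fixes z :: "('h, 'y, 'k, 'd) gobj"
  assumes z: "is_object C z" and \<gamma>: "\<gamma> \<in> \<Gamma>" "\<gamma>' \<in> \<Gamma>"
  shows "conj_obj C \<gamma> (conj_obj C \<gamma>' z) \<lparr>hmap := h\<rparr> = conj_obj C (\<gamma> \<circ> \<gamma>') z \<lparr>hmap := h\<rparr>"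
    "x \<in> tor z \<Longrightarrow> hmap (conj_obj C \<gamma> (conj_obj C \<gamma>' z)) x = hmap (conj_obj C (\<gamma> \<circ> \<gamma>') z) x"
proof -
  have inv: "ginv (\<gamma> \<circ> \<gamma>') = ginv \<gamma>' \<circ> ginv \<gamma>" using \<gamma> by (intro o_inv_distrib) (auto simp: gal_def)
  have j: "(\<lambda>(j, \<zeta>). (\<lambda>x\<in>tor z. \<gamma> \<circ> j x, \<zeta>)) ` (\<lambda>(j, \<zeta>). (\<lambda>x\<in>tor z. \<gamma>' \<circ> j x, \<zeta>)) ` jcls z
      = (\<lambda>(j, \<zeta>). (\<lambda>x\<in>tor z. (\<gamma> \<circ> \<gamma>') \<circ> j x, \<zeta>)) ` jcls z"
    unfolding image_image by (intro image_cong refl) (auto simp: restrict_def fun_eq_iff)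
  show "conj_obj C \<gamma> (conj_obj C \<gamma>' z) \<lparr>hmap := h\<rparr> = conj_obj C (\<gamma> \<circ> \<gamma>') z \<lparr>hmap := h\<rparr>"
    using j by (simp add: conj_obj_def inv comp_assoc)
  show "x \<in> tor z \<Longrightarrow> hmap (conj_obj C \<gamma> (conj_obj C \<gamma>' z)) x = hmap (conj_obj C (\<gamma> \<circ> \<gamma>') z) x"
    using gm_extensionD(7)[OF ext \<gamma> hmap_in[OF z]] by (auto simp: fun_eq_iff)
qed

lemma rep_conj_conj:
  fixes z z0 :: "('h, 'y, 'k, 'd) gobj"
  assumes z: "is_object C z" and \<gamma>: "\<gamma> \<in> \<Gamma>" "\<gamma>' \<in> \<Gamma>"
  shows "rep z0 (conj_obj C \<gamma> (conj_obj C \<gamma>' z)) f \<zeta> \<longleftrightarrow> rep z0 (conj_obj C (\<gamma> \<circ> \<gamma>') z) f \<zeta>"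
    "mor_class C z0 (conj_obj C \<gamma> (conj_obj C \<gamma>' z)) f \<zeta> = mor_class C z0 (conj_obj C (\<gamma> \<circ> \<gamma>') z) f \<zeta>"
proof -
  let ?a = "conj_obj C \<gamma> (conj_obj C \<gamma>' z)" and ?b = "conj_obj C (\<gamma> \<circ> \<gamma>') z"
  have e: "?a\<lparr>hmap := undefined\<rparr> = ?b\<lparr>hmap := undefined\<rparr>" by (rule conj_conj(1)[OF z \<gamma>])
  have tj: "tact ?a = tact ?b" "jcls ?a = jcls ?b"
    using arg_cong[OF e, of tact] arg_cong[OF e, of jcls] by (simp_all del: conj_simps)
  have "hmap ?a (f x) = hmap ?b (f x)" if "f \<in> tor z0 \<rightarrow> tor z" "x \<in> tor z0" for x
    using conj_conj(2)[OF z \<gamma>] that by blast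
  then show "rep z0 ?a f \<zeta> \<longleftrightarrow> rep z0 ?b f \<zeta>"
    unfolding rep_def tj by (auto simp del: conj_simps(2-4))
  show "mor_class C z0 ?a f \<zeta> = mor_class C z0 ?b f \<zeta>" unfolding mor_class_def tj ..
qed

text \<open>The trivial torsor with \<open>j\<close> sending 1 to \<open>j0\<close>. With
  \<open>j0 = 1\<close> it is \<open>base_point\<close>; a general \<open>j0\<close> admits
  splittings that agree with \<open>s_psi\<close> only up to an \<open>n\<close>-th power.\<close>

definition std_obj :: "('y \<Rightarrow> 'd) \<Rightarrow> ('y \<Rightarrow> 'k) \<Rightarrow> ('y \<Rightarrow> 'k, 'y, 'k, 'd) gobj" where
  "std_obj s j0 = \<lparr>tor = That C, tact = fmult, hmap = (\<lambda>x y. e (x y ^ n) \<cdot> s y),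
     jcls = j_class C (That C) (\<lambda>x. fmult (res (YSC C) x) j0) (\<lambda>_. 1)\<rparr>"

lemma std_obj:
  assumes s: "s \<in> splittings C (YQn C)" and j0: "j0 \<in> That_SC C"
    and eq: "\<And>y. y \<in> YSC C \<Longrightarrow> e (j0 y ^ n) \<cdot> s_psi C y = s y"
  shows "is_object C (std_obj s j0)"
proof -
  note S = splittingsD[OF s]
  let ?z = "std_obj s j0"
  have [simp]: "tor ?z = That C" "tact ?z = fmult" "\<And>x y. hmap ?z x y = e (x y ^ n) \<cdot> s y"
    "jcls ?z = j_class C (That C) (\<lambda>x. fmult (res (YSC C) x) j0) (\<lambda>_. 1)"
    by (simp_all add: std_obj_def)
  have h: "hmap ?z x \<in> splittings C (YQn C)" if x: "x \<in> That C" for x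
    unfolding splittings_def
  proof (intro CollectI conjI ballI allI impI)
    have nz: "x y ^ n \<noteq> 0" for y using That_simps(4)[OF x] by simp
    fix y
    show "hmap ?z x y = \<one>\<^bsub>G\<^esub>" if "y \<notin> YQn C" using S(4)[OF that] That_simps(6)[OF x that] by (simp add: e_simps)
    show "hmap ?z x y \<in> carrier G" using S(1) nz by (simp add: e_simps)
    assume y: "y \<in> YQn C"
    show "pr (hmap ?z x y) = y" using S(1,2) nz y by (simp add: e_simps pr_simps)
    fix y' assume y': "y' \<in> YQn C"
    have "x (y + y') = x y * x y'" using x y y' by (simp add: That_def chars_def)
    then have "hmap ?z x (y + y') = e (x y ^ n) \<cdot> ((e (x y' ^ n) \<cdot> s y) \<cdot> s y')"
      using S(1,3) nz y y' by (simp add: power_mult_distrib e_simps D.m_assoc)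
    also have "\<dots> = e (x y ^ n) \<cdot> ((s y \<cdot> e (x y' ^ n)) \<cdot> s y')" using e_central[OF nz S(1)] by simp
    also have "\<dots> = hmap ?z x y \<cdot> hmap ?z x y'" using S(1) nz by (simp add: e_simps D.m_assoc)
    finally show "hmap ?z x (y + y') = hmap ?z x y \<cdot> hmap ?z x y'" .
  qed
  have tr: "\<exists>!t. t \<in> That C \<and> fmult t x = x'" if x: "x \<in> That C" "x' \<in> That C" for x x'
  proof (rule ex1I[of _ "fmult x' (\<lambda>y. inverse (x y))"])
    show "fmult x' (\<lambda>y. inverse (x y)) \<in> That C \<and> fmult (fmult x' (\<lambda>y. inverse (x y))) x = x'"
      using That_simps(2,3) x That_simps(4)[OF x(1)] by (auto simp: fmult_def)
    show "t = fmult x' (\<lambda>y. inverse (x y))" if "t \<in> That C \<and> fmult t x = x'" for t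
      using that That_simps(4)[OF x(1)] by (auto simp: fmult_def)
  qed
  have jh: "e (fmult (res (YSC C) x) j0 y ^ n) \<cdot> s_psi C y = hmap ?z x y" if x: "x \<in> That C" and y: "y \<in> YSC C" for x y
  proof -
    have "e (fmult (res (YSC C) x) j0 y ^ n) \<cdot> s_psi C y = e (x y ^ n) \<cdot> (e (j0 y ^ n) \<cdot> s_psi C y)"
      using That_simps(4)[OF x] That_SC_simps(4)[OF j0] splittingsD(1)[OF s_psi(1)] y
      by (simp add: fmult_def res_def power_mult_distrib e_simps D.m_assoc)
    then show ?thesis using eq[OF y] by simp
  qed
  show ?thesis unfolding is_object_def
  proof (intro conjI exI[of _ "\<lambda>x. fmult (res (YSC C) x) j0"] exI[of _ "\<lambda>_. 1"] ballI allI)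
    show "hmap ?z (tact ?z t x) y = e (t y ^ n) \<cdot> hmap ?z x y" if "t \<in> That C" "x \<in> tor ?z" for t x y
      using that That_simps(4) S(1) by (simp add: fmult_def power_mult_distrib e_simps D.m_assoc)
    show "fmult (res (YSC C) x) j0 \<in> That_SC C" if "x \<in> tor ?z" for x
      using res_That[OF setting] That_SC_simps(2) j0 that by simp
    show "fmult (res (YSC C) (tact ?z t x)) j0 = fmult (res (YSC C) t) (fmult (res (YSC C) x) j0)"
      if "t \<in> That C" "x \<in> tor ?z" for t x by (auto simp: fmult_def res_def)
    show "(\<lambda>_. 1) \<in> Ttilde_SC C" by (simp add: Ttilde_SC_def chars_closed)
    show "tor ?z \<noteq> {}" using That_simps(1) by auto
    show "tact ?z (fmult t t') x = tact ?z t (tact ?z t' x)" for t t' x by (simp add: fmult_def mult.assoc)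
    show "tact ?z (\<lambda>_. 1) x = x" for x by (simp add: fmult_def)
  qed (use h tr jh That_simps(2) in simp_all)
qed

lemma base_point_object:
  assumes "s \<in> convenient_splittings C"
  shows "is_object C (base_point C s)"
proof -
  have s: "s \<in> splittings C (YQn C)" "\<And>y. y \<in> YSC C \<Longrightarrow> s y = s_psi C y"
    using assms by (auto simp: convenient_splittings_def)
  have "base_point C s = std_obj s (\<lambda>_. 1)"
    by (simp add: base_point_def std_obj_def fmult_def)
  moreover have "is_object C (std_obj s (\<lambda>_. 1))"
    by (rule std_obj) (use s splittingsD(1)[OF s_psi(1)] That_SC_simps(1) in \<open>auto simp: e_simps\<close>)
  ultimately show ?thesis by simp
qed

text \<open>A splitting over \<open>YQn\<close> need not extend \<open>s_psi\<close>, but over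
  \<open>YSC\<close> it differs from it by a character, and an \<open>n\<close>-th root of this
  character serves as \<open>j0\<close>.\<close>

lemma object_exists: "\<exists>z. z \<in> objects C"
proof -
  obtain s where s: "s \<in> splittings C (YQn C)" by (rule splitting_exists[OF YQn_lattice order_refl])
  note S = splittingsD[OF s]
  define s' where "s' y = (if y \<in> YSC C then s y else \<one>\<^bsub>G\<^esub>)" for y
  have "s' \<in> splittings C (YSC C)"
    using S YSC_sub is_latticeD(2)[OF YSC_lattice] by (auto simp: splittings_def s'_def subset_iff)
  then obtain q where q: "q \<in> chars (YSC C)" "\<And>y. s' y = e (q y) \<cdot> s_psi C y"
    using quotient_char[OF YSC_lattice s_psi(1)] by metis
  obtain r where r: "r \<in> chars (YSC C)" "\<And>y. r y ^ n = q y"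
    using chars_root[OF bd_facts(3) YSC_lattice q(1) _ n_pos] root_exists by metis
  have "is_object C (std_obj s r)"
    by (rule std_obj[OF s]) (use r q(2) in \<open>auto simp: That_SC_def s'_def simp flip: q(2)\<close>)
  then show ?thesis by (auto simp: objects_def)
qed

section \<open>Connectedness of the groupoid\<close>

lemma complex_root: "u \<noteq> 0 \<Longrightarrow> 0 < k \<Longrightarrow> \<exists>v::complex. v ^ k = u"
proof -
  assume u: "u \<noteq> 0" and k: "0 < k"
  have "exp (Ln u / of_nat k) ^ k = exp (of_nat k * (Ln u / of_nat k))" by (simp only: exp_of_nat_mult)
  also have "\<dots> = u" using u k by simp
  finally show ?thesis by blast
qed

text \<open>An \<open>n\<close>-th root of the quotient of two splittings moves a point of the
  second torsor to some \<open>x1\<close> with the same splitting as \<open>x0\<close>; sending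
  \<open>x0\<close> to \<open>x1\<close> fixes \<open>f\<close>. The trivialisations then differ by
  torsion \<eta> over \<open>YSC\<close>, and a complex character \<zeta> of \<open>YQn\<close>
  corrects for it.\<close>

lemma rep_exists:
  fixes z z' :: "('h, 'y, 'k, 'd) gobj"
  assumes z: "is_object C z" "is_object C z'"
  obtains f \<zeta> where "rep z z' f \<zeta>"
proof -
  note O = is_objectD[OF z(1)] and O' = is_objectD[OF z(2)]
  obtain x0 where x0: "x0 \<in> tor z" using O(1) by blast
  obtain x0' where x0': "x0' \<in> tor z'" using O'(1) by blast
  obtain q where q: "q \<in> chars (YQn C)" "\<And>y. hmap z x0 y = e (q y) \<cdot> hmap z' x0' y"
    using quotient_char[OF YQn_lattice O'(7)[OF x0'] O(7)[OF x0]] by metis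
  obtain r where r: "r \<in> That C" "\<And>y. r y ^ n = q y"
    using chars_root[OF bd_facts(3) YQn_lattice q(1) _ n_pos] root_exists unfolding That_def by metis
  define x1 where "x1 = tact z' r x0'"
  have x1: "x1 \<in> tor z'" "hmap z' x1 = hmap z x0"
    using O'(2)[OF r(1) x0'] O'(8)[OF r(1) x0'] q(2) r(2) by (auto simp: x1_def)
  define \<delta> where "\<delta> x = (THE t. t \<in> That C \<and> x = tact z t x0)" for x
  have \<delta>: "\<delta> x = t" if "t \<in> That C" "x = tact z t x0" for x t
    unfolding \<delta>_def using that O(6)[OF _ _ x0] by (intro the_equality) auto
  have \<delta>T: "\<delta> x \<in> That C" "x = tact z (\<delta> x) x0" if "x \<in> tor z" for x
    using O(5)[OF x0 that] \<delta> by auto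
  have \<delta>t: "\<delta> (tact z t x) = fmult t (\<delta> x)" if "t \<in> That C" "x \<in> tor z" for t x
    using that \<delta>T[OF that(2)] O(4)[OF that(1) _ x0] That_simps(2) by (intro \<delta>) metis+
  define f where "f x = tact z' (\<delta> x) x1" for x
  obtain j \<omega> where j: "(j, \<omega>) \<in> jcls z" by (rule jcls_nonempty[OF z(1)])
  obtain j' \<omega>' where j': "(j', \<omega>') \<in> jcls z'" by (rule jcls_nonempty[OF z(2)])
  note J = jclsD[OF z(1) j] and J' = jclsD[OF z(2) j']
  \<comment> \<open>The failure of \<open>f\<close> to respect \<open>j\<close>. It is torsion
    because both trivialisations lie over the same splitting.\<close>
  define \<eta> where "\<eta> = fmult (j' x1) (\<lambda>y. inverse (j x0 y))"
  have nz: "j x0 y \<noteq> 0" "j' x1 y \<noteq> 0" for y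
    using That_SC_simps(4)[OF J(1)[OF x0]] That_SC_simps(4)[OF J'(1)[OF x1(1)]] by auto
  have "j' x1 y ^ n = j x0 y ^ n" for y
  proof (cases "y \<in> YSC C")
    case True
    have "e (j' x1 y ^ n) \<cdot> s_psi C y = e (j x0 y ^ n) \<cdot> s_psi C y"
      using J(3)[OF x0 True] J'(3)[OF x1(1) True] x1(2) by simp
    then have "e (j' x1 y ^ n) = e (j x0 y ^ n)"
      using nz splittingsD(1)[OF s_psi(1)] by (simp add: e_simps(1))
    then show ?thesis using nz by (simp add: e_simps(5))
  next
    case False
    then show ?thesis
      using That_SC_simps(6)[OF J(1)[OF x0] False] That_SC_simps(6)[OF J'(1)[OF x1(1)] False] by simp
  qed
  then have \<eta>: "\<eta> \<in> tors n (That_SC C)"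
    using That_SC_simps(2,3) J(1)[OF x0] J'(1)[OF x1(1)] nz
    by (auto simp: tors_def \<eta>_def) (auto simp: fmult_def power_mult_distrib power_inverse)
  have j\<eta>: "j' (f x) = fmult \<eta> (j x)" if "x \<in> tor z" for x
  proof -
    have "j' (f x) = fmult (res (YSC C) (\<delta> x)) (j' x1)" unfolding f_def using J'(2) \<delta>T(1)[OF that] x1(1) by simp
    moreover have "j x = fmult (res (YSC C) (\<delta> x)) (j x0)" using J(2)[OF \<delta>T(1)[OF that] x0] \<delta>T(2)[OF that] by simp
    ultimately show ?thesis using nz(1) by (auto simp: \<eta>_def fmult_def fun_eq_iff)
  qed
  have \<omega>: "\<omega> \<in> chars (YSC C)" "\<omega>' \<in> chars (YSC C)" using J(4) J'(4) by (auto simp: Ttilde_SC_def)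
  \<comment> \<open>The value that \<zeta> must take on \<open>YSC\<close>: the image of \<eta>
    under \<epsilon>, inverted, times the quotient of the second components of the two
    trivialisations.\<close>
  define \<zeta>0 where "\<zeta>0 = fmult (\<lambda>y. inverse (eps C (\<eta> y)) * \<omega> y) (\<lambda>y. inverse (\<omega>' y))"
  have "\<zeta>0 \<in> chars (YSC C)"
    unfolding \<zeta>0_def
    using chars_closed(2,3) \<omega>(2) tors_SC_simps(7)[OF \<eta> J(4)] unfolding Ttilde_SC_def by blast
  then obtain \<zeta> where \<zeta>: "\<zeta> \<in> chars (YQn C)" "\<And>y. y \<in> YSC C \<Longrightarrow> \<zeta> y = \<zeta>0 y"
    using chars_extend[OF bd_facts(3) YSC_lattice YQn_lattice YSC_sub _ complex_root] by metis
  have "rep z z' f \<zeta>"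
  proof (rule repI[OF z _ _ _ _ j'])
    show "f (tact z t x) = tact z' t (f x)" if "t \<in> That C" "x \<in> tor z" for t x
      using \<delta>t[OF that] O'(4)[OF that(1) \<delta>T(1)[OF that(2)] x1(1)] by (simp add: f_def)
    show "hmap z' (f x) = hmap z x" if "x \<in> tor z" for x
    proof
      fix y
      show "hmap z' (f x) y = hmap z x y"
        unfolding f_def O'(8)[OF \<delta>T(1)[OF that] x1(1)] x1(2)
        using O(8)[OF \<delta>T(1)[OF that] x0, of y] \<delta>T(2)[OF that] by simp
    qed
    have "compose (tor z) j' f = (\<lambda>x\<in>tor z. fmult \<eta> (j x))"
      using j\<eta> by (auto simp: compose_def restrict_def)
    moreover have "fmult \<omega>' (res (YSC C) \<zeta>) = (\<lambda>y. inverse (eps C (\<eta> y)) * \<omega> y)"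
    proof
      fix y
      show "fmult \<omega>' (res (YSC C) \<zeta>) y = inverse (eps C (\<eta> y)) * \<omega> y"
      proof (cases "y \<in> YSC C")
        case True
        then show ?thesis using \<zeta>(2) chars_nz[OF \<omega>(2)] by (simp add: fmult_def res_def \<zeta>0_def)
      next
        case False
        then have "\<omega> y = 1" "\<omega>' y = 1" "\<eta> y = 1"
          using \<omega> That_SC_simps(6)[OF tors_SC_simps(4)[OF \<eta>]] by (auto simp: chars_def)
        then show ?thesis using False by (simp add: fmult_def res_def eps_simps(3))
      qed
    qed
    ultimately show "(compose (tor z) j' f, fmult \<omega>' (res (YSC C) \<zeta>)) \<in> jcls z"
      using jcls_twist[OF z(1) j \<eta>] by simp
  qed (use O'(2) \<delta>T x1(1) \<zeta>(1) in \<open>auto simp: f_def Ttilde_def\<close>)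
  then show ?thesis by (rule that)
qed

end

section \<open>The comparison map at an arbitrary base point\<close>

context bd
begin

definition datum :: "('h, 'y, 'k, 'd) gobj \<Rightarrow> ('h \<Rightarrow> 'h) \<Rightarrow> 'd \<Rightarrow> 'h \<Rightarrow> ('y \<Rightarrow> 'k) \<Rightarrow> 'k \<Rightarrow> bool" where
  "datum z f d x t v \<longleftrightarrow> x \<in> tor z \<and> t \<in> That C \<and> f x = tact z t x \<and> v \<noteq> 0 \<and> hmap z x (pr d) \<cdot> e (v ^ n) = d"

definition cval :: "('k \<Rightarrow> 'k) \<Rightarrow> ('y \<Rightarrow> complex) \<Rightarrow> 'd \<Rightarrow> ('y \<Rightarrow> 'k) \<Rightarrow> 'k \<Rightarrow> complex" where
  "cval \<gamma> \<zeta> d t v = eps C (ginv \<gamma> v / v * t (pr d)) * \<zeta> (pr d)"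

text \<open>\<open>Cgen\<close> generalises \<open>C_map\<close> from convenient base points to all objects: the vector \<open>1\<close> of the
  torsor \<open>That\<close> is replaced by an arbitrary point \<open>x\<close>, and \<open>s\<close> by the splitting \<open>h x\<close>.\<close>

definition Cgen :: "('h, 'y, 'k, 'd) gobj \<Rightarrow> ('k \<Rightarrow> 'k) \<times> ('h, 'y) gmor \<Rightarrow> ('k \<Rightarrow> 'k) \<times> ('d \<Rightarrow> complex)" where
  "Cgen z = (\<lambda>(\<gamma>, m). (\<gamma>, \<lambda>d. if d \<in> D_Qn C
     then THE w. \<exists>f \<zeta> x t v. (f, \<zeta>) \<in> m \<and> datum z f d x t v \<and> w = cval \<gamma> \<zeta> d t v else 1))"

section \<open>Independence of the choices\<close>

lemma datum_exists:
  fixes z :: "('h, 'y, 'k, 'd) gobj"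
  assumes z: "is_object C z" and x: "x \<in> tor z" and f: "f x \<in> tor z" and d: "d \<in> D_Qn C"
  shows "\<exists>t v. datum z f d x t v"
proof -
  note O = is_objectD[OF z]
  obtain t where t: "t \<in> That C" "f x = tact z t x" using O(5)[OF x f] by blast
  have "pr (hmap z x (pr d)) = pr d"
    using splittingsD(2)[OF O(7)[OF x] D_Qn_simps(2)[OF d]] .
  then obtain u where u: "u \<noteq> 0" "d = hmap z x (pr d) \<cdot> e u"
    by (rule same_fibre[OF hmap_in[OF z x] D_Qn_simps(1)[OF d]])
  obtain v where v: "v ^ n = u" "v \<noteq> 0" using root_exists[OF u(1)] by metis
  have "datum z f d x t v" unfolding datum_def using x t v u(2) by simp
  then show ?thesis by blast
qed

text \<open>Compatibility of \<open>f\<close> with \<open>hmap\<close> says that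
  \<open>\<gamma>^-1\<close> moves \<open>h x\<close> by \<open>t^n\<close>; applying
  \<open>\<gamma>^-1\<close> to the rational point \<open>d\<close> then gives
  \<open>v^n = (t * \<gamma>^-1 v)^n\<close>. Multiplicativity of \<epsilon> is available only on
  such roots of unity.\<close>

lemma datum_root:
  fixes z :: "('h, 'y, 'k, 'd) gobj"
  assumes z: "is_object C z" and \<gamma>: "\<gamma> \<in> \<Gamma>" and r: "rep z (conj_obj C \<gamma> z) f \<zeta>"
    and d: "d \<in> D_Qn C" and dt: "datum z f d x t v"
  shows "(ginv \<gamma> v / v * t (pr d)) ^ n = 1"
proof -
  have x: "x \<in> tor z" and t: "t \<in> That C" and fx: "f x = tact z t x" and v: "v \<noteq> 0"
    and de: "hmap z x (pr d) \<cdot> e (v ^ n) = d" using dt by (auto simp: datum_def)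
  have \<gamma>': "ginv \<gamma> \<in> \<Gamma>" using ginv_gal[OF \<gamma>] .
  note A' = act_simps[OF \<gamma>']
  let ?y = "pr d" and ?g = "ginv \<gamma>"
  let ?h = "hmap z x ?y"
  have h: "?h \<in> carrier G" using hmap_in[OF z x] .
  have nz: "t ?y \<noteq> 0" "?g v \<noteq> 0" using That_simps(4)[OF t] gal_simps(7)[OF \<gamma>'] v by auto
  have "act \<gamma> (e (t ?y ^ n) \<cdot> ?h) = ?h"
    using repD(3)[OF r x] is_objectD(8)[OF z t x] fx by (auto simp: fun_eq_iff)
  moreover have "e (t ?y ^ n) \<cdot> ?h \<in> carrier G" using h nz by (simp add: e_simps(1))
  ultimately have gh: "act ?g ?h = e (t ?y ^ n) \<cdot> ?h"
    using act_simps(5)[OF \<gamma>] by metis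
  have "?h \<cdot> e (v ^ n) = act ?g (?h \<cdot> e (v ^ n))" using D_Qn_simps(3)[OF d \<gamma>'] de by simp
  also have "\<dots> = e (t ?y ^ n) \<cdot> ?h \<cdot> e (?g v ^ n)"
    using A'(2)[OF h e_simps(1)] A'(4) v gh by (simp add: gal_simps(4)[OF \<gamma>'])
  also have "\<dots> = ?h \<cdot> e (t ?y ^ n) \<cdot> e (?g v ^ n)" using e_central[OF _ h] nz by simp
  also have "\<dots> = ?h \<cdot> e ((t ?y * ?g v) ^ n)" using h nz by (simp add: e_simps D.m_assoc power_mult_distrib)
  finally have "e (v ^ n) = e ((t ?y * ?g v) ^ n)"
    using h v nz by (metis D.Units_eq D.Units_l_cancel e_simps(1) power_not_zero mult_eq_0_iff)
  then have "v ^ n = (t ?y * ?g v) ^ n" using v nz by (simp add: e_simps(5))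
  moreover have "(?g v / v * t ?y) ^ n = (t ?y * ?g v) ^ n / v ^ n"
    by (simp add: power_divide mult.commute)
  ultimately show ?thesis using v nz by simp
qed

lemma cval_unique:
  fixes z :: "('h, 'y, 'k, 'd) gobj"
  assumes z: "is_object C z" and \<gamma>: "\<gamma> \<in> \<Gamma>" and r: "rep z (conj_obj C \<gamma> z) f \<zeta>"
    and \<xi>: "\<xi> \<in> tors n (That C)" and d: "d \<in> D_Qn C" and dt: "datum z f d x t v"
    and f': "\<And>x. x \<in> tor z \<Longrightarrow> f' x = tact z \<xi> (f x)" and dt': "datum z f' d x' t' v'"
  shows "cval \<gamma> (\<lambda>y. inverse (eps C (\<xi> y)) * \<zeta> y) d t' v' = cval \<gamma> \<zeta> d t v"
proof -
  note O = is_objectD[OF z]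
  have x: "x \<in> tor z" and t: "t \<in> That C" and fx: "f x = tact z t x" and v: "v \<noteq> 0"
    and de: "hmap z x (pr d) \<cdot> e (v ^ n) = d" using dt by (auto simp: datum_def)
  have x': "x' \<in> tor z" and t': "t' \<in> That C" and fx': "f' x' = tact z t' x'" and v': "v' \<noteq> 0"
    and de': "hmap z x' (pr d) \<cdot> e (v' ^ n) = d" using dt' by (auto simp: datum_def)
  have \<gamma>': "ginv \<gamma> \<in> \<Gamma>" using ginv_gal[OF \<gamma>] .
  let ?y = "pr d" and ?g = "ginv \<gamma>"
  note g = gal_simps[OF \<gamma>']
  let ?h = "hmap z x ?y"
  have h: "?h \<in> carrier G" using hmap_in[OF z x] .
  obtain r where rT: "r \<in> That C" and xr: "x' = tact z r x" using O(5)[OF x x'] by blast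
  have gr: "?g \<circ> r \<in> That C" using That_simps(5)[OF \<gamma>' rT] .
  have "tact z (fmult t' r) x = f' x'" using fx' xr O(4)[OF t' rT x] by simp
  also have "\<dots> = tact z \<xi> (tact z (?g \<circ> r) (tact z t x))"
    using f'[OF x'] xr repD(2)[OF assms(3) rT x] fx by simp
  also have "\<dots> = tact z (fmult \<xi> (fmult (?g \<circ> r) t)) x"
    using O(2,4) tors_simps(4)[OF \<xi>] gr t x That_simps(2) by simp
  finally have "fmult t' r = fmult \<xi> (fmult (?g \<circ> r) t)"
    using O(6)[OF _ _ x] That_simps(2) t' rT tors_simps(4)[OF \<xi>] gr t by simp
  \<comment> \<open>Moving the base point by \<open>r\<close> changes \<open>t\<close> by
    \<open>\<gamma>^-1(r) / r\<close>, because \<open>f\<close> takes values in the conjugate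
    torsor.\<close>
  then have tt: "t' ?y * r ?y = \<xi> ?y * ?g (r ?y) * t ?y" by (auto simp: fmult_def fun_eq_iff)
  have rn: "r ?y \<noteq> 0" "?g (r ?y) \<noteq> 0" using That_simps(4)[OF rT] g(7) by auto
  have "e (r ?y ^ n) \<cdot> ?h \<cdot> e (v' ^ n) = ?h \<cdot> e (v ^ n)"
    using de de' xr O(8)[OF rT x] by simp
  then have "?h \<cdot> e ((r ?y * v') ^ n) = ?h \<cdot> e (v ^ n)"
    using e_central[OF _ h] rn v' h by (simp add: power_mult_distrib e_simps D.m_assoc)
  then have "e ((r ?y * v') ^ n) = e (v ^ n)"
    using h v v' rn by (metis D.Units_eq D.Units_l_cancel e_simps(1) power_not_zero mult_eq_0_iff)
  then have vv: "(r ?y * v') ^ n = v ^ n" using v v' rn by (simp add: e_simps(5))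
  \<comment> \<open>The two \<open>n\<close>-th roots agree, after correcting by \<open>r\<close>,
    up to this root of unity, which lies in \<open>F\<close> and cancels from
    \<open>\<gamma>^-1(v') / v'\<close>.\<close>
  define \<omega> where "\<omega> = r ?y * v' / v"
  have \<omega>n: "\<omega> ^ n = 1" using vv v by (simp add: \<omega>_def power_divide)
  have w0: "\<omega> \<noteq> 0" using v v' rn by (simp add: \<omega>_def)
  have ve: "v' = \<omega> * v / r ?y" using v rn by (simp add: \<omega>_def)
  have "?g (r ?y) * ?g v' = \<omega> * ?g v"
  proof -
    have "r ?y * v' = \<omega> * v" using v by (simp add: \<omega>_def)
    then have "?g (r ?y * v') = ?g (\<omega> * v)" by simp
    then show ?thesis using eps_simps(4)[OF \<gamma>' \<omega>n] by (simp add: g)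
  qed
  then have gv: "?g v' = \<omega> * ?g v / ?g (r ?y)" using rn by (simp add: field_simps)
  have te: "t' ?y = \<xi> ?y * ?g (r ?y) * t ?y / r ?y" using tt rn by (simp add: field_simps)
  have key: "?g v' / v' * t' ?y = \<xi> ?y * (?g v / v * t ?y)"
    unfolding gv te by (subst ve) (use rn v w0 in \<open>simp add: field_simps\<close>)
  have \<xi>n: "\<xi> ?y ^ n = 1" using tors_simps(5)[OF \<xi>] .
  show ?thesis unfolding cval_def key
    using eps_simps(1)[OF \<xi>n datum_root[OF z \<gamma> assms(3) d dt]] eps_simps(2)[OF \<xi>n] by simp
qed

section \<open>The comparison map with values in \<open>E2\<close>\<close>

lemma pi1_carrier: "(\<gamma>, m) \<in> carrier (pi1 C z) \<longleftrightarrow> \<gamma> \<in> \<Gamma> \<and> m \<in> Mor C z (conj_obj C \<gamma> z)"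
  by (simp add: pi1_def)

lemma pi1_rep:
  fixes z :: "('h, 'y, 'k, 'd) gobj"
  assumes z: "is_object C z" and m: "(\<gamma>, m) \<in> carrier (pi1 C z)" "(f, \<zeta>) \<in> m"
  shows "\<gamma> \<in> \<Gamma>" "rep z (conj_obj C \<gamma> z) f \<zeta>" "m = mor_class C z (conj_obj C \<gamma> z) f \<zeta>"
    "x \<in> tor z \<Longrightarrow> f x \<in> tor z"
proof -
  have m': "\<gamma> \<in> \<Gamma>" "m \<in> Mor C z (conj_obj C \<gamma> z)" using m(1) by (auto simp: pi1_carrier)
  note E = Mor_elem[OF z is_object_conj[OF z m'(1)] m'(2) m(2)]
  show "\<gamma> \<in> \<Gamma>" "rep z (conj_obj C \<gamma> z) f \<zeta>" "m = mor_class C z (conj_obj C \<gamma> z) f \<zeta>" using m' E by auto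
  show "x \<in> tor z \<Longrightarrow> f x \<in> tor z" using repD(1)[OF E(1)] by simp
qed

lemma Cgen_eq:
  fixes z :: "('h, 'y, 'k, 'd) gobj"
  assumes z: "is_object C z" and m: "(\<gamma>, m) \<in> carrier (pi1 C z)" "(f, \<zeta>) \<in> m"
    and d: "d \<in> D_Qn C" and dt: "datum z f d x t v"
  shows "snd (Cgen z (\<gamma>, m)) d = cval \<gamma> \<zeta> d t v"
proof -
  note P = pi1_rep[OF z m]
  have "w = cval \<gamma> \<zeta> d t v"
    if w: "(f', \<zeta>') \<in> m" "datum z f' d x' t' v'" "w = cval \<gamma> \<zeta>' d t' v'" for f' \<zeta>' x' t' v' w
  proof -
    obtain \<xi> where \<xi>: "\<xi> \<in> tors n (That C)" "f' = (\<lambda>x\<in>tor z. tact z (ginv \<gamma> \<circ> \<xi>) (f x))"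
      "\<zeta>' = (\<lambda>y. inverse (eps C (\<xi> y)) * \<zeta> y)"
      using w(1) unfolding P(3) mor_class_def by auto
    \<comment> \<open>In the conjugate object \<xi> acts through \<open>\<gamma>^-1\<close>, which
      fixes torsion characters.\<close>
    have "f' x = tact z \<xi> (f x)" if "x \<in> tor z" for x
      using that \<xi>(2) tors_simps(6)[OF ginv_gal[OF P(1)] \<xi>(1)] by simp
    then show ?thesis using cval_unique[OF z P(1,2) \<xi>(1) d dt _ w(2)] w(3) \<xi>(3) by simp
  qed
  then have "(THE w. \<exists>f \<zeta> x t v. (f, \<zeta>) \<in> m \<and> datum z f d x t v \<and> w = cval \<gamma> \<zeta> d t v) = cval \<gamma> \<zeta> d t v"
    using m(2) dt by (intro the_equality) blast+
  then show ?thesis using d by (simp add: Cgen_def)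
qed

lemma Cgen_simps: "fst (Cgen z g) = fst g" "d \<notin> D_Qn C \<Longrightarrow> snd (Cgen z g) d = 1"
  by (simp_all add: Cgen_def case_prod_beta)

lemma pi1_E:
  fixes z :: "('h, 'y, 'k, 'd) gobj"
  assumes "is_object C z" "g \<in> carrier (pi1 C z)"
  obtains \<gamma> m f \<zeta> where "g = (\<gamma>, m)" "(\<gamma>, m) \<in> carrier (pi1 C z)" "(f, \<zeta>) \<in> m"
proof -
  obtain \<gamma> m where g: "g = (\<gamma>, m)" by (cases g)
  then have "m \<in> Mor C z (conj_obj C \<gamma> z)" using assms(2) by (simp add: pi1_carrier)
  then obtain f \<zeta> where "(f, \<zeta>) \<in> m" by (rule Mor_nonempty)
  then show ?thesis using that g assms(2) by blast
qed

lemma Cgen_in_E2: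
  fixes z :: "('h, 'y, 'k, 'd) gobj"
  assumes z: "is_object C z" and g: "g \<in> carrier (pi1 C z)"
  shows "Cgen z g \<in> carrier (E2 C)"
proof -
  note O = is_objectD[OF z]
  obtain \<gamma> m f \<zeta> where g: "g = (\<gamma>, m)" and m: "(\<gamma>, m) \<in> carrier (pi1 C z)" "(f, \<zeta>) \<in> m"
    by (rule pi1_E[OF z g])
  note P = pi1_rep[OF z m] and eq = Cgen_eq[OF z m]
  have \<gamma>': "ginv \<gamma> \<in> \<Gamma>" using ginv_gal[OF P(1)] .
  note gs = gal_simps[OF \<gamma>']
  have \<zeta>: "\<zeta> \<in> chars (YQn C)" using repD(4)[OF P(2)] by (simp add: Ttilde_def)
  obtain x where x: "x \<in> tor z" using O(1) by blast
  note h = hmap_in[OF z x] and hs = splittingsD[OF O(7)[OF x]]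
  define \<theta> where "\<theta> = snd (Cgen z (\<gamma>, m))"
  have ex: "\<exists>t v. datum z f d x t v" if "d \<in> D_Qn C" for d
    using datum_exists[of z x f, OF z x P(4)[OF x] that] .
  have "\<theta> d \<noteq> 0" if d: "d \<in> D_Qn C" for d
  proof -
    obtain t v where dt: "datum z f d x t v" using ex[OF d] by blast
    show ?thesis unfolding \<theta>_def eq[OF d dt] cval_def
      using eps_simps(2)[OF datum_root[OF z P(1,2) d dt]] chars_nz[OF \<zeta>] by simp
  qed
  moreover have "\<theta> (d \<cdot> d') = \<theta> d * \<theta> d'" if d: "d \<in> D_Qn C" "d' \<in> D_Qn C" for d d'
  proof -
    obtain t v where dt: "datum z f d x t v" using ex[OF d(1)] by blast
    obtain t' v' where dt': "datum z f d' x t' v'" using ex[OF d(2)] by blast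
    have t: "t \<in> That C" "f x = tact z t x" and v: "v \<noteq> 0" "hmap z x (pr d) \<cdot> e (v ^ n) = d"
      using dt by (auto simp: datum_def)
    have "t' \<in> That C" "f x = tact z t' x" and v': "v' \<noteq> 0" "hmap z x (pr d') \<cdot> e (v' ^ n) = d'"
      using dt' by (auto simp: datum_def)
    then have tt: "t' = t" using O(6) t x by metis
    note y = D_Qn_simps(2)[OF d(1)] D_Qn_simps(2)[OF d(2)]
    have pd: "pr (d \<cdot> d') = pr d + pr d'" using D_Qn_simps(1) d by (simp add: pr_simps)
    have ty: "t (pr d + pr d') = t (pr d) * t (pr d')" using t(1) y by (simp add: That_def chars_def)
    have \<zeta>y: "\<zeta> (pr d + pr d') = \<zeta> (pr d) * \<zeta> (pr d')" using \<zeta> y by (simp add: chars_def)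
    \<comment> \<open>With the point \<open>x\<close> fixed, \<open>t\<close> is common to both
      elements, and the product of the two roots serves for \<open>d \<cdot> d'\<close>.\<close>
    have "hmap z x (pr d + pr d') \<cdot> e ((v * v') ^ n) = hmap z x (pr d) \<cdot> ((hmap z x (pr d') \<cdot> e (v ^ n)) \<cdot> e (v' ^ n))"
      using hs(3)[OF y] h v v' by (simp add: power_mult_distrib e_simps D.m_assoc)
    also have "\<dots> = hmap z x (pr d) \<cdot> ((e (v ^ n) \<cdot> hmap z x (pr d')) \<cdot> e (v' ^ n))"
      using e_central[OF _ h] v by simp
    also have "\<dots> = (hmap z x (pr d) \<cdot> e (v ^ n)) \<cdot> (hmap z x (pr d') \<cdot> e (v' ^ n))"
      using h v(1) v'(1) by (simp add: e_simps(1) D.m_assoc)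
    finally have dt2: "datum z f (d \<cdot> d') x t (v * v')"
      unfolding datum_def pd using x t v v' by simp
    have k: "ginv \<gamma> (v * v') / (v * v') * (t (pr d) * t (pr d'))
        = (ginv \<gamma> v / v * t (pr d)) * (ginv \<gamma> v' / v' * t (pr d'))" by (simp add: gs)
    note E = eps_simps(1)[OF datum_root[OF z P(1,2) d(1) dt] datum_root[OF z P(1,2) d(2) dt'[unfolded tt]]]
    show ?thesis
      unfolding \<theta>_def eq[OF d(1) dt] eq[OF d(2) dt'] eq[OF D_Qn_simps(4)[OF d] dt2] cval_def pd ty \<zeta>y tt k E
      by (simp only: mult.assoc mult.left_commute)
  qed
  moreover have "\<theta> (s_psi C y) = 1" if y: "y \<in> YSC C" for y
  proof -
    let ?d = "s_psi C y"
    have d: "?d \<in> D_Qn C" and pd: "pr ?d = y" using D_Qn_simps(5)[OF y] splittingsD(2)[OF s_psi(1) y] by auto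
    note sp = splittingsD(1)[OF s_psi(1), of y]
    obtain t v0 where "datum z f ?d x t v0" using ex[OF d] by blast
    then have t: "t \<in> That C" "f x = tact z t x" by (auto simp: datum_def)
    obtain j \<omega> where j: "(j, \<omega>) \<in> jcls z" by (rule jcls_nonempty[OF z])
    note J = jclsD[OF z j]
    have jn: "j x y \<noteq> 0" using That_SC_simps(4)[OF J(1)[OF x]] .
    have gjn: "ginv \<gamma> (j x y) \<noteq> 0" using gs(7) jn by simp
    have "e (j x y ^ n) \<cdot> ?d \<cdot> e (inverse (j x y) ^ n) = ?d \<cdot> (e (j x y ^ n) \<cdot> e (inverse (j x y) ^ n))"
      using e_central[OF _ sp, of "j x y ^ n"] jn sp by (simp add: e_simps(1) D.m_assoc)
    also have "\<dots> = ?d" using jn sp by (simp add: e_simps power_inverse flip: e_simps(2))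
    \<comment> \<open>Since \<open>h x y\<close> is \<open>j x y ^ n\<close> times
      \<open>s_psi C y\<close>, the inverse of \<open>j x y\<close> is an admissible root.
      Compatibility with \<open>j\<close> then evaluates the argument of \<epsilon> as
      \<open>\<eta> y\<close> and \<open>\<zeta> y\<close> as the inverse of its image.\<close>
    finally have dt: "datum z f ?d x t (inverse (j x y))"
      unfolding datum_def pd using J(3)[OF x y] jn t x by simp
    have "(\<lambda>x\<in>tor z. \<gamma> \<circ> j x, \<omega>) \<in> jcls (conj_obj C \<gamma> z)" using j by force
    from repD(5)[OF P(2) this] obtain \<eta> where \<eta>: "\<eta> \<in> tors n (That_SC C)"
      and 1: "compose (tor z) (\<lambda>x\<in>tor z. \<gamma> \<circ> j x) f = (\<lambda>x\<in>tor z. fmult \<eta> (j x))"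
      and 2: "fmult \<omega> (res (YSC C) \<zeta>) = (\<lambda>y. inverse (eps C (\<eta> y)) * \<omega> y)"
      by (rule jcls_cases[OF z j])
    have \<eta>n: "\<eta> y ^ n = 1" using tors_SC_simps(5)[OF \<eta>] .
    have "\<omega> y \<noteq> 0" using J(4) chars_nz by (auto simp: Ttilde_SC_def)
    then have \<zeta>e: "\<zeta> y = inverse (eps C (\<eta> y))"
      using fun_cong[OF 2, of y] y by (simp add: fmult_def res_def mult.commute)
    have "\<gamma> (j (f x) y) = \<eta> y * j x y"
      using fun_cong[OF fun_cong[OF 1, of x], of y] x P(4)[OF x] by (simp add: compose_def fmult_def)
    moreover have "j (f x) y = t y * j x y" using J(2)[OF t(1) x] t(2) y by (simp add: fmult_def res_def)
    ultimately have "ginv \<gamma> (\<gamma> (t y * j x y)) = ginv \<gamma> (\<eta> y * j x y)" by simp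
    then have te: "t y * j x y = \<eta> y * ginv \<gamma> (j x y)"
      using gal_simps(6)[OF P(1)] eps_simps(4)[OF \<gamma>' \<eta>n] by (simp add: gs)
    have gi: "ginv \<gamma> (inverse (j x y)) = inverse (ginv \<gamma> (j x y))"
      using gs(1)[of "j x y" "inverse (j x y)"] jn gs(2) by (simp add: inverse_unique)
    have "ginv \<gamma> (inverse (j x y)) / inverse (j x y) * t y = \<eta> y"
      unfolding gi using te jn gjn by (simp add: field_simps)
    then show ?thesis
      unfolding \<theta>_def eq[OF d dt] cval_def pd \<zeta>e using eps_simps(2)[OF \<eta>n] by simp
  qed
  moreover have "\<theta> (e u) = eps C (ginv \<gamma> v / v)" if u: "u \<in> base C - {0}" "v ^ n = u" for u v
  proof -
    have d: "e u \<in> D_Qn C" and pd: "pr (e u) = 0" using D_Qn_simps(6) u(1) e_simps(3) by auto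
    have v0: "v \<noteq> 0" using u n_pos by auto
    obtain t v0 where "datum z f (e u) x t v0" using ex[OF d] by blast
    then have t: "t \<in> That C" "f x = tact z t x" by (auto simp: datum_def)
    \<comment> \<open>Any prescribed root \<open>v\<close> of \<open>u\<close> is admissible,
      because the splitting is trivial at 0.\<close>
    have "datum z f (e u) x t v"
      unfolding datum_def pd using x t v0 u splittings_simps(1)[OF YQn_lattice O(7)[OF x]]
      by (simp add: e_simps(1))
    from eq[OF d this] show ?thesis
      using chars_simps(1)[OF YQn_lattice \<zeta>] chars_simps(1)[OF YQn_lattice t(1)[unfolded That_def]]
      by (simp add: \<theta>_def cval_def pd)
  qed
  moreover have "\<theta> d = 1" if "d \<notin> D_Qn C" for d using that by (simp add: \<theta>_def Cgen_simps)
  moreover have "Cgen z g = (\<gamma>, \<theta>)" by (simp add: g \<theta>_def prod_eq_iff Cgen_simps)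
  ultimately show ?thesis using P(1) by (simp add: E2_def)
qed

text \<open>The conjugate of \<iota> has the same representing pairs as \<iota>, so the transported
  morphism is \<open>f0 f f0^-1\<close> with second component \<zeta>: the factor
  \<open>\<zeta>0\<close> cancels.\<close>

lemma pi1_map_rep:
  fixes z z' :: "('h, 'y, 'k, 'd) gobj"
  assumes z: "is_object C z" "is_object C z'" and \<iota>: "\<iota> \<in> Mor C z z'" and g: "g \<in> carrier (pi1 C z)"
  shows "pi1_map z z' \<iota> g \<in> carrier (pi1 C z')" "Cgen z' (pi1_map z z' \<iota> g) = Cgen z g"
proof -
  obtain \<gamma> m f \<zeta> where g: "g = (\<gamma>, m)" and m: "(\<gamma>, m) \<in> carrier (pi1 C z)" "(f, \<zeta>) \<in> m"
    by (rule pi1_E[OF z(1) g])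
  note P = pi1_rep[OF z(1) m]
  obtain f0 \<zeta>0 where \<iota>0: "\<iota> = mor_class C z z' f0 \<zeta>0" and r0: "rep z z' f0 \<zeta>0" using \<iota> unfolding Mor_iff by blast
  note c = is_object_conj[OF z(1) P(1)] is_object_conj[OF z(2) P(1)]
  define k where "k = (\<lambda>x\<in>tor z'. inv_into (tor z) f0 x)"
  note ri = rep_inv[OF r0 z, folded k_def] and rc = rep_conj[OF r0 z P(1)]
  note r1 = rep_comp[OF ri(1) P(2) z(2,1) c(1)]
  note r2 = rep_comp[OF r1(1) rc(1) z(2) c]
  define F where "F = compose (tor z') f0 (compose (tor z') f k)"
  define Z where "Z = fmult \<zeta>0 (fmult \<zeta> (\<lambda>y. inverse (\<zeta>0 y)))"
  have mc: "pi1_map z z' \<iota> g = (\<gamma>, mor_class C z' (conj_obj C \<gamma> z') F Z)"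
    unfolding pi1_map_def g conj_mor_def F_def Z_def
    using r2(2) by (simp add: \<iota>0 ri(2) r1(2)[folded P(3)] rc(2))
  have rF: "rep z' (conj_obj C \<gamma> z') F Z" using r2(1) unfolding F_def Z_def .
  show in': "pi1_map z z' \<iota> g \<in> carrier (pi1 C z')"
    unfolding mc pi1_carrier Mor_iff using rF P(1) by blast
  have Z: "Z = \<zeta>" using Ttilde_simps(4)[OF repD(4)[OF r0]] by (auto simp: Z_def fmult_def)
  have Fext: "(\<lambda>x\<in>tor z'. F x, Z) \<in> mor_class C z' (conj_obj C \<gamma> z') F Z"
    using restrict_in_mor_class[OF c(2)] repD(1)[OF rF] by simp
  have "snd (Cgen z' (pi1_map z z' \<iota> g)) d = snd (Cgen z g) d" for d
  proof (cases "d \<in> D_Qn C")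
    case d: True
    obtain x where x: "x \<in> tor z" using is_objectD(1)[OF z(1)] by blast
    obtain t v where dt: "datum z f d x t v" using datum_exists[of z x f, OF z(1) x P(4)[OF x] d] by blast
    have x': "f0 x \<in> tor z'" using repD(1)[OF r0 x] .
    have "k (f0 x) = x"
      using x x' rep_bij[OF r0 z] by (simp add: k_def bij_betw_def inv_into_f_f)
    then have "F (f0 x) = f0 (f x)" using x' by (simp add: F_def compose_def)
    then have "datum z' (\<lambda>x\<in>tor z'. F x) d (f0 x) t v"
      using dt x' repD(2,3)[OF r0] by (simp add: datum_def)
    from Cgen_eq[OF z(2) in'[unfolded mc] Fext d this] show ?thesis
      unfolding mc using Cgen_eq[OF z(1) m d dt] by (simp add: g Z)
  qed (simp add: Cgen_simps)
  moreover have "fst (Cgen z' (pi1_map z z' \<iota> g)) = fst (Cgen z g)" unfolding mc by (simp add: Cgen_simps g)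
  ultimately show "Cgen z' (pi1_map z z' \<iota> g) = Cgen z g" by (simp add: prod_eq_iff fun_eq_iff)
qed

text \<open>Both factors may be evaluated at the same point \<open>x\<close> and with the same root
  \<open>v\<close>. The composite then sends \<open>x\<close> to
  \<open>(\<gamma>'^-1 t) t' x\<close>.\<close>

lemma Cgen_mult:
  fixes z :: "('h, 'y, 'k, 'd) gobj"
  assumes z: "is_object C z" and g: "g \<in> carrier (pi1 C z)" "g' \<in> carrier (pi1 C z)"
  shows "Cgen z (g \<otimes>\<^bsub>pi1 C z\<^esub> g') = Cgen z g \<otimes>\<^bsub>E2 C\<^esub> Cgen z g'"
proof -
  note O = is_objectD[OF z]
  obtain \<gamma> m f \<zeta> where g: "g = (\<gamma>, m)" and m: "(\<gamma>, m) \<in> carrier (pi1 C z)" "(f, \<zeta>) \<in> m"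
    by (rule pi1_E[OF z g(1)])
  obtain \<gamma>' m' f' \<zeta>' where g': "g' = (\<gamma>', m')" and m': "(\<gamma>', m') \<in> carrier (pi1 C z)" "(f', \<zeta>') \<in> m'"
    by (rule pi1_E[OF z assms(3)])
  note P = pi1_rep[OF z m] and P' = pi1_rep[OF z m']
  note c = is_object_conj[OF z P(1)] and c' = is_object_conj[OF z P'(1)]
  note cc = is_object_conj[OF c' P(1)]
  note rc = rep_conj[OF P'(2) z c' P(1)]
  note r = rep_comp[OF P(2) rc(1) z c cc]
  define F where "F = compose (tor z) f' f"
  define Z where "Z = fmult \<zeta>' \<zeta>"
  have gg: "\<gamma> \<circ> \<gamma>' \<in> \<Gamma>" using gal_comp[OF P(1) P'(1)] .
  have rF: "rep z (conj_obj C (\<gamma> \<circ> \<gamma>') z) F Z"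
    using r(1) unfolding rep_conj_conj(1)[OF z P(1) P'(1)] F_def Z_def .
  have mc: "g \<otimes>\<^bsub>pi1 C z\<^esub> g' = (\<gamma> \<circ> \<gamma>', mor_class C z (conj_obj C (\<gamma> \<circ> \<gamma>') z) F Z)"
  proof -
    have "mor_class C (conj_obj C \<gamma> z) (conj_obj C \<gamma> (conj_obj C \<gamma>' z)) f' \<zeta>' = m'"
      using rc(2) P'(3) by simp
    then have "mor_comp z m' m = mor_class C z (conj_obj C \<gamma> (conj_obj C \<gamma>' z)) F Z"
      using r(2) unfolding P(3)[symmetric] F_def Z_def by simp
    then show ?thesis
      unfolding rep_conj_conj(2)[OF z P(1) P'(1)] by (simp add: pi1_def g g' conj_mor_def)
  qed
  have in': "(\<gamma> \<circ> \<gamma>', mor_class C z (conj_obj C (\<gamma> \<circ> \<gamma>') z) F Z) \<in> carrier (pi1 C z)"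
    unfolding pi1_carrier Mor_iff using rF gg by blast
  have Fext: "(\<lambda>x\<in>tor z. F x, Z) \<in> mor_class C z (conj_obj C (\<gamma> \<circ> \<gamma>') z) F Z"
    using restrict_in_mor_class[OF is_object_conj[OF z gg]] repD(1)[OF rF] by simp
  have inv: "ginv (\<gamma> \<circ> \<gamma>') = ginv \<gamma>' \<circ> ginv \<gamma>"
    using P(1) P'(1) by (intro o_inv_distrib) (auto simp: gal_def)
  note gi = ginv_gal[OF P'(1)]
  obtain x where x: "x \<in> tor z" using O(1) by blast
  have "snd (Cgen z (g \<otimes>\<^bsub>pi1 C z\<^esub> g')) d = snd (Cgen z g) d * snd (Cgen z g') d" for d
  proof (cases "d \<in> D_Qn C")
    case d: True
    obtain t v where dt: "datum z f d x t v" using datum_exists[of z x f, OF z x P(4)[OF x] d] by blast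
    obtain t' v' where dt': "datum z f' d x t' v'" using datum_exists[of z x f', OF z x P'(4)[OF x] d] by blast
    have t: "t \<in> That C" "f x = tact z t x" and v: "v \<noteq> 0" "hmap z x (pr d) \<cdot> e (v ^ n) = d"
      using dt by (auto simp: datum_def)
    have t': "t' \<in> That C" "f' x = tact z t' x" using dt' by (auto simp: datum_def)
    have dt1: "datum z f' d x t' v" using t' v x by (simp add: datum_def)
    have gt: "ginv \<gamma>' \<circ> t \<in> That C" using That_simps(5)[OF gi t(1)] .
    have "F x = tact z (fmult (ginv \<gamma>' \<circ> t) t') x"
      using repD(2)[OF P'(2) t(1) x] t t' x O(4)[OF gt t'(1) x] by (simp add: F_def compose_def)
    then have dt2: "datum z (\<lambda>x\<in>tor z. F x) d x (fmult (ginv \<gamma>' \<circ> t) t') v"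
      using x v That_simps(2)[OF gt t'(1)] by (simp add: datum_def)
    have R: "(ginv \<gamma> v / v * t (pr d)) ^ n = 1" "(ginv \<gamma>' v / v * t' (pr d)) ^ n = 1"
      using datum_root[OF z P(1,2) d dt] datum_root[OF z P'(1,2) d dt1] .
    \<comment> \<open>This ratio lies in mu_n because \<open>d\<close> is rational, hence is fixed
      by \<open>\<gamma>'\<close>; that turns the cocycle expression for the composite into a
      product.\<close>
    have fx: "ginv \<gamma>' (ginv \<gamma> v / v * t (pr d)) = ginv \<gamma> v / v * t (pr d)" using eps_simps(4)[OF gi R(1)] .
    have "ginv \<gamma>' (ginv \<gamma> v / v * t (pr d)) * ginv \<gamma>' v = ginv \<gamma>' (ginv \<gamma> v) * ginv \<gamma>' (t (pr d))"
      using v by (simp flip: gal_simps(1)[OF gi])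
    then have "ginv \<gamma>' (ginv \<gamma> v) / v * (ginv \<gamma>' (t (pr d)) * t' (pr d))
        = (ginv \<gamma> v / v * t (pr d)) * (ginv \<gamma>' v / v * t' (pr d))"
      unfolding fx using v by (simp add: field_simps)
    then have "cval (\<gamma> \<circ> \<gamma>') Z d (fmult (ginv \<gamma>' \<circ> t) t') v = cval \<gamma> \<zeta> d t v * cval \<gamma>' \<zeta>' d t' v"
      using eps_simps(1)[OF R] by (simp add: cval_def inv Z_def fmult_def)
    then show ?thesis
      unfolding mc using Cgen_eq[OF z in' Fext d dt2] Cgen_eq[OF z m d dt] Cgen_eq[OF z m' d dt1]
      by (simp add: g g')
  qed (simp add: Cgen_simps)
  moreover have "fst (Cgen z (g \<otimes>\<^bsub>pi1 C z\<^esub> g')) = \<gamma> \<circ> \<gamma>'" unfolding mc by (simp add: Cgen_simps)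
  ultimately show ?thesis
    by (simp add: E2_def case_prod_beta prod_eq_iff fun_eq_iff fmult_def) (simp add: Cgen_simps g g')
qed

text \<open>Two morphisms over the same \<gamma> differ on torsors by an element \<xi>, which is
  torsion because both respect \<open>hmap\<close>. Once it is absorbed, equal values at rational
  points give equal \<zeta>, since these points surject onto \<open>YQn\<close>.\<close>

lemma Cgen_inj:
  fixes z :: "('h, 'y, 'k, 'd) gobj"
  assumes z: "is_object C z"
  shows "inj_on (Cgen z) (carrier (pi1 C z))"
proof (rule inj_onI)
  note O = is_objectD[OF z]
  fix g g' assume gg: "g \<in> carrier (pi1 C z)" "g' \<in> carrier (pi1 C z)" and eq: "Cgen z g = Cgen z g'"
  obtain \<gamma> m f \<zeta> where g: "g = (\<gamma>, m)" and m: "(\<gamma>, m) \<in> carrier (pi1 C z)" "(f, \<zeta>) \<in> m"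
    by (rule pi1_E[OF z gg(1)])
  obtain \<gamma>' m' f' \<zeta>' where g': "g' = (\<gamma>', m')" and m0: "(\<gamma>', m') \<in> carrier (pi1 C z)" "(f', \<zeta>') \<in> m'"
    by (rule pi1_E[OF z gg(2)])
  have gs: "\<gamma>' = \<gamma>" using arg_cong[OF eq, of fst] by (simp add: Cgen_simps g g')
  have m': "(\<gamma>, m') \<in> carrier (pi1 C z)" using m0 gs by simp
  note P = pi1_rep[OF z m] and P' = pi1_rep[OF z m' m0(2)]
  let ?c = "conj_obj C \<gamma> z"
  have c: "is_object C ?c" using is_object_conj[OF z P(1)] .
  note O' = is_objectD[OF c]
  note R = repD[OF P(2)] and R' = repD[OF P'(2)]
  obtain x where x: "x \<in> tor z" using O(1) by blast
  obtain \<xi> where \<xi>T: "\<xi> \<in> That C" and fx: "f' x = tact ?c \<xi> (f x)"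
    using O'(5)[OF R(1)[OF x] R'(1)[OF x]] by blast
  have "\<xi> y ^ n = 1" for y
  proof -
    have "e (\<xi> y ^ n) \<cdot> hmap ?c (f x) y = hmap ?c (f x) y"
      using O'(8)[OF \<xi>T R(1)[OF x], of y] fx R(3)[OF x] R'(3)[OF x] by (simp del: conj_simps)
    then have "e (\<xi> y ^ n) = e 1"
      using hmap_in[OF c R(1)[OF x], of y] e_simps(1)[of "\<xi> y ^ n"] That_simps(4)[OF \<xi>T] by (simp add: e_simps(4) del: conj_simps)
    then show ?thesis using That_simps(4)[OF \<xi>T] e_simps(5)[of "\<xi> y ^ n" 1] by simp
  qed
  then have \<xi>: "\<xi> \<in> tors n (That C)" using \<xi>T by (simp add: tors_def)
  have f': "f' x' = tact ?c \<xi> (f x')" if x': "x' \<in> tor z" for x'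
  proof -
    obtain t where t: "t \<in> That C" "x' = tact z t x" using O(5)[OF x x'] by blast
    have "f' x' = tact ?c t (tact ?c \<xi> (f x))" using R'(2)[OF t(1) x] t(2) fx by simp
    also have "\<dots> = tact ?c \<xi> (tact ?c t (f x))"
      unfolding O'(4)[OF t(1) \<xi>T R(1)[OF x]] O'(4)[OF \<xi>T t(1) R(1)[OF x]]
      by (simp add: fmult_def mult.commute)
    finally show ?thesis using R(2)[OF t(1) x] t(2) by simp
  qed
  \<comment> \<open>Another representative of \<open>m\<close>, with the same first component as
    \<open>f'\<close> on the torsor.\<close>
  define f1 where "f1 = (\<lambda>x\<in>tor z. tact ?c \<xi> (f x))"
  define \<zeta>1 where "\<zeta>1 = (\<lambda>y. inverse (eps C (\<xi> y)) * \<zeta> y)"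
  have m1: "(f1, \<zeta>1) \<in> m" unfolding P(3) mor_class_def f1_def \<zeta>1_def using \<xi> by blast
  note P1 = pi1_rep[OF z m(1) m1]
  have "\<zeta>1 y = \<zeta>' y" for y
  proof (cases "y \<in> YQn C")
    case True
    then obtain d where d: "d \<in> D_Qn C" "pr d = y" using D_Qn_simps(7) by blast
    obtain t v where dt: "datum z f1 d x t v" using datum_exists[of z x f1, OF z x P1(4)[OF x] d(1)] by blast
    then have dt': "datum z f' d x t v" using f'[OF x] x by (simp add: datum_def f1_def)
    have "cval \<gamma> \<zeta>1 d t v = cval \<gamma> \<zeta>' d t v"
      using Cgen_eq[OF z m(1) m1 d(1) dt] Cgen_eq[OF z m' m0(2) d(1) dt'] eq by (simp add: g g' gs)
    then show ?thesis
      using eps_simps(2)[OF datum_root[OF z P1(1,2) d(1) dt]] by (simp add: cval_def d(2))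
  next
    case False
    then show ?thesis using Ttilde_simps(5)[OF repD(4)[OF P1(2)]] Ttilde_simps(5)[OF R'(4)] by simp
  qed
  then have "\<zeta>1 = \<zeta>'" by blast
  then have "mor_class C z ?c f1 \<zeta>1 = mor_class C z ?c f' \<zeta>'"
    unfolding mor_class_def using f' by (intro image_cong refl) (simp add: f1_def cong: restrict_cong)
  then show "g = g'" using P1(3) P'(3) by (simp add: g g' gs)
qed

text \<open>Some morphism over \<gamma> exists and has a value \<open>\<theta>0\<close>. The
  quotient of \<theta> by \<open>\<theta>0\<close> is trivial on scalars of \<open>F\<close> and on
  the image of \<open>s_psi\<close>, so it descends to a character in \<open>Ztilde\<close> by which
  the morphism can be changed.\<close>

lemma Cgen_surj:
  fixes z :: "('h, 'y, 'k, 'd) gobj"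
  assumes z: "is_object C z" and g: "(\<gamma>, \<theta>) \<in> carrier (E2 C)"
  shows "(\<gamma>, \<theta>) \<in> Cgen z ` carrier (pi1 C z)"
proof -
  note O = is_objectD[OF z]
  have \<theta>: "\<gamma> \<in> \<Gamma>" "\<And>d. d \<in> D_Qn C \<Longrightarrow> \<theta> d \<noteq> 0"
    "\<And>d d'. d \<in> D_Qn C \<Longrightarrow> d' \<in> D_Qn C \<Longrightarrow> \<theta> (d \<cdot> d') = \<theta> d * \<theta> d'"
    "\<And>d. d \<notin> D_Qn C \<Longrightarrow> \<theta> d = 1" "\<And>y. y \<in> YSC C \<Longrightarrow> \<theta> (s_psi C y) = 1"
    "\<And>u v. u \<in> base C - {0} \<Longrightarrow> v ^ n = u \<Longrightarrow> \<theta> (e u) = eps C (ginv \<gamma> v / v)"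
    using g by (auto simp: E2_def)
  have c: "is_object C (conj_obj C \<gamma> z)" using is_object_conj[OF z \<theta>(1)] .
  obtain f0 \<zeta>0 where r0: "rep z (conj_obj C \<gamma> z) f0 \<zeta>0" by (rule rep_exists[OF z c])
  define m0 where "m0 = mor_class C z (conj_obj C \<gamma> z) f0 \<zeta>0"
  have m0: "(\<gamma>, m0) \<in> carrier (pi1 C z)" unfolding pi1_carrier Mor_iff m0_def using r0 \<theta>(1) by blast
  define f where "f = (\<lambda>x\<in>tor z. f0 x)"
  have fm: "(f, \<zeta>0) \<in> m0"
    unfolding m0_def f_def using restrict_in_mor_class[OF c] repD(1)[OF r0] by simp
  note P = pi1_rep[OF z m0 fm]
  define \<theta>0 where "\<theta>0 = snd (Cgen z (\<gamma>, m0))"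
  have "Cgen z (\<gamma>, m0) = (\<gamma>, \<theta>0)" by (simp add: \<theta>0_def prod_eq_iff Cgen_simps)
  then have "(\<gamma>, \<theta>0) \<in> carrier (E2 C)" using Cgen_in_E2[OF z m0] by simp
  then have \<theta>0: "\<And>d. d \<in> D_Qn C \<Longrightarrow> \<theta>0 d \<noteq> 0"
    "\<And>d d'. d \<in> D_Qn C \<Longrightarrow> d' \<in> D_Qn C \<Longrightarrow> \<theta>0 (d \<cdot> d') = \<theta>0 d * \<theta>0 d'"
    "\<And>y. y \<in> YSC C \<Longrightarrow> \<theta>0 (s_psi C y) = 1"
    "\<And>u v. u \<in> base C - {0} \<Longrightarrow> v ^ n = u \<Longrightarrow> \<theta>0 (e u) = eps C (ginv \<gamma> v / v)"
    by (auto simp: E2_def)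
  define \<rho> where "\<rho> d = \<theta> d / \<theta>0 d" for d
  have \<rho>m: "\<rho> (d \<cdot> d') = \<rho> d * \<rho> d'" if "d \<in> D_Qn C" "d' \<in> D_Qn C" for d d'
    using \<theta>(3)[OF that] \<theta>0(2)[OF that] by (simp add: \<rho>_def)
  \<comment> \<open>Two rational points over one lattice point differ by a scalar of
    \<open>F\<close>, where \<theta> and \<open>\<theta>0\<close> take the same prescribed
    value.\<close>
  have \<rho>u: "\<rho> d = \<rho> d'" if d: "d \<in> D_Qn C" "d' \<in> D_Qn C" "pr d = pr d'" for d d'
  proof -
    obtain u where u: "u \<noteq> 0" "d' = d \<cdot> e u"
      using same_fibre[OF D_Qn_simps(1)[OF d(1)] D_Qn_simps(1)[OF d(2)] d(3)] by metis
    have "act \<delta> (e u) = e u" if \<delta>: "\<delta> \<in> \<Gamma>" for \<delta>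
    proof -
      have "d \<cdot> act \<delta> (e u) = d \<cdot> e u"
        using D_Qn_simps(3)[OF d(2) \<delta>] D_Qn_simps(3)[OF d(1) \<delta>] u
          act_simps(2)[OF \<delta> D_Qn_simps(1)[OF d(1)] e_simps(1)[OF u(1)]] by simp
      then show ?thesis
        using D_Qn_simps(1)[OF d(1)] act_simps(1)[OF \<delta>] e_simps(1)[OF u(1)]
        by (metis D.Units_eq D.Units_l_cancel)
    qed
    then have eu: "e u \<in> D_Qn C"
      using u(1) is_latticeD(1)[OF YQn_lattice] by (simp add: D_Qn_def e_simps)
    then have ub: "u \<in> base C - {0}" using D_Qn_simps(6)[OF u(1)] u(1) by simp
    obtain v where v: "v ^ n = u" using root_exists[OF u(1)] by metis
    have "\<rho> (e u) = 1" using \<theta>(6)[OF ub v] \<theta>0(4)[OF ub v] \<theta>0(1)[OF eu] by (simp add: \<rho>_def)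
    then show ?thesis using \<rho>m[OF d(1) eu] u(2) by simp
  qed
  define \<zeta>' where "\<zeta>' y = (if y \<in> YQn C then \<rho> (SOME d. d \<in> D_Qn C \<and> pr d = y) else 1)" for y
  have \<zeta>'e: "\<zeta>' (pr d) = \<rho> d" if d: "d \<in> D_Qn C" for d
  proof -
    have "(SOME d'. d' \<in> D_Qn C \<and> pr d' = pr d) \<in> D_Qn C \<and> pr (SOME d'. d' \<in> D_Qn C \<and> pr d' = pr d) = pr d"
      by (rule someI[of _ d]) (use d in simp)
    then show ?thesis using \<rho>u[OF _ d] D_Qn_simps(2)[OF d] by (simp add: \<zeta>'_def)
  qed
  have "\<zeta>' \<in> chars (YQn C)"
    unfolding chars_def
  proof (intro CollectI conjI ballI allI impI)
    fix y assume y: "y \<in> YQn C"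
    obtain d where d: "d \<in> D_Qn C" "pr d = y" using D_Qn_simps(7)[OF y] by blast
    show "\<zeta>' y \<noteq> 0" using \<zeta>'e[OF d(1)] d \<theta>(2) \<theta>0(1) by (simp add: \<rho>_def)
    fix y' assume y': "y' \<in> YQn C"
    obtain d' where d': "d' \<in> D_Qn C" "pr d' = y'" using D_Qn_simps(7)[OF y'] by blast
    have "pr (d \<cdot> d') = y + y'" using d d' D_Qn_simps(1) by (simp add: pr_simps)
    then show "\<zeta>' (y + y') = \<zeta>' y * \<zeta>' y'"
      using \<zeta>'e[OF d(1)] \<zeta>'e[OF d'(1)] \<zeta>'e[OF D_Qn_simps(4)[OF d(1) d'(1)]] \<rho>m[OF d(1) d'(1)] d d' by simp
  qed (simp add: \<zeta>'_def)
  then have \<zeta>'T: "\<zeta>' \<in> Ttilde C" by (simp add: Ttilde_def)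
  have \<zeta>'1: "\<zeta>' y = 1" if y: "y \<in> YSC C" for y
    using \<zeta>'e[OF D_Qn_simps(5)[OF y]] splittingsD(2)[OF s_psi(1) y] \<theta>(5)[OF y] \<theta>0(3)[OF y] by (simp add: \<rho>_def)
  define Z where "Z = fmult \<zeta>0 \<zeta>'"
  \<comment> \<open>As \<open>\<zeta>'\<close> is trivial on \<open>YSC\<close>, the compatibility
    with \<open>j\<close> is unaffected.\<close>
  have res: "res (YSC C) Z = res (YSC C) \<zeta>0" using \<zeta>'1 by (auto simp: res_def Z_def fmult_def)
  have rZ: "rep z (conj_obj C \<gamma> z) f Z"
    using P(2) Ttilde_simps(2)[OF repD(4)[OF P(2)] \<zeta>'T] unfolding rep_def res by (simp add: Z_def)
  define m where "m = mor_class C z (conj_obj C \<gamma> z) f Z"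
  have m: "(\<gamma>, m) \<in> carrier (pi1 C z)" unfolding pi1_carrier Mor_iff m_def using rZ \<theta>(1) by blast
  have fm': "(f, Z) \<in> m"
  proof -
    have "restrict f (tor z) = f" by (simp add: f_def)
    then show ?thesis using restrict_in_mor_class[OF c, of z f Z] repD(1)[OF rZ] by (simp add: m_def)
  qed
  obtain x where x: "x \<in> tor z" using O(1) by blast
  have "snd (Cgen z (\<gamma>, m)) d = \<theta> d" for d
  proof (cases "d \<in> D_Qn C")
    case d: True
    obtain t v where dt: "datum z f d x t v" using datum_exists[of z x f, OF z x P(4)[OF x] d] by blast
    have "snd (Cgen z (\<gamma>, m)) d = \<theta>0 d * \<zeta>' (pr d)"
      using Cgen_eq[OF z m fm' d dt] Cgen_eq[OF z m0 fm d dt] by (simp add: \<theta>0_def cval_def Z_def fmult_def)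
    then show ?thesis using \<zeta>'e[OF d] \<theta>0(1)[OF d] by (simp add: \<rho>_def)
  qed (simp add: Cgen_simps \<theta>(4))
  then have "Cgen z (\<gamma>, m) = (\<gamma>, \<theta>)" by (simp add: prod_eq_iff Cgen_simps fun_eq_iff)
  then show ?thesis using m by (metis image_eqI)
qed

lemma Cgen_bij:
  fixes z :: "('h, 'y, 'k, 'd) gobj"
  assumes "is_object C z"
  shows "bij_betw (Cgen z) (carrier (pi1 C z)) (carrier (E2 C))"
  unfolding bij_betw_def using Cgen_inj[OF assms] Cgen_in_E2[OF assms] Cgen_surj[OF assms] by auto

text \<open>The pair and the root selected in \<open>C_map\<close> form one admissible datum, and
  \<open>Cgen\<close> does not depend on which datum is taken.\<close>

lemma Cgen_base_point:
  assumes s: "s \<in> convenient_splittings C" and g: "g \<in> carrier (pi1 C (base_point C s))"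
  shows "Cgen (base_point C s) g = C_map C s g"
proof -
  let ?z = "base_point C s"
  have z: "is_object C ?z" using base_point_object[OF s] .
  have S: "s \<in> splittings C (YQn C)" using s by (simp add: convenient_splittings_def)
  have [simp]: "tor ?z = That C" "tact ?z = fmult" "\<And>x y. hmap ?z x y = e (x y ^ n) \<cdot> s y"
    by (simp_all add: base_point_def)
  obtain \<gamma> m where g: "g = (\<gamma>, m)" by (cases g)
  have m: "(\<gamma>, m) \<in> carrier (pi1 C ?z)" using assms(2) g by simp
  define p where "p = (SOME p. p \<in> m)"
  obtain f' \<zeta>' where "(f', \<zeta>') \<in> m" using pi1_E[OF z m] by blast
  then have "p \<in> m" unfolding p_def by (rule someI)
  moreover obtain f \<zeta> where p: "p = (f, \<zeta>)" by (cases p)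
  ultimately have fm: "(f, \<zeta>) \<in> m" by simp
  note P = pi1_rep[OF z m fm]
  have C: "C_map C s g = (\<gamma>, C_pair C s \<gamma> (f (\<lambda>_. 1)) \<zeta>)"
    by (simp add: C_map_def g p_def[symmetric] p)
  have "C_pair C s \<gamma> (f (\<lambda>_. 1)) \<zeta> d = snd (Cgen ?z g) d" for d
  proof (cases "d \<in> D_Qn C")
    case d: True
    let ?y = "pr d"
    have sd: "s ?y \<in> carrier G" "pr (s ?y) = ?y"
      using splittingsD(1,2)[OF S] D_Qn_simps(2)[OF d] by auto
    obtain u where u: "u \<noteq> 0" "d = s ?y \<cdot> e u"
      using same_fibre[OF sd(1) D_Qn_simps(1)[OF d] sd(2)] by metis
    have U: "(THE u. u \<noteq> 0 \<and> d = s ?y \<cdot> e u) = u"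
    proof (rule the_equality)
      fix u' assume u': "u' \<noteq> 0 \<and> d = s ?y \<cdot> e u'"
      then have "s ?y \<cdot> e u' = s ?y \<cdot> e u" using u(2) by simp
      then have "e u' = e u" using sd(1) e_simps(1) u(1) u' by (metis D.Units_eq D.Units_l_cancel)
      then show "u' = u" using e_simps(5) u(1) u' by blast
    qed (use u in simp)
    define v where "v = (SOME v. v ^ n = u)"
    have "\<exists>v. v ^ n = u" using root_exists[OF u(1)] by metis
    then have v: "v ^ n = u" unfolding v_def by (rule someI_ex)
    have v0: "v \<noteq> 0" using v u(1) n_pos by auto
    have "datum ?z f d (\<lambda>_. 1) (f (\<lambda>_. 1)) v"
      unfolding datum_def using That_simps(1) P(4)[of "\<lambda>_. 1"] v v0 u(2) sd(1)
      by (simp add: fmult_def e_simps(4))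
    from Cgen_eq[OF z m fm d this] show ?thesis
      using d by (simp add: C_pair_def Let_def U v_def[symmetric] cval_def g)
  qed (simp add: C_pair_def Cgen_simps)
  then show ?thesis unfolding C by (simp add: prod_eq_iff Cgen_simps fun_eq_iff g)
qed

lemma Cgen_incl:
  fixes z :: "('h, 'y, 'k, 'd) gobj"
  assumes z: "is_object C z" and \<zeta>: "\<zeta> \<in> Ztilde C"
  shows "Cgen z (pi1_incl C z \<zeta>) = E2_incl C \<zeta>"
proof -
  note O = is_objectD[OF z]
  let ?c = "conj_obj C id z"
  have c: "is_object C ?c" using is_object_conj[OF z gal_id] .
  have \<zeta>T: "\<zeta> \<in> Ttilde C" "\<And>y. y \<in> YSC C \<Longrightarrow> \<zeta> y = 1" using \<zeta> by (auto simp: Ztilde_def)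
  \<comment> \<open>The inclusion is written with target \<open>z\<close>, whereas
    \<open>pi1\<close> asks for the conjugate by the identity. The two records may differ off the
    torsor, but a class only sees the torsor of the source and the action on the target.\<close>
  have mc: "mor_class C z z id \<zeta> = mor_class C z ?c id \<zeta>" by (simp add: mor_class_def)
  obtain j \<omega> where j: "(j, \<omega>) \<in> jcls z" by (rule jcls_nonempty[OF z])
  have je: "(\<lambda>x\<in>tor z. id \<circ> j x) = j" using jclsD(5)[OF z j] by (auto simp: extensional_def fun_eq_iff)
  have j': "(j, \<omega>) \<in> jcls ?c" using j je by force
  have "rep z ?c id \<zeta>"
  proof (rule repI[OF z c _ _ _ _ j'])
    have "compose (tor z) j id = j" using jclsD(5)[OF z j] by (auto simp: compose_def extensional_def fun_eq_iff)
    moreover have "fmult \<omega> (res (YSC C) \<zeta>) = \<omega>" using \<zeta>T(2) by (auto simp: fmult_def res_def)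
    ultimately show "(compose (tor z) j id, fmult \<omega> (res (YSC C) \<zeta>)) \<in> jcls z" using j by simp
    show "hmap ?c (id x) = hmap z x" if "x \<in> tor z" for x
      using gm_extensionD(6)[OF ext hmap_in[OF z that]] by (auto simp: fun_eq_iff)
  qed (use \<zeta>T in auto)
  then have m: "(id, mor_class C z ?c id \<zeta>) \<in> carrier (pi1 C z)"
    unfolding pi1_carrier Mor_iff using gal_id by blast
  have fm: "(\<lambda>x\<in>tor z. id x, \<zeta>) \<in> mor_class C z ?c id \<zeta>"
    by (rule restrict_in_mor_class[OF c]) simp
  note P = pi1_rep[OF z m fm]
  obtain x where x: "x \<in> tor z" using O(1) by blast
  have "snd (Cgen z (id, mor_class C z ?c id \<zeta>)) d = (if d \<in> D_Qn C then \<zeta> (pr d) else 1)" for d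
  proof (cases "d \<in> D_Qn C")
    case d: True
    obtain t v where dt: "datum z (\<lambda>x\<in>tor z. id x) d x t v"
      using datum_exists[of z x "\<lambda>x\<in>tor z. id x", OF z x P(4)[OF x] d] by blast
    then have v: "v \<noteq> 0" and t: "t \<in> That C" "tact z t x = x" using x by (auto simp: datum_def)
    have "t = (\<lambda>_. 1)" using O(6)[OF t(1) That_simps(1) x] O(3)[OF x] t(2) by simp
    then show ?thesis using Cgen_eq[OF z m fm d dt] v d by (simp add: cval_def eps_simps(3))
  qed (simp add: Cgen_simps)
  then show ?thesis
    by (simp add: pi1_incl_def E2_incl_def mc prod_eq_iff Cgen_simps fun_eq_iff)
qed

section \<open>The base-point-free fundamental group\<close>

lemma platonic_value:
  assumes g: "g \<in> carrier (pi1_platonic C)" and z: "z \<in> objects C" "z' \<in> objects C"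
  shows "g z \<in> carrier (pi1 C z)" "Cgen z (g z) = Cgen z' (g z')"
proof -
  have o: "is_object C z" "is_object C z'" using z by (auto simp: objects_def)
  show gz: "g z \<in> carrier (pi1 C z)" using g z(1) by (auto simp: pi1_platonic_def PiE_def)
  obtain f \<zeta> where "rep z z' f \<zeta>" by (rule rep_exists[OF o])
  then have \<iota>: "mor_class C z z' f \<zeta> \<in> Mor C z z'" unfolding Mor_iff by blast
  then have "pi1_map z z' (mor_class C z z' f \<zeta>) (g z) = g z'" using g z by (simp add: pi1_platonic_def)
  then show "Cgen z (g z) = Cgen z' (g z')" using pi1_map_rep(2)[OF o \<iota> gz] by simp
qed

text \<open>A compatible family has one common comparison value, so evaluation at \<open>z0\<close>
  is injective. Conversely, the preimages of a given value at all objects form a compatible family: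
  transport preserves the value, and \<open>Cgen\<close> is injective at the target.\<close>

lemma platonic_iso:
  assumes z0: "z0 \<in> objects C"
  shows "(\<lambda>g. Cgen z0 (g z0)) \<in> iso (pi1_platonic C) (E2 C)"
proof -
  have ob: "is_object C z" if "z \<in> objects C" for z using that by (simp add: objects_def)
  note b = Cgen_bij[OF ob]
  let ?\<phi> = "\<lambda>g. Cgen z0 (g z0)"
  have "?\<phi> \<in> hom (pi1_platonic C) (E2 C)"
  proof (rule homI)
    fix g assume g: "g \<in> carrier (pi1_platonic C)"
    show "?\<phi> g \<in> carrier (E2 C)" using Cgen_in_E2[OF ob[OF z0] platonic_value(1)[OF g z0 z0]] .
    fix g' assume g': "g' \<in> carrier (pi1_platonic C)"
    have "(g \<otimes>\<^bsub>pi1_platonic C\<^esub> g') z0 = g z0 \<otimes>\<^bsub>pi1 C z0\<^esub> g' z0" using z0 by (simp add: pi1_platonic_def)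
    then show "?\<phi> (g \<otimes>\<^bsub>pi1_platonic C\<^esub> g') = ?\<phi> g \<otimes>\<^bsub>E2 C\<^esub> ?\<phi> g'"
      using Cgen_mult[OF ob[OF z0] platonic_value(1)[OF g z0 z0] platonic_value(1)[OF g' z0 z0]] by simp
  qed
  moreover have "inj_on ?\<phi> (carrier (pi1_platonic C))"
  proof (rule inj_onI)
    fix g g' assume gg: "g \<in> carrier (pi1_platonic C)" "g' \<in> carrier (pi1_platonic C)" "?\<phi> g = ?\<phi> g'"
    have "g z = g' z" if z: "z \<in> objects C" for z
      using platonic_value(2)[OF gg(1) z z0] platonic_value(2)[OF gg(2) z z0] gg(3)
        inj_onD[OF Cgen_inj[OF ob[OF z]] _ platonic_value(1)[OF gg(1) z z] platonic_value(1)[OF gg(2) z z]] by simp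
    moreover have "g \<in> extensional (objects C)" "g' \<in> extensional (objects C)"
      using gg by (auto simp: pi1_platonic_def PiE_def)
    ultimately show "g = g'" by (intro extensionalityI) auto
  qed
  moreover have "w \<in> ?\<phi> ` carrier (pi1_platonic C)" if w: "w \<in> carrier (E2 C)" for w
  proof -
    define g where "g = (\<lambda>z\<in>objects C. inv_into (carrier (pi1 C z)) (Cgen z) w)"
    have g: "g z \<in> carrier (pi1 C z)" "Cgen z (g z) = w" if z: "z \<in> objects C" for z
    proof -
      have "w \<in> Cgen z ` carrier (pi1 C z)" using b[OF z] w by (simp add: bij_betw_def)
      then show "g z \<in> carrier (pi1 C z)" "Cgen z (g z) = w"
        using z by (auto simp: g_def inv_into_into f_inv_into_f)
    qed
    have "pi1_map z z' \<iota> (g z) = g z'" if z: "z \<in> objects C" "z' \<in> objects C" and \<iota>: "\<iota> \<in> Mor C z z'" for z z' \<iota>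
      by (rule inj_onD[OF Cgen_inj[OF ob[OF z(2)]]])
        (use pi1_map_rep[OF ob[OF z(1)] ob[OF z(2)] \<iota> g(1)[OF z(1)]] g z in auto)
    then have "g \<in> carrier (pi1_platonic C)"
      using g(1) by (auto simp: pi1_platonic_def g_def)
    then show ?thesis using g(2)[OF z0] by (metis image_eqI)
  qed
  ultimately show ?thesis unfolding iso_def bij_betw_def by (auto simp: hom_def)
qed

end

theorem mainTheorem3:
  fixes C :: "('y::ab_group_add, 'k::field, 'd, 'e) bd_data"
  assumes "bd_setting C"
  shows "(\<forall>s1\<in>convenient_splittings C. \<forall>s2\<in>convenient_splittings C.
            \<forall>\<iota>\<in>Mor C (base_point C s1) (base_point C s2).
            \<forall>g\<in>carrier (pi1 C (base_point C s1)).
              C_map C s2 (pi1_map (base_point C s1) (base_point C s2) \<iota> g) = C_map C s1 g) \<and>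
         (\<exists>\<phi>\<in>iso (pi1_platonic C) (E2 C).
            (\<forall>g\<in>carrier (pi1_platonic C). \<forall>z\<in>objects C. fst (\<phi> g) = fst (g z)) \<and>
            (\<forall>\<zeta>\<in>Ztilde C. \<phi> (\<lambda>z\<in>objects C. pi1_incl C z \<zeta>) = E2_incl C \<zeta>) \<and>
            (\<forall>s\<in>convenient_splittings C. \<forall>g\<in>carrier (pi1_platonic C).
               \<phi> g = C_map C s (g (base_point C s))))"
proof -
  interpret bd C by (rule bd.intro) fact
  \<comment> \<open>Any object gives the same isomorphism, since the comparison value of a
    compatible family does not depend on where it is evaluated.\<close>
  obtain z0 where z0: "z0 \<in> objects C" using object_exists by blast
  have bp: "base_point C s \<in> objects C" if "s \<in> convenient_splittings C" for s
    using base_point_object[OF that] by (simp add: objects_def)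
  show ?thesis
  proof (intro conjI ballI bexI[OF _ platonic_iso[OF z0]])
    fix s1 s2 \<iota> g
    assume s: "s1 \<in> convenient_splittings C" "s2 \<in> convenient_splittings C"
      and \<iota>: "\<iota> \<in> Mor C (base_point C s1) (base_point C s2)" and g: "g \<in> carrier (pi1 C (base_point C s1))"
    note M = pi1_map_rep[OF base_point_object[OF s(1)] base_point_object[OF s(2)] \<iota> g]
    show "C_map C s2 (pi1_map (base_point C s1) (base_point C s2) \<iota> g) = C_map C s1 g"
      using M(2) Cgen_base_point[OF s(2) M(1)] Cgen_base_point[OF s(1) g] by simp
  next
    fix g z assume "g \<in> carrier (pi1_platonic C)" "z \<in> objects C"
    then show "fst (Cgen z0 (g z0)) = fst (g z)"
      using platonic_value(2)[of g z z0] z0 by (metis Cgen_simps(1))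
  next
    fix \<zeta> assume "\<zeta> \<in> Ztilde C"
    then show "Cgen z0 ((\<lambda>z\<in>objects C. pi1_incl C z \<zeta>) z0) = E2_incl C \<zeta>"
      using Cgen_incl z0 by (simp add: objects_def)
  next
    fix s g assume s: "s \<in> convenient_splittings C" and g: "g \<in> carrier (pi1_platonic C)"
    show "Cgen z0 (g z0) = C_map C s (g (base_point C s))"
      using platonic_value[OF g bp[OF s] z0] Cgen_base_point[OF s] by simp
  qed
qed

end
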